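(* There exist infinitely many quadratic fields $\mathbb{K}$ such that for each of them there exist infinitely many Diophantine triples over $\mathbb{K}$ whose induced elliptic curves have torsion group $E(\mathbb{K})_{\mathrm{tors}}\cong \mathbb{Z}/2\mathbb{Z}\times\mathbb{Z}/10\mathbb{Z}$.
   Context: For a field $\mathbb{K}$, a Diophantine triple over $\mathbb{K}$ is a set $\{a,b,c\}$ of three distinct nonzero elements of $\mathbb{K}$ such that $ab+1$, $ac+1$ and $bc+1$ are all squares in $\mathbb{K}$. The elliptic curve induced by the Diophantine triple $\{a,b,c\}$ is $E:\ y^2=(ax+1)(bx+1)(cx+1)$ over $\mathbb{K}$. A quadratic field is a field extension of $\mathbb{Q}$ of degree $2$. *)

theory Defs
  imports Complex_Main "HOL-Algebra.Elementary_Groups"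
begin

text \<open>Quadratic fields are realised as subfields of the complex numbers (every
quadratic field embeds into C, and two quadratic subfields of C are isomorphic
iff they are equal).\<close>

definition subfield_C :: "complex set \<Rightarrow> bool" where
  "subfield_C K \<longleftrightarrow> 0 \<in> K \<and> 1 \<in> K \<and>
     (\<forall>x\<in>K. \<forall>y\<in>K. x + y \<in> K \<and> x * y \<in> K) \<and>
     (\<forall>x\<in>K. - x \<in> K) \<and> (\<forall>x\<in>K. x \<noteq> 0 \<longrightarrow> inverse x \<in> K)"

definition quadratic_field :: "complex set \<Rightarrow> bool" where
  "quadratic_field K \<longleftrightarrow> subfield_C K \<and>
     (\<exists>u\<in>K. \<exists>v\<in>K. \<forall>x\<in>K. \<exists>!pq :: rat \<times> rat.
         x = of_rat (fst pq) * u + of_rat (snd pq) * v)"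

definition is_square_in :: "complex set \<Rightarrow> complex \<Rightarrow> bool" where
  "is_square_in K z \<longleftrightarrow> (\<exists>r\<in>K. r\<^sup>2 = z)"

definition diophantine_triple :: "complex set \<Rightarrow> complex \<Rightarrow> complex \<Rightarrow> complex \<Rightarrow> bool" where
  "diophantine_triple K a b c \<longleftrightarrow> a \<in> K \<and> b \<in> K \<and> c \<in> K \<and>
     a \<noteq> b \<and> a \<noteq> c \<and> b \<noteq> c \<and> a \<noteq> 0 \<and> b \<noteq> 0 \<and> c \<noteq> 0 \<and>
     is_square_in K (a * b + 1) \<and> is_square_in K (a * c + 1) \<and> is_square_in K (b * c + 1)"

text \<open>Points of E: y^2 = (ax+1)(bx+1)(cx+1); None is the point at infinity.\<close>
definition ec_rhs :: "complex \<Rightarrow> complex \<Rightarrow> complex \<Rightarrow> complex \<Rightarrow> complex" where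
  "ec_rhs a b c x = (a * x + 1) * (b * x + 1) * (c * x + 1)"

definition ec_points :: "complex set \<Rightarrow> complex \<Rightarrow> complex \<Rightarrow> complex \<Rightarrow> (complex \<times> complex) option set" where
  "ec_points K a b c = insert None
     {Some (x, y) | x y. x \<in> K \<and> y \<in> K \<and> y\<^sup>2 = ec_rhs a b c x}"

text \<open>Chord-and-tangent addition on y^2 = A x^3 + B x^2 + C x + 1 with
A = abc, B = ab+ac+bc, C = a+b+c, identity the point at infinity.\<close>
definition ec_add :: "complex \<Rightarrow> complex \<Rightarrow> complex \<Rightarrow>
    (complex \<times> complex) option \<Rightarrow> (complex \<times> complex) option \<Rightarrow> (complex \<times> complex) option" where
  "ec_add a b c P Q =
     (case P of None \<Rightarrow> Q | Some (x1, y1) \<Rightarrow>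
      (case Q of None \<Rightarrow> P | Some (x2, y2) \<Rightarrow>
        (if x1 = x2 \<and> y1 = - y2 then None
         else
          (let A = a * b * c; B = a * b + a * c + b * c; C = a + b + c;
               l = (if x1 = x2 then (3 * A * x1\<^sup>2 + 2 * B * x1 + C) / (2 * y1)
                    else (y2 - y1) / (x2 - x1));
               n = y1 - l * x1;
               x3 = (l\<^sup>2 - B) / A - x1 - x2
           in Some (x3, - (l * x3 + n))))))"

fun ec_mul :: "complex \<Rightarrow> complex \<Rightarrow> complex \<Rightarrow> nat \<Rightarrow>
    (complex \<times> complex) option \<Rightarrow> (complex \<times> complex) option" where
  "ec_mul a b c 0 P = None"
| "ec_mul a b c (Suc n) P = ec_add a b c P (ec_mul a b c n P)"

definition ec_torsion :: "complex set \<Rightarrow> complex \<Rightarrow> complex \<Rightarrow> complex \<Rightarrow> (complex \<times> complex) option set" where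
  "ec_torsion K a b c = {P \<in> ec_points K a b c. \<exists>n>0. ec_mul a b c n P = None}"

definition ec_torsion_group :: "complex set \<Rightarrow> complex \<Rightarrow> complex \<Rightarrow> complex \<Rightarrow> (complex \<times> complex) option monoid" where
  "ec_torsion_group K a b c =
     \<lparr>carrier = ec_torsion K a b c, monoid.mult = ec_add a b c, one = None\<rparr>"

end

theory Submission
  imports Defs "HOL-Computational_Algebra.Polynomial" "HOL-Computational_Algebra.Primes"
begin

text \<open>
For rational \<open>m\<close> put \<open>h = (m\<^sup>2 - 2 m + 5) / (4 m)\<close>, \<open>\<delta>\<^sup>2 = h\<close> and \<open>r\<^sup>2 = h\<^sup>2 + h - 1\<close>; then \<open>r\<close> is rational
and \<open>\<delta>\<close> lies in the quadratic field \<open>K\<close> generated by the square root of \<open>m (m\<^sup>2 - 2 m + 5)\<close>.  Take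
Kubert's curve with a rational point \<open>Q\<close> of order 10 whose parameter is \<open>(h + 1) / 2\<close>.  Its
2-torsion is defined over \<open>K\<close>, and \<open>x(2Q) - x(4Q)\<close> is \<open>h\<close> times a rational square, hence a square in
\<open>K\<close>.  Moving \<open>4Q\<close> to \<open>(0, 1)\<close> turns the curve into the one induced by a Diophantine triple
\<open>a, b, c\<close>, on which \<open>(0, 1)\<close> has order 5.

If \<open>m\<close> is congruent to \<open>-1\<close> modulo 5, then 5 is inert in \<open>K\<close>, the curve has good reduction at 5 with
exactly 20 points over the field with 25 elements, and the kernel of reduction has no torsion.  So
the torsion group over \<open>K\<close> has exactly 20 elements.

For fixed \<open>K\<close>, multiplication by 3 on \<open>d y\<^sup>2 = m (m\<^sup>2 - 2 m + 5)\<close> preserves the class of \<open>m\<close> modulo 5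
and increases its 3-adic valuation, which gives infinitely many \<open>m\<close>.  Letting a prime \<open>p\<close> divide
the starting value of \<open>m\<close> exactly once makes \<open>p\<close> ramify in \<open>K\<close>, which gives infinitely many \<open>K\<close>.

Associativity of the group law is read off from ideals of the ring of regular functions: the
class of the maximal ideal of a point determines the point, because no regular function has a single
simple pole at infinity.
\<close>

section \<open>The group law\<close>

text \<open>The equation \<open>r^2 = h^2 + h - 1\<close> is the conic
  \<open>(2 h + 1)^2 - (2 r)^2 = 5\<close>, and \<open>m\<close> is its factor
  \<open>2 h + 1 + 2 r\<close>; this is the origin of the formula for \<open>h\<close>. As
  \<open>h\<close> equals \<open>m (m^2 - 2 m + 5)\<close> divided by the square
  \<open>4 m^2\<close>, the field of \<open>\<delta>\<close> can be read off from \<open>m\<close>.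

  For \<open>m\<close> congruent to -1 modulo 5 one gets \<open>h\<close> congruent to 3. After
  scaling \<open>x\<close> by \<open>\<delta>\<close> the reduced curve is then the same for every
  triple and every field, so a single point count bounds all torsion groups at once, and its value
  20 is already the order of the group sought.

  Infinitely many \<open>m\<close> do not by themselves give infinitely many sets
  \<open>{a, b, c}\<close>. They do here because \<open>(a b c)^2\<close> is a rational number with
  the same 3-adic absolute value as \<open>m\<close>; this is why multiplication by 3 and the 3-adic
  valuation are paired.\<close>

locale triple_curve =
  fixes a b c :: complex
  assumes nonzero: "a \<noteq> 0" "b \<noteq> 0" "c \<noteq> 0"
    and distinct: "a \<noteq> b" "a \<noteq> c" "b \<noteq> c"
begin

abbreviation "A \<equiv> a * b * c"
abbreviation "B \<equiv> a * b + a * c + b * c"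
abbreviation "C \<equiv> a + b + c"
abbreviation "W \<equiv> ec_rhs a b c"
abbreviation add (infixl "\<oplus>\<^sub>E" 65) where "P \<oplus>\<^sub>E Q \<equiv> ec_add a b c P Q"
abbreviation "pts \<equiv> ec_points UNIV a b c"

definition slope_at :: "complex \<Rightarrow> complex" where
  "slope_at x = 3 * A * x\<^sup>2 + 2 * B * x + C"

lemma W_expand: "W x = A * x ^ 3 + B * x\<^sup>2 + C * x + 1"
  by (simp add: ec_rhs_def power2_eq_square power3_eq_cube algebra_simps)

lemma W_eq: "W x = (a * x + 1) * (b * x + 1) * (c * x + 1)"
  by (simp add: ec_rhs_def)

lemma slope_eq: "slope_at x = a * (b * x + 1) * (c * x + 1) + b * (a * x + 1) * (c * x + 1) + c * (a * x + 1) * (b * x + 1)"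
  by (simp add: slope_at_def power2_eq_square algebra_simps)

lemma smooth: "W x = 0 \<Longrightarrow> slope_at x \<noteq> 0"
proof
  have root_unique: "p = q" if "p * x + 1 = 0" "q * x + 1 = 0" for p q
  proof -
    have "(p - q) * x = 0" using that by algebra
    moreover have "x \<noteq> 0" using that by auto
    ultimately show ?thesis by simp
  qed
  assume W0: "W x = 0" and s0: "slope_at x = 0"
  from W0 consider "a * x + 1 = 0" | "b * x + 1 = 0" | "c * x + 1 = 0"
    by (auto simp: W_eq)
  then show False
  proof cases
    case 1
    then have "b * x + 1 = 0 \<or> c * x + 1 = 0" using s0 nonzero by (auto simp: slope_eq)
    then show False using 1 root_unique distinct by metis
  next
    case 2
    then have "a * x + 1 = 0 \<or> c * x + 1 = 0" using s0 nonzero by (auto simp: slope_eq)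
    then show False using 2 root_unique distinct by metis
  next
    case 3
    then have "a * x + 1 = 0 \<or> b * x + 1 = 0" using s0 nonzero by (auto simp: slope_eq)
    then show False using 3 root_unique distinct by metis
  qed
qed

lemma A_nonzero: "A \<noteq> 0"
  using nonzero by simp

section \<open>Regular functions on the affine curve and their pole order at infinity\<close>

definition eqE :: "(complex \<Rightarrow> complex \<Rightarrow> complex) \<Rightarrow> (complex \<Rightarrow> complex \<Rightarrow> complex) \<Rightarrow> bool" (infix "\<approx>" 50) where
  "F \<approx> G \<longleftrightarrow> (\<forall>x y. y\<^sup>2 = W x \<longrightarrow> F x y = G x y)"

text \<open>The coordinate ring of the affine curve: \<open>y^2 = W x\<close> reduces every
  polynomial in \<open>x\<close> and \<open>y\<close> to this shape. Its elements are kept as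
  functions of two complex variables and compared by \<open>\<approx>\<close>, that is on the curve
  only, so no quotient ring is formed.\<close>

definition regular :: "(complex \<Rightarrow> complex \<Rightarrow> complex) set" where
  "regular = {F. \<exists>f g :: complex poly. F \<approx> (\<lambda>x y. poly f x + y * poly g x)}"

lemma regularI: "F \<approx> (\<lambda>x y. poly f x + y * poly g x) \<Longrightarrow> F \<in> regular"
  unfolding regular_def by blast

lemma regularE:
  assumes "F \<in> regular"
  obtains f g where "F \<approx> (\<lambda>x y. poly f x + y * poly g x)"
  using assms unfolding regular_def by blast

lemma regular_const [simp]: "(\<lambda>x y. k) \<in> regular"
  by (rule regularI[of _ "[:k:]" 0]) (simp add: eqE_def)

lemma regular_x [simp]: "(\<lambda>x y. x) \<in> regular"
  by (rule regularI[of _ "[:0, 1:]" 0]) (simp add: eqE_def)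

lemma regular_y [simp]: "(\<lambda>x y. y) \<in> regular"
  by (rule regularI[of _ 0 "[:1:]"]) (simp add: eqE_def)

lemma regular_add [simp]:
  assumes "F \<in> regular" "G \<in> regular"
  shows "(\<lambda>x y. F x y + G x y) \<in> regular"
proof -
  obtain f g where "F \<approx> (\<lambda>x y. poly f x + y * poly g x)" using assms(1) by (rule regularE)
  moreover obtain f' g' where "G \<approx> (\<lambda>x y. poly f' x + y * poly g' x)" using assms(2) by (rule regularE)
  ultimately show ?thesis
    by (intro regularI[of _ "f + f'" "g + g'"]) (auto simp: eqE_def algebra_simps)
qed

lemma poly_W: "poly [:1, C, B, A:] x = W x"
  by (simp add: W_expand power2_eq_square power3_eq_cube algebra_simps)

lemma regular_mult [simp]:
  assumes "F \<in> regular" "G \<in> regular"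
  shows "(\<lambda>x y. F x y * G x y) \<in> regular"
proof -
  obtain f g where 1: "F \<approx> (\<lambda>x y. poly f x + y * poly g x)" using assms(1) by (rule regularE)
  obtain f' g' where 2: "G \<approx> (\<lambda>x y. poly f' x + y * poly g' x)" using assms(2) by (rule regularE)
  have "(\<lambda>x y. F x y * G x y) \<approx>
      (\<lambda>x y. poly (f * f' + g * g' * [:1, C, B, A:]) x + y * poly (f * g' + f' * g) x)"
    unfolding eqE_def
  proof (intro allI impI)
    fix x y :: complex
    assume y: "y\<^sup>2 = W x"
    then have "F x y * G x y = (poly f x + y * poly g x) * (poly f' x + y * poly g' x)"
      using 1 2 by (simp add: eqE_def)
    also have "\<dots> = poly f x * poly f' x + y\<^sup>2 * (poly g x * poly g' x) +
        y * (poly f x * poly g' x + poly f' x * poly g x)"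
      by (simp add: algebra_simps power2_eq_square)
    finally show "F x y * G x y =
        poly (f * f' + g * g' * [:1, C, B, A:]) x + y * poly (f * g' + f' * g) x"
      unfolding y poly_add poly_mult poly_W by (simp add: algebra_simps)
  qed
  then show ?thesis by (rule regularI)
qed

lemma regular_minus [simp]: "F \<in> regular \<Longrightarrow> (\<lambda>x y. - F x y) \<in> regular"
  using regular_mult[of "\<lambda>x y. -1" F] by simp

lemma regular_diff [simp]:
  "F \<in> regular \<Longrightarrow> G \<in> regular \<Longrightarrow> (\<lambda>x y. F x y - G x y) \<in> regular"
  using regular_add[of F "\<lambda>x y. - G x y"] by simp

lemma regular_power [simp]: "F \<in> regular \<Longrightarrow> (\<lambda>x y. F x y ^ n) \<in> regular"
  by (induction n) simp_all

lemma regular_cong: "F \<in> regular \<Longrightarrow> F \<approx> G \<Longrightarrow> G \<in> regular"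
  unfolding regular_def eqE_def by auto

text \<open>The norm \<^term>\<open>\<lambda>x. F x y * F x (- y)\<close> is a polynomial in \<^term>\<open>x\<close>.  Its degree is the pole
order of \<^term>\<open>F\<close> at infinity, which is never 1.\<close>

definition norm_poly :: "(complex \<Rightarrow> complex \<Rightarrow> complex) \<Rightarrow> complex poly" where
  "norm_poly F = (THE p. \<forall>x y. y\<^sup>2 = W x \<longrightarrow> poly p x = F x y * F x (- y))"

abbreviation "pole F \<equiv> degree (norm_poly F)"

text \<open>Every \<open>x\<close> carries a point of the complex curve, so a polynomial in
  \<open>x\<close> is determined by its values on the curve and \<open>norm_poly\<close> is well
  defined.\<close>

lemma ex_y: "\<exists>y. y\<^sup>2 = W x"
  by (rule exI[of _ "csqrt (W x)"]) simp

lemma norm_poly_eqI: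
  assumes "\<And>x y. y\<^sup>2 = W x \<Longrightarrow> poly p x = F x y * F x (- y)"
  shows "norm_poly F = p"
  unfolding norm_poly_def
proof (rule the_equality)
  fix q
  assume q: "\<forall>x y. y\<^sup>2 = W x \<longrightarrow> poly q x = F x y * F x (- y)"
  have "poly q x = poly p x" for x
    using ex_y[of x] q assms by metis
  then show "q = p" by (simp add: poly_eq_poly_eq_iff[symmetric] ext)
qed (use assms in blast)

lemma norm_poly_rep:
  assumes "F \<approx> (\<lambda>x y. poly f x + y * poly g x)"
  shows "norm_poly F = f\<^sup>2 - g\<^sup>2 * [:1, C, B, A:]"
proof (rule norm_poly_eqI)
  fix x y
  assume y: "y\<^sup>2 = W x"
  then have "F x y * F x (- y) = (poly f x + y * poly g x) * (poly f x - y * poly g x)"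
    using assms by (simp add: eqE_def)
  also have "\<dots> = poly f x ^ 2 - y\<^sup>2 * poly g x ^ 2"
    by (simp add: algebra_simps power2_eq_square)
  finally show "poly (f\<^sup>2 - g\<^sup>2 * [:1, C, B, A:]) x = F x y * F x (- y)"
    unfolding y poly_diff poly_mult poly_power poly_W by simp
qed

lemma norm_poly:
  assumes "F \<in> regular" "y\<^sup>2 = W x"
  shows "poly (norm_poly F) x = F x y * F x (- y)"
proof -
  obtain f g where r: "F \<approx> (\<lambda>x y. poly f x + y * poly g x)" using assms(1) by (rule regularE)
  have "F x y * F x (- y) = (poly f x + y * poly g x) * (poly f x - y * poly g x)"
    using r assms(2) by (simp add: eqE_def)
  also have "\<dots> = poly f x ^ 2 - y\<^sup>2 * poly g x ^ 2"
    by (simp add: algebra_simps power2_eq_square)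
  finally show ?thesis
    unfolding norm_poly_rep[OF r] assms(2) poly_diff poly_mult poly_power poly_W by simp
qed

lemma norm_poly_mult:
  assumes "F \<in> regular" "G \<in> regular"
  shows "norm_poly (\<lambda>x y. F x y * G x y) = norm_poly F * norm_poly G"
  by (rule norm_poly_eqI) (simp add: norm_poly[OF assms(1)] norm_poly[OF assms(2)])

lemma norm_poly_cong: "F \<in> regular \<Longrightarrow> F \<approx> G \<Longrightarrow> norm_poly F = norm_poly G"
  by (rule sym, rule norm_poly_eqI) (simp add: norm_poly eqE_def)

text \<open>The norm of \<open>f + y g\<close> is \<open>f^2 - g^2 W\<close>. Its two terms have
  degrees of opposite parity, so their leading terms cannot cancel, and a nonzero \<open>g\<close>
  forces degree at least 3. Pole orders below 3 therefore come from \<open>f\<close> alone and are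
  even.\<close>

lemma pole_cases:
  assumes F: "F \<in> regular" and ne: "\<not> F \<approx> (\<lambda>x y. 0)"
  shows "norm_poly F \<noteq> 0" and "pole F \<noteq> 1"
    and "pole F = 0 \<Longrightarrow> \<exists>k. k \<noteq> 0 \<and> F \<approx> (\<lambda>x y. k)"
    and "pole F = 2 \<Longrightarrow> \<exists>k r. k \<noteq> 0 \<and> F \<approx> (\<lambda>x y. k * (x - r))"
proof -
  obtain f g where r: "F \<approx> (\<lambda>x y. poly f x + y * poly g x)" using F by (rule regularE)
  note n = norm_poly_rep[OF r]
  have dW: "degree [:1, C, B, A:] = 3" using A_nonzero by simp
  have "norm_poly F \<noteq> 0 \<and> pole F \<noteq> 1 \<and> (pole F = 0 \<longrightarrow> (\<exists>k. k \<noteq> 0 \<and> F \<approx> (\<lambda>x y. k))) \<and>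
      (pole F = 2 \<longrightarrow> (\<exists>k r. k \<noteq> 0 \<and> F \<approx> (\<lambda>x y. k * (x - r))))"
  proof (cases "g = 0")
    case True
    then have f0: "f \<noteq> 0" using r ne by (auto simp: eqE_def)
    have d: "pole F = 2 * degree f" using n True f0 by (simp add: degree_power_eq)
    have 0: "\<exists>k. k \<noteq> 0 \<and> F \<approx> (\<lambda>x y. k)" if deg: "degree f = 0"
    proof -
      obtain k where "f = [:k:]" using deg by (rule degree_eq_zeroE)
      then show ?thesis using r True f0 by (auto simp: eqE_def)
    qed
    have 1: "\<exists>k r. k \<noteq> 0 \<and> F \<approx> (\<lambda>x y. k * (x - r))" if deg: "degree f = 1"
    proof -
      obtain k k' where f: "f = [:k', k:]" "k \<noteq> 0"
        using deg by (metis degree1_coeffs)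
      show ?thesis
        by (rule exI[of _ k], rule exI[of _ "- k' / k"])
          (use r True f in \<open>auto simp: eqE_def field_simps\<close>)
    qed
    show ?thesis using d 0 1 n True f0 by auto
  next
    case False
    have d: "degree (g\<^sup>2 * [:1, C, B, A:]) = 2 * degree g + 3"
      using False dW by (subst degree_mult_eq) (auto simp: degree_power_eq A_nonzero)
    have "degree (f\<^sup>2) = 2 * degree f"
      by (cases "f = 0") (simp_all add: degree_power_eq)
    then have "degree (f\<^sup>2) \<noteq> degree (g\<^sup>2 * [:1, C, B, A:])"
      unfolding d by presburger
    then have "degree (f\<^sup>2 - g\<^sup>2 * [:1, C, B, A:]) = max (degree (f\<^sup>2)) (degree (g\<^sup>2 * [:1, C, B, A:]))"
      using degree_add_eq_left[of "- (g\<^sup>2 * [:1, C, B, A:])" "f\<^sup>2"]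
        degree_add_eq_right[of "f\<^sup>2" "- (g\<^sup>2 * [:1, C, B, A:])"]
      by (cases "degree (f\<^sup>2) < degree (g\<^sup>2 * [:1, C, B, A:])") (auto simp del: mult_pCons_right)
    then have "pole F \<ge> 3" using n d by simp
    then show ?thesis by auto
  qed
  then show "norm_poly F \<noteq> 0" and "pole F \<noteq> 1"
    and "pole F = 0 \<Longrightarrow> \<exists>k. k \<noteq> 0 \<and> F \<approx> (\<lambda>x y. k)"
    and "pole F = 2 \<Longrightarrow> \<exists>k r. k \<noteq> 0 \<and> F \<approx> (\<lambda>x y. k * (x - r))" by blast+
qed

text \<open>Multiplicativity of the norm carries the absence of zero divisors over from
  polynomials.\<close>

lemma regular_mult_nonzero:
  assumes "F \<in> regular" "G \<in> regular" "\<not> F \<approx> (\<lambda>x y. 0)" "\<not> G \<approx> (\<lambda>x y. 0)"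
  shows "\<not> (\<lambda>x y. F x y * G x y) \<approx> (\<lambda>x y. 0)"
proof
  assume "(\<lambda>x y. F x y * G x y) \<approx> (\<lambda>x y. 0)"
  then have "norm_poly (\<lambda>x y. F x y * G x y) = norm_poly (\<lambda>x y. 0)"
    using assms by (intro norm_poly_cong) auto
  also have "\<dots> = 0" by (rule norm_poly_eqI) simp
  finally show False
    using pole_cases(1)[OF assms(1,3)] pole_cases(1)[OF assms(2,4)] norm_poly_mult[OF assms(1,2)] by simp
qed

lemma regular_cancel:
  assumes "H \<in> regular" "F \<in> regular" "G \<in> regular" "\<not> H \<approx> (\<lambda>x y. 0)"
    and "(\<lambda>x y. H x y * F x y) \<approx> (\<lambda>x y. H x y * G x y)"
  shows "F \<approx> G"
proof -
  have "(\<lambda>x y. F x y - G x y) \<approx> (\<lambda>x y. 0)"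
    using regular_mult_nonzero[of H "\<lambda>x y. F x y - G x y"] assms
    by (auto simp: eqE_def algebra_simps)
  then show ?thesis by (simp add: eqE_def)
qed

lemma pole_mult:
  assumes "F \<in> regular" "G \<in> regular" "H \<approx> (\<lambda>x y. F x y * G x y)" "\<not> H \<approx> (\<lambda>x y. 0)"
  shows "pole H = pole F + pole G" "\<not> F \<approx> (\<lambda>x y. 0)" "\<not> G \<approx> (\<lambda>x y. 0)"
proof -
  show 1: "\<not> F \<approx> (\<lambda>x y. 0)" "\<not> G \<approx> (\<lambda>x y. 0)" using assms(3,4) by (auto simp: eqE_def)
  have "norm_poly H = norm_poly (\<lambda>x y. F x y * G x y)"
    by (rule norm_poly_cong[symmetric]) (use assms in \<open>auto simp: eqE_def\<close>)
  then show "pole H = pole F + pole G"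
    using pole_cases(1)[OF assms(1) 1(1)] pole_cases(1)[OF assms(2) 1(2)] norm_poly_mult[OF assms(1,2)]
    by (simp add: degree_mult_eq)
qed

lemma pole_x: "pole (\<lambda>x y. x - x0) = 2" "\<not> (\<lambda>x y. x - x0) \<approx> (\<lambda>x y. 0)"
proof -
  have "norm_poly (\<lambda>x y. x - x0) = [:-x0, 1:]\<^sup>2"
    by (rule norm_poly_eqI) (simp add: power2_eq_square algebra_simps)
  then show 1: "pole (\<lambda>x y. x - x0) = 2" by (simp add: degree_power_eq)
  show "\<not> (\<lambda>x y. x - x0) \<approx> (\<lambda>x y. 0)"
    using ex_y[of "x0 + 1"] by (force simp: eqE_def)
qed

lemma pole_line: "pole (\<lambda>x y. y - (l * x + n)) = 3" "\<not> (\<lambda>x y. y - (l * x + n)) \<approx> (\<lambda>x y. 0)"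
proof -
  have "norm_poly (\<lambda>x y. y - (l * x + n)) = [:n, l:]\<^sup>2 - [:1, C, B, A:]"
  proof (rule norm_poly_eqI)
    fix x y :: complex
    assume "y\<^sup>2 = W x"
    then show "poly ([:n, l:]\<^sup>2 - [:1, C, B, A:]) x = (y - (l * x + n)) * (- y - (l * x + n))"
      unfolding poly_diff poly_W by (simp add: power2_eq_square algebra_simps)
  qed
  moreover have "degree ([:n, l:]\<^sup>2 - [:1, C, B, A:]) = 3"
    using A_nonzero by (simp add: power2_eq_square)
  ultimately show 1: "pole (\<lambda>x y. y - (l * x + n)) = 3" by simp
  have "norm_poly (\<lambda>x y. 0) = 0" by (rule norm_poly_eqI) simp
  then show "\<not> (\<lambda>x y. y - (l * x + n)) \<approx> (\<lambda>x y. 0)"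
    using 1 norm_poly_cong[of "\<lambda>x y. y - (l * x + n)" "\<lambda>x y. 0"] by auto
qed

lemma pole_y: "pole (\<lambda>x y. y - y0) = 3" "\<not> (\<lambda>x y. y - y0) \<approx> (\<lambda>x y. 0)"
  using pole_line[of 0 y0] by simp_all

section \<open>Ideals of the coordinate ring and their classes\<close>

definition fn_ideal :: "(complex \<Rightarrow> complex \<Rightarrow> complex) set \<Rightarrow> bool" where
  "fn_ideal I \<longleftrightarrow> I \<subseteq> regular \<and> (\<lambda>x y. 0) \<in> I \<and> (\<forall>F G. F \<in> I \<longrightarrow> F \<approx> G \<longrightarrow> G \<in> I) \<and>
     (\<forall>F\<in>I. \<forall>G\<in>I. (\<lambda>x y. F x y + G x y) \<in> I) \<and>
     (\<forall>F\<in>regular. \<forall>G\<in>I. (\<lambda>x y. F x y * G x y) \<in> I)"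

text \<open>The principal multiple \<open>h I\<close>. Equality of \<open>scale h I\<close> and
  \<open>scale k J\<close> with nonzero \<open>h\<close> and \<open>k\<close> expresses that
  \<open>I\<close> and \<open>J\<close> lie in the same ideal class, without fractional
  ideals.\<close>

definition scale :: "(complex \<Rightarrow> complex \<Rightarrow> complex) \<Rightarrow> (complex \<Rightarrow> complex \<Rightarrow> complex) set \<Rightarrow> (complex \<Rightarrow> complex \<Rightarrow> complex) set" where
  "scale h I = {H. \<exists>F\<in>I. H \<approx> (\<lambda>x y. h x y * F x y)}"

text \<open>\<open>mulP P I\<close> is the product of \<open>I\<close> with the maximal ideal of \<open>P\<close>.\<close>

fun mulP :: "(complex \<times> complex) option \<Rightarrow> (complex \<Rightarrow> complex \<Rightarrow> complex) set \<Rightarrow> (complex \<Rightarrow> complex \<Rightarrow> complex) set" where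
  "mulP None I = I"
| "mulP (Some (x0, y0)) I = {H. \<exists>F\<in>I. \<exists>G\<in>I. H \<approx> (\<lambda>x y. (x - x0) * F x y + (y - y0) * G x y)}"

fun neg :: "(complex \<times> complex) option \<Rightarrow> (complex \<times> complex) option" where
  "neg None = None"
| "neg (Some (x, y)) = Some (x, - y)"

lemma mulP_I: "F \<in> I \<Longrightarrow> G \<in> I \<Longrightarrow> H \<approx> (\<lambda>x y. (x - x0) * F x y + (y - y0) * G x y) \<Longrightarrow> H \<in> mulP (Some (x0, y0)) I"
  by auto

lemma scale_I: "F \<in> I \<Longrightarrow> H \<approx> (\<lambda>x y. h x y * F x y) \<Longrightarrow> H \<in> scale h I"
  by (auto simp: scale_def)

lemma fn_idealD:
  assumes "fn_ideal I"
  shows "F \<in> I \<Longrightarrow> F \<in> regular" "(\<lambda>x y. 0) \<in> I" "F \<in> I \<Longrightarrow> F \<approx> G \<Longrightarrow> G \<in> I"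
    "F \<in> I \<Longrightarrow> G \<in> I \<Longrightarrow> (\<lambda>x y. F x y + G x y) \<in> I"
    "H \<in> regular \<Longrightarrow> G \<in> I \<Longrightarrow> (\<lambda>x y. H x y * G x y) \<in> I"
  using assms unfolding fn_ideal_def by blast+

lemma fn_ideal_diff:
  assumes "fn_ideal I" "F \<in> I" "G \<in> I"
  shows "(\<lambda>x y. F x y - G x y) \<in> I"
  using fn_idealD(4)[OF assms(1,2) fn_idealD(5)[OF assms(1) regular_const[of "-1"] assms(3)]] by simp

lemma eqE_sym: "F \<approx> G \<Longrightarrow> G \<approx> F" and eqE_refl [simp]: "F \<approx> F"
  by (auto simp: eqE_def)

lemma fn_ideal_regular [simp]: "fn_ideal regular"
  unfolding fn_ideal_def using regular_cong by auto

lemma fn_ideal_mulP [simp]: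
  assumes I: "fn_ideal I"
  shows "fn_ideal (mulP P I)"
proof (cases P)
  case (Some Q)
  obtain x0 y0 where Q: "Q = (x0, y0)" by force
  note D = fn_idealD[OF I]
  show ?thesis
    unfolding fn_ideal_def Some Q
  proof (intro conjI allI ballI impI subsetI)
    fix H assume "H \<in> mulP (Some (x0, y0)) I"
    then obtain F G where FG: "F \<in> I" "G \<in> I" and H: "H \<approx> (\<lambda>x y. (x - x0) * F x y + (y - y0) * G x y)" by auto
    show "H \<in> regular"
      by (rule regular_cong[OF _ eqE_sym[OF H]]) (use FG D(1) in simp)
  next
    show "(\<lambda>x y. 0) \<in> mulP (Some (x0, y0)) I"
      using D(2) by (auto intro!: bexI[of _ "\<lambda>x y. 0"])
  next
    fix F G assume "F \<in> mulP (Some (x0, y0)) I" "F \<approx> G"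
    then obtain F1 F2 where "F1 \<in> I" "F2 \<in> I" "F \<approx> (\<lambda>x y. (x - x0) * F1 x y + (y - y0) * F2 x y)" by auto
    then show "G \<in> mulP (Some (x0, y0)) I"
      using \<open>F \<approx> G\<close> by (intro mulP_I[of F1 _ F2]) (auto simp: eqE_def)
  next
    fix H H' assume "H \<in> mulP (Some (x0, y0)) I" "H' \<in> mulP (Some (x0, y0)) I"
    then obtain F G F' G' where FG: "F \<in> I" "G \<in> I" and H: "H \<approx> (\<lambda>x y. (x - x0) * F x y + (y - y0) * G x y)"
      and FG': "F' \<in> I" "G' \<in> I" and H': "H' \<approx> (\<lambda>x y. (x - x0) * F' x y + (y - y0) * G' x y)" by auto
    have "(\<lambda>x y. H x y + H' x y) \<approx> (\<lambda>x y. (x - x0) * (F x y + F' x y) + (y - y0) * (G x y + G' x y))"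
      using H H' by (simp add: eqE_def distrib_left)
    then show "(\<lambda>x y. H x y + H' x y) \<in> mulP (Some (x0, y0)) I"
      using D(4)[OF FG(1) FG'(1)] D(4)[OF FG(2) FG'(2)] by auto
  next
    fix K H assume K: "K \<in> regular" and "H \<in> mulP (Some (x0, y0)) I"
    then obtain F G where FG: "F \<in> I" "G \<in> I" and H: "H \<approx> (\<lambda>x y. (x - x0) * F x y + (y - y0) * G x y)" by auto
    have "(\<lambda>x y. K x y * H x y) \<approx> (\<lambda>x y. (x - x0) * (K x y * F x y) + (y - y0) * (K x y * G x y))"
      using H by (simp add: eqE_def distrib_left mult.left_commute)
    then show "(\<lambda>x y. K x y * H x y) \<in> mulP (Some (x0, y0)) I"
      using D(5)[OF K FG(1)] D(5)[OF K FG(2)] by auto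
  qed
qed (use I in simp)

lemma mulP_commute_le:
  assumes I: "fn_ideal I"
  shows "mulP P (mulP Q I) \<subseteq> mulP Q (mulP P I)"
proof (cases "P = None \<or> Q = None")
  case False
  then obtain x1 y1 x2 y2 where PQ: "P = Some (x1, y1)" "Q = Some (x2, y2)" by (metis option.exhaust surj_pair)
  show ?thesis
  proof
    fix H assume "H \<in> mulP P (mulP Q I)"
    then obtain F G F1 F2 G1 G2 where m: "F1 \<in> I" "F2 \<in> I" "G1 \<in> I" "G2 \<in> I"
      and H: "H \<approx> (\<lambda>x y. (x - x1) * F x y + (y - y1) * G x y)"
      and F: "F \<approx> (\<lambda>x y. (x - x2) * F1 x y + (y - y2) * F2 x y)"
      and G: "G \<approx> (\<lambda>x y. (x - x2) * G1 x y + (y - y2) * G2 x y)"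
      unfolding PQ by auto
    have "H \<approx> (\<lambda>x y. (x - x2) * ((x - x1) * F1 x y + (y - y1) * G1 x y) + (y - y2) * ((x - x1) * F2 x y + (y - y1) * G2 x y))"
      unfolding eqE_def
    proof (intro allI impI)
      fix x y assume "y\<^sup>2 = W x"
      then have "H x y = (x - x1) * ((x - x2) * F1 x y + (y - y2) * F2 x y) + (y - y1) * ((x - x2) * G1 x y + (y - y2) * G2 x y)"
        using H F G by (simp add: eqE_def)
      then show "H x y = (x - x2) * ((x - x1) * F1 x y + (y - y1) * G1 x y) + (y - y2) * ((x - x1) * F2 x y + (y - y1) * G2 x y)"
        by (simp add: algebra_simps)
    qed
    moreover have "(\<lambda>x y. (x - x1) * F1 x y + (y - y1) * G1 x y) \<in> mulP P I"
      "(\<lambda>x y. (x - x1) * F2 x y + (y - y1) * G2 x y) \<in> mulP P I"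
      unfolding PQ using m mulP_I[OF _ _ eqE_refl] by blast+
    ultimately show "H \<in> mulP Q (mulP P I)" unfolding PQ using mulP_I by blast
  qed
qed auto

lemma mulP_commute: "fn_ideal I \<Longrightarrow> mulP P (mulP Q I) = mulP Q (mulP P I)"
  using mulP_commute_le by blast

lemma scale_scale: "scale h (scale k I) = scale (\<lambda>x y. h x y * k x y) I"
proof (intro equalityI subsetI)
  fix H assume "H \<in> scale h (scale k I)"
  then obtain F G where "F \<in> I" "G \<approx> (\<lambda>x y. k x y * F x y)" "H \<approx> (\<lambda>x y. h x y * G x y)"
    by (auto simp: scale_def)
  then show "H \<in> scale (\<lambda>x y. h x y * k x y) I"
    by (intro scale_I) (auto simp: eqE_def mult.assoc)
next
  fix H assume "H \<in> scale (\<lambda>x y. h x y * k x y) I"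
  then obtain F where F: "F \<in> I" "H \<approx> (\<lambda>x y. h x y * (k x y * F x y))"
    by (auto simp: scale_def mult.assoc)
  then have "(\<lambda>x y. k x y * F x y) \<in> scale k I" using scale_I[OF _ eqE_refl] by blast
  then show "H \<in> scale h (scale k I)" using scale_I F(2) by blast
qed

lemma mulP_scale: "mulP P (scale h I) = scale h (mulP P I)"
proof (cases P)
  case (Some Q)
  obtain x0 y0 where Q: "Q = (x0, y0)" by force
  show ?thesis unfolding Some Q
  proof (intro equalityI subsetI)
    fix H assume "H \<in> mulP (Some (x0, y0)) (scale h I)"
    then obtain F G F' G' where FG: "F' \<in> I" "G' \<in> I" and "H \<approx> (\<lambda>x y. (x - x0) * F x y + (y - y0) * G x y)"
      "F \<approx> (\<lambda>x y. h x y * F' x y)" "G \<approx> (\<lambda>x y. h x y * G' x y)" by (auto simp: scale_def)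
    then have "H \<approx> (\<lambda>x y. h x y * ((x - x0) * F' x y + (y - y0) * G' x y))"
      by (simp add: eqE_def algebra_simps)
    moreover have "(\<lambda>x y. (x - x0) * F' x y + (y - y0) * G' x y) \<in> mulP (Some (x0, y0)) I"
      using FG mulP_I[OF _ _ eqE_refl] by blast
    ultimately show "H \<in> scale h (mulP (Some (x0, y0)) I)" using scale_I by blast
  next
    fix H assume "H \<in> scale h (mulP (Some (x0, y0)) I)"
    then obtain K F G where FG: "F \<in> I" "G \<in> I" "K \<approx> (\<lambda>x y. (x - x0) * F x y + (y - y0) * G x y)" "H \<approx> (\<lambda>x y. h x y * K x y)"
      by (auto simp: scale_def)
    then have "H \<approx> (\<lambda>x y. (x - x0) * (h x y * F x y) + (y - y0) * (h x y * G x y))"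
      by (auto simp: eqE_def distrib_left mult.left_commute)
    moreover have "(\<lambda>x y. h x y * F x y) \<in> scale h I" "(\<lambda>x y. h x y * G x y) \<in> scale h I"
      using FG scale_I[OF _ eqE_refl] by blast+
    ultimately show "H \<in> mulP (Some (x0, y0)) (scale h I)" using mulP_I by blast
  qed
qed simp

lemma mulP_intro:
  assumes "fn_ideal I" "F \<in> I"
  shows "(\<lambda>x y. (x - x0) * F x y) \<in> mulP (Some (x0, y0)) I"
    and "(\<lambda>x y. (y - y0) * F x y) \<in> mulP (Some (x0, y0)) I"
   apply (rule mulP_I[OF assms(2) fn_idealD(2)[OF assms(1)]], simp)
  apply (rule mulP_I[OF fn_idealD(2)[OF assms(1)] assms(2)], simp)
  done


declare mulP.simps(2) [simp del]

text \<open>The generator \<open>\<eta>\<close> divides elements of known pole order. Since no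
  cofactor has pole order 1, only order 2 remains for \<open>\<eta>\<close> when both points are
  affine; then \<open>\<eta>\<close> is a multiple of some \<open>x - r\<close>, whose zeros are a
  point and its negative.\<close>

lemma principal_imp_inverse:
  assumes V: "V \<in> pts" and U: "U \<in> pts" and \<eta>: "\<eta> \<in> mulP V (mulP U regular)"
    and princ: "\<And>F. F \<in> mulP V (mulP U regular) \<Longrightarrow> \<exists>K\<in>regular. F \<approx> (\<lambda>x y. \<eta> x y * K x y)"
  shows "U = neg V"
proof -
  let ?J = "mulP V (mulP U regular)"
  have J: "fn_ideal ?J" by simp
  have \<eta>reg: "\<eta> \<in> regular" using fn_idealD(1)[OF J \<eta>] .
  have vanish: "F x y = 0" if F: "F \<in> mulP (Some (x, y)) I" and "Some (x, y) \<in> pts" for F I x y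
  proof -
    have "y\<^sup>2 = W x" using that(2) by (simp add: ec_points_def)
    moreover from F obtain F1 F2 where "F \<approx> (\<lambda>u v. (u - x) * F1 u v + (v - y) * F2 u v)"
      by (auto simp: mulP.simps)
    ultimately show ?thesis by (simp add: eqE_def)
  qed
  have van_V: "F x y = 0" if "V = Some (x, y)" "F \<in> ?J" for F x y
    using vanish[of F x y] that V by simp
  have van_U: "F x y = 0" if "U = Some (x, y)" "F \<in> ?J" for F x y
    using vanish[of F x y "mulP V regular"] that U mulP_commute[of regular V U] by simp
  have split: "\<exists>K\<in>regular. F \<approx> (\<lambda>x y. \<eta> x y * K x y) \<and> pole F = pole \<eta> + pole K \<and> \<not> K \<approx> (\<lambda>x y. 0)"
    if "F \<in> ?J" "\<not> F \<approx> (\<lambda>x y. 0)" for F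
    using princ[OF that(1)] pole_mult[OF \<eta>reg _ _ that(2)] by blast
  have \<eta>_nz: "\<not> \<eta> \<approx> (\<lambda>x y. 0)" if "F \<in> ?J" "\<not> F \<approx> (\<lambda>x y. 0)" for F
    using princ[OF that(1)] that(2) pole_mult(2)[OF \<eta>reg _ _ that(2)] by blast
  have no_unit: "pole \<eta> \<noteq> 0" if UV: "U \<noteq> None \<or> V \<noteq> None" and nz: "\<not> \<eta> \<approx> (\<lambda>x y. 0)"
  proof
    assume "pole \<eta> = 0"
    then obtain k where k: "k \<noteq> 0" "\<eta> \<approx> (\<lambda>x y. k)" using pole_cases(3)[OF \<eta>reg nz] by blast
    obtain x y where "U = Some (x, y) \<or> V = Some (x, y)" using UV by (metis option.exhaust surj_pair)
    then have "\<eta> x y = 0" "y\<^sup>2 = W x" using van_U van_V \<eta> U V by (auto simp: ec_points_def)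
    then show False using k by (simp add: eqE_def)
  qed
  \<comment> \<open>One point affine, the other at infinity: \<open>x - x0\<close> and
    \<open>y - y0\<close> have pole orders 2 and 3, so with p the order of \<open>\<eta>\<close> the
    cofactors have orders 2 - p and 3 - p. Neither may be 1, and p is neither 0 nor 1, which is
    impossible.\<close>
  have one_point: False if "mulP (Some (x0, y0)) regular = ?J" "U \<noteq> None \<or> V \<noteq> None" for x0 y0
  proof -
    have X: "(\<lambda>x y. x - x0) \<in> ?J"
      using mulP_intro(1)[of regular "\<lambda>x y. 1" x0 y0] that by simp
    have Y: "(\<lambda>x y. y - y0) \<in> ?J"
      using mulP_intro(2)[of regular "\<lambda>x y. 1" y0 x0] that by simp
    note nz = \<eta>_nz[OF X pole_x(2)]
    obtain K where K: "K \<in> regular" "2 = pole \<eta> + pole K" "\<not> K \<approx> (\<lambda>x y. 0)"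
      using split[OF X pole_x(2)] pole_x(1) by auto
    obtain K' where K': "K' \<in> regular" "3 = pole \<eta> + pole K'" "\<not> K' \<approx> (\<lambda>x y. 0)"
      using split[OF Y pole_y(2)] pole_y(1) by auto
    have "pole \<eta> = 2" using K(2) pole_cases(2)[OF K(1,3)] no_unit[OF that(2) nz] pole_cases(2)[OF \<eta>reg nz]
      by linarith
    then show False using K'(2) pole_cases(2)[OF K'(1,3)] by simp
  qed
  show ?thesis
  proof (cases "U = None \<or> V = None")
    case True
    then show ?thesis using one_point by (cases U; cases V) auto
  next
    case False
    then obtain x1 y1 x2 y2 where UV: "V = Some (x1, y1)" "U = Some (x2, y2)" by (metis option.exhaust surj_pair)
    have on: "y1\<^sup>2 = W x1" "y2\<^sup>2 = W x2" using U V UV by (auto simp: ec_points_def)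
    have XU: "(\<lambda>x y. x - x2) \<in> mulP U regular" and YU: "(\<lambda>x y. y - y2) \<in> mulP U regular"
      unfolding UV using mulP_intro(1)[of regular "\<lambda>x y. 1" x2 y2] mulP_intro(2)[of regular "\<lambda>x y. 1" y2 x2] by simp_all
    have XX: "(\<lambda>x y. (x - x1) * (x - x2)) \<in> ?J" and XY: "(\<lambda>x y. (x - x1) * (y - y2)) \<in> ?J"
      and YY: "(\<lambda>x y. (y - y1) * (y - y2)) \<in> ?J"
      using mulP_intro[OF _ XU, of x1 y1] mulP_intro[OF _ YU] unfolding UV(1) by auto
    have nzXX: "\<not> (\<lambda>x y. (x - x1) * (x - x2)) \<approx> (\<lambda>x y. 0)"
      and nzXY: "\<not> (\<lambda>x y. (x - x1) * (y - y2)) \<approx> (\<lambda>x y. 0)"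
      using regular_mult_nonzero[OF _ _ pole_x(2)[of x1] pole_x(2)[of x2]]
        regular_mult_nonzero[OF _ _ pole_x(2)[of x1] pole_y(2)[of y2]] by simp_all
    have pXX: "pole (\<lambda>x y. (x - x1) * (x - x2)) = 4"
      using pole_mult(1)[OF _ _ eqE_refl nzXX] by (simp add: pole_x(1))
    have pXY: "pole (\<lambda>x y. (x - x1) * (y - y2)) = 5"
      using pole_mult(1)[OF _ _ eqE_refl nzXY] by (simp add: pole_x(1) pole_y(1))
    note nz = \<eta>_nz[OF XX nzXX]
    obtain K where K: "K \<in> regular" "4 = pole \<eta> + pole K" "\<not> K \<approx> (\<lambda>x y. 0)"
      using split[OF XX nzXX] pXX by auto
    obtain K' where K': "K' \<in> regular" "5 = pole \<eta> + pole K'" "\<not> K' \<approx> (\<lambda>x y. 0)"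
      using split[OF XY nzXY] pXY by auto
    \<comment> \<open>The cofactors have orders 4 - p and 5 - p, neither of which is 1; as p itself
      is neither 0 nor 1, this leaves p = 2.\<close>
    have "pole \<eta> = 2"
    proof -
      have "pole \<eta> \<noteq> 0" using no_unit nz False by blast
      moreover have "pole \<eta> \<noteq> 4" using K'(2) pole_cases(2)[OF K'(1,3)] by linarith
      ultimately show ?thesis
        using K(2) pole_cases(2)[OF K(1,3)] pole_cases(2)[OF \<eta>reg nz] by linarith
    qed
    then obtain k r where k: "k \<noteq> 0" "\<eta> \<approx> (\<lambda>x y. k * (x - r))" using pole_cases(4)[OF \<eta>reg nz] by blast
    have x: "x1 = r" "x2 = r"
      using van_V[OF UV(1) \<eta>] van_U[OF UV(2) \<eta>] k on by (auto simp: eqE_def)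
    \<comment> \<open>Evaluating at the mirror point \<open>(r, - y1)\<close>, where
      \<open>\<eta>\<close> vanishes as well, excludes \<open>y2 = y1\<close> unless
      \<open>y1 = 0\<close>.\<close>
    obtain L where L: "(\<lambda>x y. (y - y1) * (y - y2)) \<approx> (\<lambda>x y. \<eta> x y * L x y)"
      using princ[OF YY] by blast
    have "(- y1)\<^sup>2 = W r" using on x by simp
    then have "(- y1 - y1) * (- y1 - y2) = \<eta> r (- y1) * L r (- y1)" "\<eta> r (- y1) = k * (r - r)"
      using L k(2) unfolding eqE_def by blast+
    then have "(- y1 - y1) * (- y1 - y2) = 0" by simp
    moreover have "y2 = y1 \<or> y2 = - y1" using on x by (auto simp: power2_eq_iff[symmetric])
    ultimately have "y2 = - y1" by auto
    then show ?thesis using UV x by simp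
  qed
qed

text \<open>After division by the equation of the line, what remains of the product of the three ideals is
the unit ideal because the curve is smooth.\<close>

lemma line_product:
  assumes on: "y1 = l * x1 + n" "y2 = l * x2 + n" "y3 = l * x3 + n"
    and factor: "\<And>x. W x - (l * x + n)\<^sup>2 = A * (x - x1) * (x - x2) * (x - x3)"
    and nontors: "x1 = x2 \<Longrightarrow> y1 \<noteq> 0" "x1 = x3 \<Longrightarrow> y1 \<noteq> 0" "x2 = x3 \<Longrightarrow> y2 \<noteq> 0"
    and I: "fn_ideal I"
  shows "mulP (Some (x1, y1)) (mulP (Some (x2, y2)) (mulP (Some (x3, y3)) I)) =
    scale (\<lambda>x y. y - (l * x + n)) I" (is "?J = _")
proof (intro equalityI subsetI)
  let ?L = "\<lambda>x y. y - (l * x + n)"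
  note D = fn_idealD[OF I]
  \<comment> \<open>\<open>S q\<close> is the ideal \<open>q I + L I\<close>, where \<open>L\<close>
    is the equation of the line. Since \<open>y - y0 = L + l (x - x0)\<close> for a point on the
    line, multiplication by its maximal ideal leads into \<open>S ((x - x0) q)\<close>. After three
    points \<open>q\<close> is, up to the constant \<open>A\<close>, equal to
    \<open>L (y + l x + n)\<close> on the curve.\<close>
  define S where "S q = {H. \<exists>F\<in>I. \<exists>G\<in>I. H \<approx> (\<lambda>x y. q x y * F x y + ?L x y * G x y)}" for q
  have S_I: "H \<in> S q" if "H \<approx> (\<lambda>x y. q x y * F x y + ?L x y * G x y)" "F \<in> I" "G \<in> I" for H q F G
    unfolding S_def using that by blast
  have step: "mulP (Some (x0, y0)) T \<subseteq> S (\<lambda>x y. (x - x0) * q x y)"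
    if T: "T \<subseteq> S q" and q: "q \<in> regular" and y0: "y0 = l * x0 + n" for T q x0 y0
  proof
    fix H assume "H \<in> mulP (Some (x0, y0)) T"
    then obtain H1 H2 where "H1 \<in> S q" "H2 \<in> S q" and H: "H \<approx> (\<lambda>x y. (x - x0) * H1 x y + (y - y0) * H2 x y)"
      using T by (auto simp: mulP.simps)
    then obtain F1 G1 F2 G2 where m: "F1 \<in> I" "G1 \<in> I" "F2 \<in> I" "G2 \<in> I"
      and e: "H1 \<approx> (\<lambda>x y. q x y * F1 x y + ?L x y * G1 x y)" "H2 \<approx> (\<lambda>x y. q x y * F2 x y + ?L x y * G2 x y)"
      unfolding S_def by blast
    have "H \<approx> (\<lambda>x y. (x - x0) * q x y * (F1 x y + l * F2 x y) +
        ?L x y * ((x - x0) * G1 x y + q x y * F2 x y + (?L x y + l * (x - x0)) * G2 x y))"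
      unfolding eqE_def
    proof (intro allI impI)
      fix x y assume "y\<^sup>2 = W x"
      then have "H x y = (x - x0) * (q x y * F1 x y + ?L x y * G1 x y) + (y - y0) * (q x y * F2 x y + ?L x y * G2 x y)"
        using H e by (simp add: eqE_def)
      then show "H x y = (x - x0) * q x y * (F1 x y + l * F2 x y) +
          ?L x y * ((x - x0) * G1 x y + q x y * F2 x y + (?L x y + l * (x - x0)) * G2 x y)"
        using y0 by algebra
    qed
    moreover have "(\<lambda>x y. F1 x y + l * F2 x y) \<in> I"
      "(\<lambda>x y. (x - x0) * G1 x y + q x y * F2 x y + (?L x y + l * (x - x0)) * G2 x y) \<in> I"
      by (intro D(4) D(5) m q regular_add regular_mult regular_diff regular_x regular_y regular_const)+
    ultimately show "H \<in> S (\<lambda>x y. (x - x0) * q x y)" by (rule S_I)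
  qed
  have "I \<subseteq> S (\<lambda>x y. 1)"
    by (intro subsetI S_I[OF _ _ D(2)]) simp_all
  from step[OF step[OF step[OF this _ on(3)] _ on(2)] _ on(1)]
  have sub: "?J \<subseteq> S (\<lambda>x y. (x - x1) * ((x - x2) * ((x - x3) * 1)))" by simp
  fix H assume "H \<in> ?J"
  then obtain F G where FG: "F \<in> I" "G \<in> I"
    and H: "H \<approx> (\<lambda>x y. (x - x1) * ((x - x2) * ((x - x3) * 1)) * F x y + ?L x y * G x y)"
    using sub unfolding S_def by blast
  have "H \<approx> (\<lambda>x y. ?L x y * ((y + (l * x + n)) * (1 / A * F x y) + G x y))"
    unfolding eqE_def
  proof (intro allI impI)
    fix x y assume y: "y\<^sup>2 = W x"
    have "?L x y * (y + (l * x + n)) = A * ((x - x1) * (x - x2) * (x - x3))"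
      using factor[of x] y by (simp add: power2_eq_square algebra_simps)
    then have p: "(x - x1) * ((x - x2) * ((x - x3) * 1)) = ?L x y * (y + (l * x + n)) * (1 / A)"
      using A_nonzero by simp
    have "H x y = (x - x1) * ((x - x2) * ((x - x3) * 1)) * F x y + ?L x y * G x y"
      using H y unfolding eqE_def by blast
    then show "H x y = ?L x y * ((y + (l * x + n)) * (1 / A * F x y) + G x y)"
      unfolding p by (simp only: distrib_left[of "?L x y" _ "G x y"] mult.assoc)
  qed
  moreover have "(\<lambda>x y. (y + (l * x + n)) * (1 / A * F x y) + G x y) \<in> I"
    by (intro D(4) D(5) FG regular_add regular_mult regular_x regular_y regular_const)
  ultimately show "H \<in> scale ?L I" by (rule scale_I[rotated])
next
  let ?L = "\<lambda>x y. y - (l * x + n)"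
  fix H assume "H \<in> scale ?L I"
  then obtain F where F: "F \<in> I" "H \<approx> (\<lambda>x y. ?L x y * F x y)" by (auto simp: scale_def)
  have J: "fn_ideal ?J" using I by simp
  have gen: "(\<lambda>x y. (x - x0) * F x y) \<in> mulP (Some (x0, y0)) K"
    "(\<lambda>x y. ?L x y * F x y) \<in> mulP (Some (x0, y0)) K"
    if "fn_ideal K" "F \<in> K" "y0 = l * x0 + n" for F K x0 y0
  proof -
    note i = mulP_intro[OF that(1,2)]
    show "(\<lambda>x y. (x - x0) * F x y) \<in> mulP (Some (x0, y0)) K" by (rule i)
    have "fn_ideal (mulP (Some (x0, y0)) K)" using that by simp
    from fn_ideal_diff[OF this i(2) fn_idealD(5)[OF this regular_const[of l] i(1)]]
    show "(\<lambda>x y. ?L x y * F x y) \<in> mulP (Some (x0, y0)) K"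
      by (rule fn_idealD(3)[OF \<open>fn_ideal (mulP (Some (x0, y0)) K)\<close>]) (simp add: eqE_def that algebra_simps)
  qed
  \<comment> \<open>The ideal of all \<open>q\<close> for which \<open>L q F\<close> lies in the
    product; it remains to see that \<open>Q\<close> contains 1.\<close>
  define Q where "Q = {q \<in> regular. (\<lambda>x y. ?L x y * (q x y * F x y)) \<in> ?J}"
  have QI: "q \<in> Q" if "G \<in> ?J" "q \<in> regular" "G \<approx> (\<lambda>x y. ?L x y * (q x y * F x y))" for q G
    using fn_idealD(3)[OF J that(1,3)] that(2) by (simp add: Q_def)
  have Q: "fn_ideal Q"
    unfolding fn_ideal_def
  proof (intro conjI allI ballI impI subsetI)
    show "(\<lambda>x y. 0) \<in> Q" using fn_idealD(2)[OF J] by (simp add: Q_def)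
  next
    fix p q assume "p \<in> Q" "p \<approx> q"
    then show "q \<in> Q" 
      by (intro QI[of "\<lambda>x y. ?L x y * (p x y * F x y)"]) (auto simp: Q_def eqE_def intro: regular_cong)
  next
    fix p q assume "p \<in> Q" "q \<in> Q"
    then show "(\<lambda>x y. p x y + q x y) \<in> Q"
      by (intro QI[OF fn_idealD(4)[OF J, of "\<lambda>x y. ?L x y * (p x y * F x y)" "\<lambda>x y. ?L x y * (q x y * F x y)"]])
        (auto simp: Q_def eqE_def algebra_simps)
  next
    fix p q assume "p \<in> regular" "q \<in> Q"
    then show "(\<lambda>x y. p x y * q x y) \<in> Q"
      by (intro QI[OF fn_idealD(5)[OF J, of p "\<lambda>x y. ?L x y * (q x y * F x y)"]])
        (auto simp: Q_def eqE_def algebra_simps)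
  qed (simp add: Q_def)
  note QD = fn_idealD[OF Q]
  have I1: "fn_ideal (mulP (Some (x3, y3)) I)" and I2: "fn_ideal (mulP (Some (x2, y2)) (mulP (Some (x3, y3)) I))"
    using I by simp_all
  note g3 = gen[OF I F(1) on(3)]
  note g2 = gen[OF I1 _ on(2)]
  note g1 = gen[OF I2 _ on(1)]
  have q12: "(\<lambda>x y. (x - x1) * (x - x2)) \<in> Q"
    by (rule QI[OF g1(1)[OF g2(1)[OF g3(2)]]]) (auto simp: eqE_def algebra_simps)
  have q13: "(\<lambda>x y. (x - x1) * (x - x3)) \<in> Q"
    by (rule QI[OF g1(1)[OF g2(2)[OF g3(1)]]]) (auto simp: eqE_def algebra_simps)
  have q23: "(\<lambda>x y. (x - x2) * (x - x3)) \<in> Q"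
    by (rule QI[OF g1(2)[OF g2(1)[OF g3(1)]]]) (auto simp: eqE_def algebra_simps)
  have LL: "(\<lambda>x y. ?L x y * ?L x y) \<in> Q"
    by (rule QI[OF g1(2)[OF g2(2)[OF g3(2)]]]) (auto simp: eqE_def algebra_simps)
  have L': "(\<lambda>x y. y + (l * x + n)) \<in> Q"
  proof (rule QI[OF fn_idealD(5)[OF J regular_const[of A] g1(1)[OF g2(1)[OF g3(1)]]]])
    show "(\<lambda>x y. A * ((x - x1) * ((x - x2) * ((x - x3) * F x y)))) \<approx>
      (\<lambda>x y. ?L x y * ((y + (l * x + n)) * F x y))"
      unfolding eqE_def
    proof (intro allI impI)
      fix x y assume y: "y\<^sup>2 = W x"
      have "?L x y * (y + (l * x + n)) = A * (x - x1) * (x - x2) * (x - x3)"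
        using factor[of x] y by (simp add: power2_eq_square algebra_simps)
      then show "A * ((x - x1) * ((x - x2) * ((x - x3) * F x y))) = ?L x y * ((y + (l * x + n)) * F x y)"
        by (metis mult.assoc)
    qed
  qed simp
  \<comment> \<open>With \<open>e = l x + n\<close>:
    \<open>(3 e - y) (y + e) + (y - e)^2 = 4 e^2\<close>.\<close>
  have sq: "(\<lambda>x y. (l * x + n)\<^sup>2) \<in> Q"
  proof (rule QD(3)[OF QD(5)[OF regular_const[of "1/4"] QD(4)[OF QD(5)[OF _ L'] LL]]])
    show "(\<lambda>x y. - y + 3 * (l * x + n)) \<in> regular" by simp
  qed (simp add: eqE_def power2_eq_square algebra_simps)
  have const: "(\<lambda>x y. 1) \<in> Q" if "(\<lambda>x y. k) \<in> Q" "k \<noteq> 0" for k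
    using QD(5)[OF regular_const[of "1 / k"] that(1)] that(2) by simp
  have lin: "(\<lambda>x y. x - r) \<in> Q" if "(\<lambda>x y. (x - r) * (x - s)) \<in> Q" "(\<lambda>x y. (x - r) * (x - t)) \<in> Q" "s \<noteq> t" for r s t
    using that(3) by (intro QD(3)[OF QD(5)[OF regular_const[of "1 / (t - s)"] fn_ideal_diff[OF Q that(1,2)]]])
      (simp add: eqE_def field_simps)
  \<comment> \<open>Modulo \<open>x - r\<close> the element \<open>(l x + n)^2\<close> is the
    constant \<open>(l r + n)^2\<close>.\<close>
  have fin: "(\<lambda>x y. 1) \<in> Q" if "(\<lambda>x y. x - r) \<in> Q" "l * r + n \<noteq> 0" for r
  proof (rule const[OF QD(3)[OF fn_ideal_diff[OF Q sq QD(5)[OF _ that(1)]]]])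
    show "(\<lambda>x y. l * ((l * x + n) + (l * r + n))) \<in> regular" by simp
    show "(l * r + n)\<^sup>2 \<noteq> 0" using that(2) by simp
  qed (simp add: eqE_def power2_eq_square algebra_simps)
  have "(\<lambda>x y. 1) \<in> Q"
  proof (cases "x1 = x2")
    case True
    show ?thesis
    proof (cases "x1 = x3")
      case False
      then show ?thesis using fin[OF lin[OF q12 q13]] True nontors(1) on by auto
    next
      case x13: True
      \<comment> \<open>Triple contact: with \<open>c = l x1 + n\<close> and
        \<open>u = l (x - x1)\<close> this is
        \<open>(c - u)^2 (c + u)^2 + u^2 (2 c^2 - u^2) = c^4\<close>, a Bezout identity for
        \<open>(l x + n)^2\<close> and \<open>(x - x1)^2\<close>.\<close>
      have aux: "((l * x1 + n) - l * (x - x1))\<^sup>2 * (l * x + n)\<^sup>2 +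
          (l\<^sup>2 * (2 * (l * x1 + n)\<^sup>2 - l\<^sup>2 * (x - x1)\<^sup>2)) * ((x - x1) * (x - x1)) = (l * x1 + n) ^ 4" for x
        by algebra
      have "(\<lambda>x y. ((l * x1 + n) - l * (x - x1))\<^sup>2 * (l * x + n)\<^sup>2) \<in> Q" by (rule QD(5)[OF _ sq]) simp
      moreover have "(\<lambda>x y. (l\<^sup>2 * (2 * (l * x1 + n)\<^sup>2 - l\<^sup>2 * (x - x1)\<^sup>2)) * ((x - x1) * (x - x2))) \<in> Q"
        by (rule QD(5)[OF _ q12]) simp
      ultimately have "(\<lambda>x y. ((l * x1 + n) - l * (x - x1))\<^sup>2 * (l * x + n)\<^sup>2 +
         (l\<^sup>2 * (2 * (l * x1 + n)\<^sup>2 - l\<^sup>2 * (x - x1)\<^sup>2)) * ((x - x1) * (x - x2))) \<in> Q" by (rule QD(4))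
      then have "(\<lambda>x y. (l * x1 + n) ^ 4) \<in> Q"
      proof (rule QD(3))
        show "(\<lambda>x y. ((l * x1 + n) - l * (x - x1))\<^sup>2 * (l * x + n)\<^sup>2 +
           (l\<^sup>2 * (2 * (l * x1 + n)\<^sup>2 - l\<^sup>2 * (x - x1)\<^sup>2)) * ((x - x1) * (x - x2))) \<approx> (\<lambda>x y. (l * x1 + n) ^ 4)"
          unfolding eqE_def True[symmetric] using aux by simp
      qed
      then show ?thesis by (rule const) (use nontors(1)[OF True] on in simp)
    qed
  next
    case False
    have q21: "(\<lambda>x y. (x - x2) * (x - x1)) \<in> Q" and q31: "(\<lambda>x y. (x - x3) * (x - x1)) \<in> Q"
      and q32: "(\<lambda>x y. (x - x3) * (x - x2)) \<in> Q"
      using q12 q13 q23 by (simp_all add: mult.commute)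
    show ?thesis
    proof (cases "x1 = x3")
      case True
      have "(\<lambda>x y. x - x1) \<in> Q" using lin[OF q31 q32] True False by simp
      then show ?thesis using fin nontors(2)[OF True] on by auto
    next
      case x13: False
      show ?thesis
      proof (cases "x2 = x3")
        case True
        have "(\<lambda>x y. x - x2) \<in> Q" using lin[OF q21 q23] x13 by simp
        then show ?thesis using fin nontors(3)[OF True] on by auto
      next
        case x23: False
        have "(\<lambda>x y. x - x1) \<in> Q" using lin[OF q12 q13] x23 by simp
        moreover have "(\<lambda>x y. x - x2) \<in> Q" using lin[OF q21 q23] x13 by simp
        ultimately have "(\<lambda>x y. (x - x1) - (x - x2)) \<in> Q" by (rule fn_ideal_diff[OF Q])
        then show ?thesis by (intro const[of "x2 - x1"]) (use False in simp_all)
      qed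
    qed
  qed
  then have "(\<lambda>x y. ?L x y * F x y) \<in> ?J" by (simp add: Q_def)
  then show "H \<in> ?J" by (rule fn_idealD(3)[OF J _ eqE_sym[OF F(2)]])
qed


text \<open>One inclusion is \<open>y^2 - y0^2 = (x - x0) Wq\<close>. For the other, a nonzero
  \<open>y0\<close> yields \<open>2 y0 (x - x0)\<close> as the difference of the two mixed
  generators; for \<open>y0 = 0\<close> the value of \<open>Wq\<close> at \<open>x0\<close> is
  \<open>slope_at x0\<close>, which is nonzero because the curve is smooth.\<close>

lemma vertical_product:
  assumes "y0\<^sup>2 = W x0" and I: "fn_ideal I"
  shows "mulP (Some (x0, y0)) (mulP (Some (x0, - y0)) I) = scale (\<lambda>x y. x - x0) I" (is "?J = _")
proof (intro equalityI subsetI)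
  note D = fn_idealD[OF I]
  define Wq where "Wq = (\<lambda>x y :: complex. A * (x\<^sup>2 + x * x0 + x0\<^sup>2) + B * (x + x0) + C)"
  have W_diff: "y\<^sup>2 - y0\<^sup>2 = (x - x0) * Wq x y" if "y\<^sup>2 = W x" for x y
    unfolding that assms(1) W_expand Wq_def by (simp add: algebra_simps power2_eq_square power3_eq_cube)
  {
    fix H assume "H \<in> ?J"
    then obtain F G where FG: "F \<in> mulP (Some (x0, - y0)) I" "G \<in> mulP (Some (x0, - y0)) I"
      and e1: "H \<approx> (\<lambda>x y. (x - x0) * F x y + (y - y0) * G x y)" by (auto simp: mulP.simps(2)[of x0 y0])
    obtain G1 G2 where G12: "G1 \<in> I" "G2 \<in> I"
      and e3: "G \<approx> (\<lambda>x y. (x - x0) * G1 x y + (y - - y0) * G2 x y)" using FG(2) by (auto simp: mulP.simps(2))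
    obtain F1 F2 where F12: "F1 \<in> I" "F2 \<in> I"
      and e2: "F \<approx> (\<lambda>x y. (x - x0) * F1 x y + (y - - y0) * F2 x y)" using FG(1) by (auto simp: mulP.simps(2))
    define T where "T = (\<lambda>x y. (x - x0) * F1 x y + (y - - y0) * F2 x y + (y - y0) * G1 x y + Wq x y * G2 x y)"
    have "H \<approx> (\<lambda>x y. (x - x0) * T x y)"
      unfolding eqE_def
    proof (intro allI impI)
      fix x y assume y: "y\<^sup>2 = W x"
      have "H x y = (x - x0) * ((x - x0) * F1 x y + (y - - y0) * F2 x y + (y - y0) * G1 x y) + (y\<^sup>2 - y0\<^sup>2) * G2 x y"
      proof -
        have "H x y = (x - x0) * ((x - x0) * F1 x y + (y - - y0) * F2 x y) + (y - y0) * ((x - x0) * G1 x y + (y - - y0) * G2 x y)"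
          using e1 e2 e3 y by (simp add: eqE_def)
        then show ?thesis by (simp add: algebra_simps power2_eq_square)
      qed
      then show "H x y = (x - x0) * T x y"
        unfolding W_diff[OF y] T_def by (simp add: algebra_simps)
    qed
    moreover have "T \<in> I"
      unfolding T_def Wq_def
      by (intro D(4) D(5) F12 G12 regular_add regular_mult regular_diff regular_power regular_x regular_y regular_const)
    ultimately show "H \<in> scale (\<lambda>x y. x - x0) I" by (rule scale_I[rotated])
  }
  fix H assume "H \<in> scale (\<lambda>x y. x - x0) I"
  then obtain F where F: "F \<in> I" "H \<approx> (\<lambda>x y. (x - x0) * F x y)" by (auto simp: scale_def)
  have J: "fn_ideal ?J" using I by simp
  note JD = fn_idealD[OF J]
  have I1: "fn_ideal (mulP (Some (x0, - y0)) I)" using I by simp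
  note g = mulP_intro[OF I F(1), of x0 "- y0"] mulP_intro(2)[OF I F(1), of "- y0" x0]
  note XX = mulP_intro(1)[OF I1 g(1), of x0 y0] and YX = mulP_intro(2)[OF I1 g(1), of y0 x0]
    and XY = mulP_intro(1)[OF I1 g(3), of x0 y0] and YY = mulP_intro(2)[OF I1 g(3), of y0 x0]
  have "(\<lambda>x y. (x - x0) * F x y) \<in> ?J"
  proof (cases "y0 = 0")
    case False
    show ?thesis
      by (rule JD(3)[OF JD(5)[OF regular_const[of "1 / (2 * y0)"] fn_ideal_diff[OF J XY YX]]])
        (use False in \<open>simp add: eqE_def field_simps\<close>)
  next
    case True
    then have "slope_at x0 \<noteq> 0" using smooth assms(1) by simp
    have "(\<lambda>x y. (A * (x + 2 * x0) + B)) \<in> regular" by simp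
    from JD(5)[OF regular_const[of "1 / slope_at x0"] fn_ideal_diff[OF J YY JD(5)[OF this XX]]]
    show ?thesis
    proof (rule JD(3))
      show "(\<lambda>x y. 1 / slope_at x0 * ((y - y0) * ((y - - y0) * F x y) - (A * (x + 2 * x0) + B) * ((x - x0) * ((x - x0) * F x y))))
        \<approx> (\<lambda>x y. (x - x0) * F x y)"
        unfolding eqE_def
      proof (intro allI impI)
        fix x y assume y: "y\<^sup>2 = W x"
        have "(y - y0) * ((y - - y0) * F x y) = (y\<^sup>2 - y0\<^sup>2) * F x y" by (simp add: algebra_simps power2_eq_square)
        then have "(y - y0) * ((y - - y0) * F x y) - (A * (x + 2 * x0) + B) * ((x - x0) * ((x - x0) * F x y)) =
           slope_at x0 * ((x - x0) * F x y)"
          unfolding W_diff[OF y] Wq_def slope_at_def by (simp add: algebra_simps power2_eq_square)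
        then show "1 / slope_at x0 * ((y - y0) * ((y - - y0) * F x y) - (A * (x + 2 * x0) + B) * ((x - x0) * ((x - x0) * F x y)))
          = (x - x0) * F x y"
          using \<open>slope_at x0 \<noteq> 0\<close> by simp
      qed
    qed
  qed
  then show "H \<in> ?J" by (rule JD(3)[OF _ eqE_sym[OF F(2)]])
qed

section \<open>The addition law as a relation between ideal classes\<close>

lemma ec_add_None [simp]: "None \<oplus>\<^sub>E Q = Q" "P \<oplus>\<^sub>E None = P"
  by (auto simp: ec_add_def split: option.splits)

lemma pts_Some [simp]: "Some (x, y) \<in> pts \<longleftrightarrow> y\<^sup>2 = W x"
  by (simp add: ec_points_def)

lemma pts_None [simp]: "None \<in> pts"
  by (simp add: ec_points_def)

text \<open>The cubic \<open>W x - (l x + n)^2\<close> has the roots \<open>x1\<close> and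
  \<open>x2\<close>, coinciding in the tangent case. The value \<open>x3\<close> is defined through
  the sum of the roots, and the factorisation follows by comparing the two remaining
  coefficients.\<close>

lemma chord:
  assumes on: "y1\<^sup>2 = W x1" "y2\<^sup>2 = W x2" and ne: "\<not> (x1 = x2 \<and> y1 = - y2)"
  defines "l \<equiv> (if x1 = x2 then slope_at x1 / (2 * y1) else (y2 - y1) / (x2 - x1))"
  defines "n \<equiv> y1 - l * x1"
  defines "x3 \<equiv> (l\<^sup>2 - B) / A - x1 - x2"
  shows "Some (x1, y1) \<oplus>\<^sub>E Some (x2, y2) = Some (x3, - (l * x3 + n))"
    and "y1 = l * x1 + n" "y2 = l * x2 + n"
    and "\<And>x. W x - (l * x + n)\<^sup>2 = A * (x - x1) * (x - x2) * (x - x3)"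
    and "x1 = x2 \<Longrightarrow> y1 = y2 \<and> y1 \<noteq> 0"
proof -
  show "Some (x1, y1) \<oplus>\<^sub>E Some (x2, y2) = Some (x3, - (l * x3 + n))"
    using ne unfolding ec_add_def by (simp add: Let_def l_def n_def x3_def slope_at_def)
  show y1: "y1 = l * x1 + n" by (simp add: n_def)
  show eq: "y1 = y2 \<and> y1 \<noteq> 0" if "x1 = x2"
    using on ne that power2_eq_iff[of y1 y2] by auto
  show y2: "y2 = l * x2 + n"
  proof (cases "x1 = x2")
    case False
    then have "l * (x2 - x1) = y2 - y1" by (simp add: l_def)
    then show ?thesis by (simp add: n_def algebra_simps)
  qed (use eq in \<open>simp add: n_def\<close>)
  have A3: "A * x3 = l\<^sup>2 - B - A * x1 - A * x2"
    using nonzero_mult_div_cancel_left[OF A_nonzero, of "l\<^sup>2 - B"]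
    unfolding x3_def right_diff_distrib[of A] times_divide_eq_right by (simp only:)
  have Z: "C - 2 * l * n = A * (x1 * x2 + x1 * x3 + x2 * x3)"
  proof (cases "x1 = x2")
    case True
    have "2 * y1 * l = slope_at x1" using eq[OF True] True unfolding l_def by auto
    then have "2 * (l * x1 + n) * l = 3 * A * x1\<^sup>2 + 2 * B * x1 + C" unfolding y1[symmetric] slope_at_def .
    then show ?thesis using A3 True[symmetric] by algebra
  next
    case False
    have "(l * x1 + n)\<^sup>2 = A * x1 ^ 3 + B * x1\<^sup>2 + C * x1 + 1" "(l * x2 + n)\<^sup>2 = A * x2 ^ 3 + B * x2\<^sup>2 + C * x2 + 1"
      using on unfolding y1[symmetric] y2[symmetric] W_expand by auto
    then have "(x1 - x2) * (C - 2 * l * n - A * (x1 * x2) - (x1 + x2) * (A * x3)) = 0"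
      unfolding A3 by algebra
    then have "C - 2 * l * n - A * (x1 * x2) - (x1 + x2) * (A * x3) = 0" using False by simp
    then show ?thesis by algebra
  qed
  have Z0: "1 - n\<^sup>2 = - (A * x1 * x2 * x3)"
  proof -
    have "(l * x1 + n)\<^sup>2 = A * x1 ^ 3 + B * x1\<^sup>2 + C * x1 + 1"
      using on unfolding y1[symmetric] W_expand by auto
    then show ?thesis using Z A3 by algebra
  qed
  fix x
  show "W x - (l * x + n)\<^sup>2 = A * (x - x1) * (x - x2) * (x - x3)"
    using A3 Z Z0 unfolding W_expand by algebra
qed

lemma ec_add_pts:
  assumes "P \<in> pts" "Q \<in> pts"
  shows "P \<oplus>\<^sub>E Q \<in> pts"
proof (cases "P = None \<or> Q = None")
  case False
  then obtain x1 y1 x2 y2 where PQ: "P = Some (x1, y1)" "Q = Some (x2, y2)" by (metis option.exhaust surj_pair)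
  show ?thesis
  proof (cases "x1 = x2 \<and> y1 = - y2")
    case True
    then show ?thesis unfolding PQ by (simp add: ec_add_def)
  next
    case ne: False
    have on: "y1\<^sup>2 = W x1" "y2\<^sup>2 = W x2" using assms PQ by auto
    define l where "l = (if x1 = x2 then slope_at x1 / (2 * y1) else (y2 - y1) / (x2 - x1))"
    define n where "n = y1 - l * x1"
    define x3 where "x3 = (l\<^sup>2 - B) / A - x1 - x2"
    note ch = chord[OF on ne, folded l_def, folded n_def x3_def]
    show ?thesis unfolding PQ ch(1) using ch(4)[of x3] by (simp add: power2_eq_square algebra_simps)
  qed
qed (use assms in auto)

lemma neg_pts: "P \<in> pts \<Longrightarrow> neg P \<in> pts" and neg_neg [simp]: "neg (neg P) = P"
  by (cases P; force)+

text \<open>In the ideal class group the classes of \<open>P\<close>, \<open>Q\<close> and the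
  negative of their sum add up to zero. The witness \<open>h\<close> is the chord or tangent, a
  vertical line, or the constant 1.\<close>

lemma ec_add_product:
  assumes "P \<in> pts" "Q \<in> pts"
  shows "\<exists>h\<in>regular. \<not> h \<approx> (\<lambda>x y. 0) \<and>
    (\<forall>I. fn_ideal I \<longrightarrow> mulP P (mulP Q (mulP (neg (P \<oplus>\<^sub>E Q)) I)) = scale h I)"
proof -
  have vertical: "\<exists>h\<in>regular. \<not> h \<approx> (\<lambda>x y. 0) \<and> (\<forall>I. fn_ideal I \<longrightarrow> mulP P (mulP (neg P) I) = scale h I)"
    if P: "P \<in> pts" for P
  proof (cases P)
    case None
    have "scale (\<lambda>x y. 1) I = I" if "fn_ideal I" for I
    proof (intro equalityI subsetI)
      fix F assume "F \<in> scale (\<lambda>x y. 1) I"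
      then obtain G where "G \<in> I" "F \<approx> G" by (auto simp: scale_def)
      then show "F \<in> I" using fn_idealD(3)[OF that] eqE_sym by blast
    qed (simp add: scale_I)
    then show ?thesis using None by (intro bexI[of _ "\<lambda>x y. 1"]) (auto simp: eqE_def intro: ex_y)
  next
    case (Some p)
    obtain x y where "p = (x, y)" by force
    then show ?thesis using Some P vertical_product pole_x by (intro bexI[of _ "\<lambda>u v. u - x"]) auto
  qed
  show ?thesis
  proof (cases "P = None \<or> Q = None")
    case True
    then show ?thesis using vertical assms by auto
  next
    case False
    then obtain x1 y1 x2 y2 where PQ: "P = Some (x1, y1)" "Q = Some (x2, y2)" by (metis option.exhaust surj_pair)
    have on: "y1\<^sup>2 = W x1" "y2\<^sup>2 = W x2" using assms PQ by auto
    show ?thesis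
    proof (cases "x1 = x2 \<and> y1 = - y2")
      case True
      then have "P \<oplus>\<^sub>E Q = None" "Q = neg P" unfolding PQ by (auto simp: ec_add_def)
      then show ?thesis using vertical[OF assms(1)] by simp
    next
      case ne: False
      define l where "l = (if x1 = x2 then slope_at x1 / (2 * y1) else (y2 - y1) / (x2 - x1))"
      define n where "n = y1 - l * x1"
      define x3 where "x3 = (l\<^sup>2 - B) / A - x1 - x2"
      note ch = chord[OF on ne, folded l_def, folded n_def x3_def]
      \<comment> \<open>If \<open>l x + n\<close> vanished at a double root \<open>r\<close> of the
        cubic, then \<open>W\<close> and its derivative \<open>2 l (l r + n)\<close> would both
        vanish at \<open>r\<close>, against smoothness.\<close>
      have double: "l * r + n \<noteq> 0" if f: "\<And>x. W x - (l * x + n)\<^sup>2 = A * (x - r) * (x - r) * (x - s)" for r s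
      proof
        assume z: "l * r + n = 0"
        then have "W r = 0" using f[of r] by simp
        define q where "q = [:1, C, B, A:] - ([:n, l:]\<^sup>2 + [:A:] * [:- r, 1:]\<^sup>2 * [:- s, 1:])"
        have "poly q x = 0" for x
          unfolding q_def poly_diff poly_W using f[of x] by (simp add: power2_eq_square algebra_simps)
        then have "q = 0" using poly_all_0_iff_0 by blast
        then have "pderiv [:1, C, B, A:] = pderiv ([:n, l:]\<^sup>2 + [:A:] * [:- r, 1:]\<^sup>2 * [:- s, 1:])"
          by (simp add: q_def)
        then have "poly (pderiv [:1, C, B, A:]) r = poly (pderiv ([:n, l:]\<^sup>2 + [:A:] * [:- r, 1:]\<^sup>2 * [:- s, 1:])) r"
          by simp
        also have "\<dots> = 2 * l * (l * r + n)"
          by (simp add: pderiv_add pderiv_mult pderiv_power power2_eq_square pderiv_pCons algebra_simps)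
        finally have "poly (pderiv [:1, C, B, A:]) r = 0" unfolding z by simp
        then have "slope_at r = 0"
          by (simp add: slope_at_def pderiv_pCons power2_eq_square algebra_simps)
        then show False using smooth \<open>W r = 0\<close> by blast
      qed
      have "mulP P (mulP Q (mulP (neg (P \<oplus>\<^sub>E Q)) I)) = scale (\<lambda>x y. y - (l * x + n)) I" if I: "fn_ideal I" for I
        unfolding PQ ch(1) neg.simps minus_minus
      proof (rule line_product[OF ch(2,3) refl ch(4) _ _ _ I])
        show "x1 = x2 \<Longrightarrow> y1 \<noteq> 0" using ch(5) by blast
        show "y1 \<noteq> 0" if "x1 = x3"
          unfolding ch(2) by (rule double[of x1 x2]) (simp add: ch(4) that)
        show "y2 \<noteq> 0" if "x2 = x3"
          unfolding ch(3) by (rule double[of x2 x1]) (simp add: ch(4) that)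
      qed
      then show ?thesis by (intro bexI[of _ "\<lambda>x y. y - (l * x + n)"]) (auto simp: pole_line)
    qed
  qed
qed

lemma ec_add_commute:
  assumes "P \<in> pts" "Q \<in> pts"
  shows "P \<oplus>\<^sub>E Q = Q \<oplus>\<^sub>E P"
proof (cases "P = None \<or> Q = None")
  case False
  then obtain x1 y1 x2 y2 where PQ: "P = Some (x1, y1)" "Q = Some (x2, y2)" by (metis option.exhaust surj_pair)
  show ?thesis
  proof (cases "x1 = x2")
    case True
    then have "y1 = y2 \<or> y1 = - y2" using assms PQ power2_eq_iff[of y1 y2] by auto
    then show ?thesis using True unfolding PQ by (auto simp: ec_add_def)
  next
    case False
    define l where "l = (y2 - y1) / (x2 - x1)"
    have l: "(y1 - y2) / (x1 - x2) = l" unfolding l_def by (metis minus_diff_eq minus_divide_divide)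
    have "l * (x2 - x1) = y2 - y1" using False by (simp add: l_def)
    then have n: "y2 - l * x2 = y1 - l * x1" by (simp add: algebra_simps)
    show ?thesis using False unfolding PQ ec_add_def Let_def option.case prod.case l_def[symmetric] l
      by (simp add: n diff_diff_eq add.commute)
  qed
qed auto

lemma ec_add_neg: "P \<oplus>\<^sub>E neg P = None"
  by (cases P) (auto simp: ec_add_def)

text \<open>Multiplication by the ideal of \<open>neg V\<close> makes the right-hand side principal.
  After cancelling \<open>h\<close>, the product of the ideals of \<open>neg V\<close> and
  \<open>U\<close> is principal too, and \<open>principal_imp_inverse\<close> identifies
  \<open>U\<close> with \<open>neg (neg V)\<close>.\<close>

lemma scale_mulP_eq_imp_eq:
  assumes U: "U \<in> pts" and V: "V \<in> pts" and h: "h \<in> regular" "\<not> h \<approx> (\<lambda>x y. 0)" and k: "k \<in> regular" "\<not> k \<approx> (\<lambda>x y. 0)"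
    and eq: "scale h (mulP U regular) = scale k (mulP V regular)"
  shows "U = V"
proof -
  let ?J = "mulP (neg V) (mulP U regular)"
  obtain v where v: "v \<in> regular" "\<not> v \<approx> (\<lambda>x y. 0)" "mulP (neg V) (mulP V regular) = scale v regular"
    using ec_add_product[OF neg_pts[OF V] V] ec_add_neg[of "neg V"] by auto
  have J: "fn_ideal ?J" by simp
  have "scale h ?J = scale k (scale v regular)"
    using arg_cong[OF eq, of "mulP (neg V)"] v(3) by (simp add: mulP_scale)
  then have hJ: "scale h ?J = scale (\<lambda>x y. k x y * v x y) regular" by (simp add: scale_scale)
  have "(\<lambda>x y. k x y * v x y) \<in> scale (\<lambda>x y. k x y * v x y) regular"
    by (rule scale_I[of "\<lambda>x y. 1"]) simp_all
  then obtain \<eta> where \<eta>: "\<eta> \<in> ?J" "(\<lambda>x y. k x y * v x y) \<approx> (\<lambda>x y. h x y * \<eta> x y)"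
    unfolding hJ[symmetric] by (auto simp: scale_def)
  have \<eta>reg: "\<eta> \<in> regular" using fn_idealD(1)[OF J \<eta>(1)] .
  have "U = neg (neg V)"
  proof (rule principal_imp_inverse[OF neg_pts[OF V] U \<eta>(1)])
    fix F assume F: "F \<in> ?J"
    then have "(\<lambda>x y. h x y * F x y) \<in> scale h ?J" by (rule scale_I) simp
    then obtain K where K: "K \<in> regular" "(\<lambda>x y. h x y * F x y) \<approx> (\<lambda>x y. k x y * v x y * K x y)"
      unfolding hJ by (auto simp: scale_def)
    have "(\<lambda>x y. h x y * F x y) \<approx> (\<lambda>x y. h x y * (\<eta> x y * K x y))"
      using K(2) \<eta>(2) by (simp add: eqE_def mult.assoc)
    then have "F \<approx> (\<lambda>x y. \<eta> x y * K x y)"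
      using regular_cancel[OF h(1) fn_idealD(1)[OF J F] regular_mult[OF \<eta>reg K(1)] h(2)] by blast
    then show "\<exists>K\<in>regular. F \<approx> (\<lambda>x y. \<eta> x y * K x y)" using K(1) by blast
  qed
  then show ?thesis by simp
qed

lemma ec_add_assoc:
  assumes "P \<in> pts" "Q \<in> pts" "R \<in> pts"
  shows "(P \<oplus>\<^sub>E Q) \<oplus>\<^sub>E R = P \<oplus>\<^sub>E (Q \<oplus>\<^sub>E R)"
proof -
  define S where "S = P \<oplus>\<^sub>E Q"
  define T where "T = Q \<oplus>\<^sub>E R"
  define U where "U = S \<oplus>\<^sub>E R"
  define V where "V = P \<oplus>\<^sub>E T"
  have pts: "S \<in> pts" "T \<in> pts" "U \<in> pts" "V \<in> pts"
    using assms ec_add_pts by (auto simp: S_def T_def U_def V_def)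
  obtain h1 where h1: "h1 \<in> regular" "\<not> h1 \<approx> (\<lambda>x y. 0)" "\<And>I. fn_ideal I \<Longrightarrow> mulP P (mulP Q (mulP (neg S) I)) = scale h1 I"
    using ec_add_product[OF assms(1,2)] unfolding S_def by blast
  obtain h2 where h2: "h2 \<in> regular" "\<not> h2 \<approx> (\<lambda>x y. 0)" "\<And>I. fn_ideal I \<Longrightarrow> mulP S (mulP R (mulP (neg U) I)) = scale h2 I"
    using ec_add_product[OF pts(1) assms(3)] unfolding U_def by blast
  obtain h3 where h3: "h3 \<in> regular" "\<not> h3 \<approx> (\<lambda>x y. 0)" "\<And>I. fn_ideal I \<Longrightarrow> mulP Q (mulP R (mulP (neg T) I)) = scale h3 I"
    using ec_add_product[OF assms(2,3)] unfolding T_def by blast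
  obtain h4 where h4: "h4 \<in> regular" "\<not> h4 \<approx> (\<lambda>x y. 0)" "\<And>I. fn_ideal I \<Longrightarrow> mulP P (mulP T (mulP (neg V) I)) = scale h4 I"
    using ec_add_product[OF assms(1) pts(2)] unfolding V_def by blast
  obtain s where s: "s \<in> regular" "\<not> s \<approx> (\<lambda>x y. 0)" "\<And>I. fn_ideal I \<Longrightarrow> mulP S (mulP (neg S) I) = scale s I"
    using ec_add_product[OF pts(1) neg_pts[OF pts(1)]] by (auto simp: ec_add_neg)
  obtain t where t: "t \<in> regular" "\<not> t \<approx> (\<lambda>x y. 0)" "\<And>I. fn_ideal I \<Longrightarrow> mulP T (mulP (neg T) I) = scale t I"
    using ec_add_product[OF pts(2) neg_pts[OF pts(2)]] by (auto simp: ec_add_neg)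
  \<comment> \<open>Grouping \<open>P\<close> and \<open>Q\<close> through \<open>S\<close> leaves
    \<open>?D\<close> in the class of \<open>neg V\<close>; grouping \<open>Q\<close> and
    \<open>R\<close> through \<open>T\<close> leaves it in the class of \<open>neg U\<close>. The
    factors \<open>s\<close> and \<open>t\<close> pay for inserting the pairs \<open>S\<close>,
    \<open>neg S\<close> and \<open>T\<close>, \<open>neg T\<close>.\<close>
  let ?D = "mulP P (mulP Q (mulP R (mulP (neg U) (mulP (neg V) regular))))"
  note com = mulP_commute
  have 1: "scale s ?D = scale h1 (scale h2 (mulP (neg V) regular))"
  proof -
    have "scale s ?D = mulP P (mulP Q (mulP R (mulP (neg U) (mulP (neg V) (scale s regular)))))"
      by (simp add: mulP_scale)
    also have "scale s regular = mulP S (mulP (neg S) regular)" by (simp add: s(3))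
    also have "mulP P (mulP Q (mulP R (mulP (neg U) (mulP (neg V) (mulP S (mulP (neg S) regular)))))) =
      mulP P (mulP Q (mulP (neg S) (mulP S (mulP R (mulP (neg U) (mulP (neg V) regular))))))"
      by (simp add: com)
    also have "\<dots> = scale h1 (scale h2 (mulP (neg V) regular))"
      by (simp add: h1(3) h2(3) mulP_scale scale_scale mult.commute)
    finally show ?thesis .
  qed
  have 2: "scale t ?D = scale h3 (scale h4 (mulP (neg U) regular))"
  proof -
    have "scale t ?D = mulP P (mulP Q (mulP R (mulP (neg U) (mulP (neg V) (scale t regular)))))"
      by (simp add: mulP_scale)
    also have "scale t regular = mulP T (mulP (neg T) regular)" by (simp add: t(3))
    also have "mulP P (mulP Q (mulP R (mulP (neg U) (mulP (neg V) (mulP T (mulP (neg T) regular)))))) =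
      mulP Q (mulP R (mulP (neg T) (mulP P (mulP T (mulP (neg V) (mulP (neg U) regular))))))"
      by (simp add: com)
    also have "\<dots> = scale h3 (scale h4 (mulP (neg U) regular))"
      by (simp add: h3(3) h4(3) mulP_scale scale_scale mult.commute)
    finally show ?thesis .
  qed
  have "scale (\<lambda>x y. t x y * (h1 x y * h2 x y)) (mulP (neg V) regular) = scale t (scale s ?D)"
    by (simp add: 1 scale_scale)
  also have "\<dots> = scale s (scale t ?D)" by (simp add: scale_scale mult.commute)
  also have "\<dots> = scale (\<lambda>x y. s x y * (h3 x y * h4 x y)) (mulP (neg U) regular)"
    by (simp add: 2 scale_scale)
  finally have "neg V = neg U"
    using h1(1,2) h2(1,2) h3(1,2) h4(1,2) s(1,2) t(1,2)
    by (intro scale_mulP_eq_imp_eq[OF neg_pts[OF pts(4)] neg_pts[OF pts(3)]])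
      (simp_all add: regular_mult_nonzero)
  then have "V = U" by (metis neg_neg)
  then show ?thesis by (simp add: S_def T_def U_def V_def)
qed

end

section \<open>Reduction at an unramified prime\<close>

lemma subfield_CD:
  assumes "subfield_C K"
  shows "0 \<in> K" "1 \<in> K" "x \<in> K \<Longrightarrow> y \<in> K \<Longrightarrow> x + y \<in> K" "x \<in> K \<Longrightarrow> y \<in> K \<Longrightarrow> x * y \<in> K"
    "x \<in> K \<Longrightarrow> - x \<in> K" "x \<in> K \<Longrightarrow> inverse x \<in> K"
    "x \<in> K \<Longrightarrow> y \<in> K \<Longrightarrow> x - y \<in> K" "x \<in> K \<Longrightarrow> y \<in> K \<Longrightarrow> x / y \<in> K" "x \<in> K \<Longrightarrow> x ^ m \<in> K"
    "numeral k \<in> K" "of_nat m \<in> K"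
proof -
  show K: "0 \<in> K" "1 \<in> K" "\<And>x y. x \<in> K \<Longrightarrow> y \<in> K \<Longrightarrow> x + y \<in> K" "\<And>x y. x \<in> K \<Longrightarrow> y \<in> K \<Longrightarrow> x * y \<in> K"
    "\<And>x. x \<in> K \<Longrightarrow> - x \<in> K"
    using assms by (auto simp: subfield_C_def)
  show inv: "inverse x \<in> K" if "x \<in> K" for x
    using assms that by (cases "x = 0") (auto simp: subfield_C_def)
  show "x \<in> K \<Longrightarrow> y \<in> K \<Longrightarrow> x - y \<in> K" using K(3)[of x "- y"] K(5) by simp
  show "x \<in> K \<Longrightarrow> y \<in> K \<Longrightarrow> x / y \<in> K" using K(4) inv by (simp add: divide_inverse)
  show "x \<in> K \<Longrightarrow> x ^ m \<in> K" by (induction m) (auto intro: K)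
  show nat: "of_nat m \<in> K" for m by (induction m) (auto intro: K)
  show "numeral k \<in> K" using nat[of "numeral k"] by simp
qed

section \<open>The group of points over a subfield and its torsion\<close>

locale triple_curve_over = triple_curve +
  fixes K :: "complex set"
  assumes subfield: "subfield_C K" and abc_K: "a \<in> K" "b \<in> K" "c \<in> K"
begin

lemmas K_closed = subfield_CD[OF subfield]

definition EK :: "(complex \<times> complex) option monoid" where
  "EK = \<lparr>carrier = ec_points K a b c, monoid.mult = ec_add a b c, one = None\<rparr>"

lemma EK_simps [simp]: "carrier EK = ec_points K a b c" "monoid.mult EK = ec_add a b c" "\<one>\<^bsub>EK\<^esub> = None"
  by (simp_all add: EK_def)

lemma EK_pts: "P \<in> ec_points K a b c \<Longrightarrow> P \<in> pts"
  by (auto simp: ec_points_def)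

lemma EK_Some: "Some (x, y) \<in> ec_points K a b c \<longleftrightarrow> x \<in> K \<and> y \<in> K \<and> y\<^sup>2 = W x"
  by (simp add: ec_points_def)

lemma EK_None: "None \<in> ec_points K a b c"
  by (simp add: ec_points_def)

lemma EK_add:
  assumes P: "P \<in> ec_points K a b c" and Q: "Q \<in> ec_points K a b c"
  shows "P \<oplus>\<^sub>E Q \<in> ec_points K a b c"
proof (cases "P = None \<or> Q = None")
  case False
  then obtain x1 y1 x2 y2 where PQ: "P = Some (x1, y1)" "Q = Some (x2, y2)" by (metis option.exhaust surj_pair)
  then have m: "x1 \<in> K" "y1 \<in> K" "x2 \<in> K" "y2 \<in> K" using P Q by (auto simp: EK_Some)
  have "P \<oplus>\<^sub>E Q \<in> insert None (Some ` (K \<times> K))"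
    unfolding PQ ec_add_def Let_def option.case prod.case
    by (auto split: if_splits simp del: minus_add_distrib intro!: K_closed m abc_K)
  then show ?thesis using ec_add_pts[OF EK_pts[OF P] EK_pts[OF Q]] by (auto simp: EK_Some EK_None)
qed (use P Q in auto)

lemma EK_neg: "P \<in> ec_points K a b c \<Longrightarrow> neg P \<in> ec_points K a b c"
  by (cases P) (auto simp: EK_Some K_closed)

sublocale EK: comm_group EK
proof (rule comm_groupI)
  show "\<exists>Q\<in>carrier EK. Q \<otimes>\<^bsub>EK\<^esub> P = \<one>\<^bsub>EK\<^esub>" if "P \<in> carrier EK" for P
    using ec_add_neg[of "neg P"] EK_neg[of P] that by auto
  show "P \<otimes>\<^bsub>EK\<^esub> Q \<otimes>\<^bsub>EK\<^esub> R = P \<otimes>\<^bsub>EK\<^esub> (Q \<otimes>\<^bsub>EK\<^esub> R)"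
    if "P \<in> carrier EK" "Q \<in> carrier EK" "R \<in> carrier EK" for P Q R
    using ec_add_assoc that EK_pts by simp
  show "P \<otimes>\<^bsub>EK\<^esub> Q = Q \<otimes>\<^bsub>EK\<^esub> P" if "P \<in> carrier EK" "Q \<in> carrier EK" for P Q
    using ec_add_commute that EK_pts by simp
qed (use EK_add EK_None in auto)

lemma EK_inv: "P \<in> ec_points K a b c \<Longrightarrow> inv\<^bsub>EK\<^esub> P = neg P"
  using EK.inv_equality[of "neg P" P] ec_add_neg[of "neg P"] EK_neg[of P] by simp

lemma ec_mul_eq_pow: "P \<in> ec_points K a b c \<Longrightarrow> ec_mul a b c n P = P [^]\<^bsub>EK\<^esub> n"
proof (induction n)
  case (Suc n)
  then show ?case
    using EK.nat_pow_Suc2[of P n] by simp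
qed simp

lemma torsion_iff:
  "P \<in> ec_torsion K a b c \<longleftrightarrow> P \<in> ec_points K a b c \<and> (\<exists>n>0::nat. P [^]\<^bsub>EK\<^esub> n = None)"
  unfolding ec_torsion_def using ec_mul_eq_pow by auto

lemma torsion_diff:
  assumes "P \<in> ec_torsion K a b c" "Q \<in> ec_torsion K a b c"
  shows "P \<oplus>\<^sub>E neg Q \<in> ec_torsion K a b c"
proof -
  obtain m n :: nat where mn: "m > 0" "P [^]\<^bsub>EK\<^esub> m = \<one>\<^bsub>EK\<^esub>" "n > 0" "Q [^]\<^bsub>EK\<^esub> n = \<one>\<^bsub>EK\<^esub>"
    and PQ: "P \<in> carrier EK" "Q \<in> carrier EK"
    using assms by (auto simp: torsion_iff)
  let ?Q = "inv\<^bsub>EK\<^esub> Q"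
  have Q': "?Q \<in> carrier EK" using PQ(2) by (rule EK.inv_closed)
  have "P [^]\<^bsub>EK\<^esub> (m * n) = (P [^]\<^bsub>EK\<^esub> m) [^]\<^bsub>EK\<^esub> n"
    using EK.nat_pow_pow[OF PQ(1)] by simp
  then have P1: "P [^]\<^bsub>EK\<^esub> (m * n) = \<one>\<^bsub>EK\<^esub>" unfolding mn(2) using EK.nat_pow_one by simp
  have "?Q [^]\<^bsub>EK\<^esub> (n * m) = (?Q [^]\<^bsub>EK\<^esub> n) [^]\<^bsub>EK\<^esub> m"
    using EK.nat_pow_pow[OF Q'] by simp
  moreover have "?Q [^]\<^bsub>EK\<^esub> n = \<one>\<^bsub>EK\<^esub>"
    using EK.nat_pow_inv[OF PQ(2)] mn(4) EK.inv_one by simp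
  ultimately have Q1: "?Q [^]\<^bsub>EK\<^esub> (m * n) = \<one>\<^bsub>EK\<^esub>"
    using EK.nat_pow_one by (simp add: mult.commute)
  have "(P \<otimes>\<^bsub>EK\<^esub> ?Q) [^]\<^bsub>EK\<^esub> (m * n) = \<one>\<^bsub>EK\<^esub>"
    using EK.nat_pow_distrib[OF PQ(1) Q', of "m * n"] unfolding P1 Q1 by simp
  then have "(P \<oplus>\<^sub>E neg Q) [^]\<^bsub>EK\<^esub> (m * n) = None"
    using EK_inv[of Q] PQ(2) by simp
  moreover have "P \<oplus>\<^sub>E neg Q \<in> ec_points K a b c" using PQ EK_add EK_neg by simp
  moreover have "m * n > 0" using mn by simp
  ultimately show ?thesis unfolding torsion_iff by blast
qed

end

text \<open>The last assumption says that \<open>q\<close> is a uniformiser, that is, unramified in \<open>K\<close>.\<close>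

locale unramified_abs =
  fixes K :: "complex set" and N :: "complex \<Rightarrow> real" and q :: nat
  assumes subfield: "subfield_C K"
    and prime: "prime q" "q > 2"
    and N0: "N 0 = 0"
    and N_pos: "\<And>x. x \<in> K \<Longrightarrow> x \<noteq> 0 \<Longrightarrow> N x > 0"
    and N_mult: "\<And>x y. x \<in> K \<Longrightarrow> y \<in> K \<Longrightarrow> N (x * y) = N x * N y"
    and N_add: "\<And>x y. x \<in> K \<Longrightarrow> y \<in> K \<Longrightarrow> N (x + y) \<le> max (N x) (N y)"
    and N_unit: "\<And>n::nat. \<not> q dvd n \<Longrightarrow> N (of_nat n) = 1"
    and N_discrete: "\<And>x. x \<in> K \<Longrightarrow> N x < 1 \<Longrightarrow> N x \<le> N (of_nat q)"
begin

lemmas K_closed = subfield_CD[OF subfield]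

lemma N_1 [simp]: "N 1 = 1"
  using N_unit[of 1] prime by simp

lemma N_nonneg [simp]: "x \<in> K \<Longrightarrow> N x \<ge> 0"
  using N_pos[of x] N0 by (cases "x = 0") auto

lemma N_power: "x \<in> K \<Longrightarrow> N (x ^ m) = N x ^ m"
  by (induction m) (auto simp: N_mult K_closed)

lemma N_neg [simp]: "x \<in> K \<Longrightarrow> N (- x) = N x"
proof -
  assume x: "x \<in> K"
  have "N (-1) ^ 2 = 1" using N_mult[of "-1" "-1"] K_closed by (simp add: power2_eq_square)
  then have "N (-1) = 1 \<or> N (-1) = -1" by (simp add: power2_eq_1_iff)
  then have "N (-1) = 1" using N_nonneg[OF K_closed(5)[OF K_closed(2)]] by linarith
  then show ?thesis using N_mult[of "-1" x] x K_closed by simp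
qed

lemma N_diff: "x \<in> K \<Longrightarrow> y \<in> K \<Longrightarrow> N (x - y) \<le> max (N x) (N y)"
  using N_add[of x "- y"] K_closed by simp

lemma N_inverse: "x \<in> K \<Longrightarrow> N (inverse x) = inverse (N x)"
proof (cases "x = 0")
  case False
  assume x: "x \<in> K"
  have "N x * N (inverse x) = 1" using N_mult[of x "inverse x"] x False K_closed by simp
  then show ?thesis by (rule inverse_unique[symmetric])
qed (simp add: N0)

lemma N_divide: "x \<in> K \<Longrightarrow> y \<in> K \<Longrightarrow> N (x / y) = N x / N y"
  by (simp add: divide_inverse N_mult N_inverse K_closed)

lemma N_add_le: "x \<in> K \<Longrightarrow> y \<in> K \<Longrightarrow> N x \<le> r \<Longrightarrow> N y \<le> r \<Longrightarrow> N (x + y) \<le> r"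
  using N_add[of x y] by simp

lemma N_diff_le: "x \<in> K \<Longrightarrow> y \<in> K \<Longrightarrow> N x \<le> r \<Longrightarrow> N y \<le> r \<Longrightarrow> N (x - y) \<le> r"
  using N_diff[of x y] by simp

lemma N_add_less: "x \<in> K \<Longrightarrow> y \<in> K \<Longrightarrow> N x < r \<Longrightarrow> N y < r \<Longrightarrow> N (x + y) < r"
  using N_add[of x y] by simp

lemma N_diff_less: "x \<in> K \<Longrightarrow> y \<in> K \<Longrightarrow> N x < r \<Longrightarrow> N y < r \<Longrightarrow> N (x - y) < r"
  using N_diff[of x y] by simp

lemma N_add_eq: "x \<in> K \<Longrightarrow> y \<in> K \<Longrightarrow> N y < N x \<Longrightarrow> N (x + y) = N x"
  using N_add[of x y] N_diff[of "x + y" y] K_closed(3)[of x y] by (simp add: max_def split: if_splits)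

lemma N_mult_le: "x \<in> K \<Longrightarrow> y \<in> K \<Longrightarrow> N x \<le> r \<Longrightarrow> N y \<le> s \<Longrightarrow> N (x * y) \<le> r * s"
  using mult_mono[of "N x" r "N y" s] order_trans[OF N_nonneg[of x], of r] N_nonneg[of y] by (simp add: N_mult)

lemma N_of_nat: "N (of_nat n) \<le> 1"
  by (induction n) (auto simp: N0 intro!: N_add_le K_closed)

lemma N_numeral: "N (numeral k) \<le> 1"
  using N_of_nat[of "numeral k"] by simp

lemma N_2 [simp]: "N 2 = 1"
proof -
  have "\<not> q dvd 2" using prime(2) by (auto dest: dvd_imp_le)
  then show ?thesis using N_unit[of 2] by simp
qed

end

text \<open>Units \<open>a, b, c\<close> that stay distinct modulo the prime give a reduced cubic
  with three distinct finite roots, and the residue characteristic is odd: this is good reduction of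
  the given model.\<close>

locale good_reduction = triple_curve_over a b c K + unramified_abs K N q
  for a b c K N q +
  assumes N_abc: "N a = 1" "N b = 1" "N c = 1"
    and N_distinct: "N (a - b) = 1" "N (a - c) = 1" "N (b - c) = 1"
begin

lemma N_A: "N A = 1"
  using N_abc abc_K K_closed by (simp add: N_mult)

lemma N_B: "N B \<le> 1"
  using N_abc abc_K by (intro N_add_le) (simp_all add: N_mult K_closed)

lemma N_C: "N C \<le> 1"
  using N_abc abc_K by (intro N_add_le) (simp_all add: K_closed)

lemma ABC_K: "A \<in> K" "B \<in> K" "C \<in> K"
  by (intro K_closed abc_K)+

lemma slope_K: "x \<in> K \<Longrightarrow> slope_at x \<in> K"
  unfolding slope_at_def by (intro K_closed abc_K)

lemma N_W_integral:
  assumes "x \<in> K" "N x \<le> 1"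
  shows "N (W x) \<le> 1"
proof -
  have 1: "N (e * x + 1) \<le> 1" if "e \<in> K" "N e = 1" for e
    using that assms by (intro N_add_le) (auto simp: N_mult K_closed)
  have "N (W x) \<le> 1 * 1 * 1"
    unfolding W_eq by (intro N_mult_le 1 K_closed assms abc_K N_abc)
  then show ?thesis by simp
qed

lemma N_W_large:
  assumes "x \<in> K" "N x > 1"
  shows "N (W x) = N x ^ 3"
proof -
  have 1: "N (e * x + 1) = N x" if "e \<in> K" "N e = 1" for e
    using that assms N_add_eq[of "e * x" 1] by (auto simp: N_mult K_closed)
  have "N (W x) = N x * N x * N x"
    unfolding W_eq using 1[OF abc_K(1) N_abc(1)] 1[OF abc_K(2) N_abc(2)] 1[OF abc_K(3) N_abc(3)]
    by (simp add: N_mult K_closed abc_K assms)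
  then show ?thesis by (simp add: power3_eq_cube)
qed

text \<open>Smoothness of the reduced curve. If the factor \<open>e1 x + 1\<close> is small, the
  others are units, since \<open>e2 (e1 x + 1) - e1 (e2 x + 1) = e2 - e1\<close> is a unit; exactly
  one summand of \<open>slope_eq\<close> then dominates.\<close>

lemma N_slope_unit:
  assumes x: "x \<in> K" "N x \<le> 1" and "N (W x) < 1"
  shows "N (slope_at x) = 1"
proof -
  have unit: "N (e2 * x + 1) = 1"
    if "e1 \<in> K" "e2 \<in> K" "N e1 = 1" "N e2 = 1" "N (e2 - e1) = 1" "N (e1 * x + 1) < 1" for e1 e2
  proof -
    have le: "N (e2 * x + 1) \<le> 1"
      using that x by (intro N_add_le) (auto simp: N_mult K_closed)
    have "\<not> N (e2 * x + 1) < 1"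
    proof
      assume "N (e2 * x + 1) < 1"
      then have "N (e2 * (e1 * x + 1) - e1 * (e2 * x + 1)) < 1"
        using that x by (intro N_diff_less) (auto simp: N_mult K_closed)
      then show False using that by (simp add: algebra_simps)
    qed
    then show ?thesis using le by simp
  qed
  have main: "N (e1 * (e2 * x + 1) * (e3 * x + 1) + e2 * (e1 * x + 1) * (e3 * x + 1) + e3 * (e1 * x + 1) * (e2 * x + 1)) = 1"
    if e: "e1 \<in> K" "e2 \<in> K" "e3 \<in> K" "N e1 = 1" "N e2 = 1" "N e3 = 1"
      and d: "N (e2 - e1) = 1" "N (e3 - e1) = 1" and s: "N (e1 * x + 1) < 1" for e1 e2 e3
  proof -
    let ?m = "e1 * (e2 * x + 1) * (e3 * x + 1)" and ?r = "e2 * (e1 * x + 1) * (e3 * x + 1) + e3 * (e1 * x + 1) * (e2 * x + 1)"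
    have u: "N (e2 * x + 1) = 1" "N (e3 * x + 1) = 1" using unit e d s by auto
    have m: "?m \<in> K" "?r \<in> K" by (intro K_closed e x)+
    have "N ?m = 1" using u e x by (simp add: N_mult K_closed)
    moreover have "N ?r < 1"
      using u e x s by (intro N_add_less) (auto simp: N_mult K_closed)
    ultimately show ?thesis using N_add_eq[of ?m ?r] m by (simp add: add.assoc)
  qed
  have le: "N (e * x + 1) \<le> 1" if "e \<in> K" "N e = 1" for e
    using that x by (intro N_add_le) (auto simp: N_mult K_closed)
  have prod: "N (W x) = N (a * x + 1) * N (b * x + 1) * N (c * x + 1)"
    unfolding W_eq using x abc_K by (simp add: N_mult K_closed)
  have sym: "N (b - a) = 1" "N (c - a) = 1" "N (c - b) = 1"
    using N_distinct N_neg[of "a - b"] N_neg[of "a - c"] N_neg[of "b - c"] K_closed abc_K by auto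
  consider "N (a * x + 1) < 1" | "N (b * x + 1) < 1" | "N (c * x + 1) < 1"
    using prod assms(3) le[OF abc_K(1) N_abc(1)] le[OF abc_K(2) N_abc(2)] le[OF abc_K(3) N_abc(3)]
    by force
  then show ?thesis
  proof cases
    case 1
    then show ?thesis using main[OF abc_K N_abc sym(1,2)] by (simp add: slope_eq)
  next
    case 2
    then show ?thesis using main[OF abc_K(2,1,3) N_abc(2,1,3) N_distinct(1) sym(3)] by (simp add: slope_eq algebra_simps)
  next
    case 3
    then show ?thesis using main[OF abc_K(3,1,2) N_abc(3,1,2) N_distinct(2,3)] by (simp add: slope_eq algebra_simps)
  qed
qed

section \<open>The kernel of reduction in the coordinate x / y at infinity\<close>

fun zc :: "(complex \<times> complex) option \<Rightarrow> complex" where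
  "zc None = 0"
| "zc (Some (x, y)) = x / y"

text \<open>The points that reduce to infinity. On them \<open>zc\<close> is the parameter of the
  formal group, up to sign.\<close>

fun in_kernel :: "(complex \<times> complex) option \<Rightarrow> bool" where
  "in_kernel None \<longleftrightarrow> True"
| "in_kernel (Some (x, y)) \<longleftrightarrow> N x > 1"

lemma zc_K: "P \<in> ec_points K a b c \<Longrightarrow> zc P \<in> K"
  by (cases P) (auto simp: EK_Some K_closed)

text \<open>For large \<open>x\<close> the leading term governs \<open>W\<close>, so
  \<open>N y ^ 2 = N x ^ 3\<close>. In terms of \<open>z = x / y\<close> this gives \<open>x\<close>
  the size of \<open>z^(-2)\<close> and \<open>1 / y\<close> that of \<open>z^3\<close>.\<close>

lemma kernel_affine:
  assumes "x \<in> K" "y \<in> K" "y\<^sup>2 = W x" "N x > 1"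
  shows "y \<noteq> 0" "0 < N (x / y)" "N (x / y) < 1" "N x = 1 / N (x / y) ^ 2" "N (1 / y) = N (x / y) ^ 3"
    "N y > 1"
proof -
  have sq: "N y ^ 2 = N x ^ 3"
    using N_W_large[OF assms(1,4)] N_power[OF assms(2), of 2] assms(3) by simp
  have x0: "N x > 0" using assms(4) by simp
  show y0: "y \<noteq> 0" using sq x0 N0 by auto
  have Ny: "N y > 0" using N_pos[OF assms(2) y0] .
  have z: "N (x / y) = N x / N y" using N_divide assms by simp
  show "0 < N (x / y)" using z Ny x0 by simp
  have z2: "N (x / y) ^ 2 = 1 / N x" unfolding z power_divide sq using x0 by (simp add: field_simps power3_eq_cube power2_eq_square)
  then show "N x = 1 / N (x / y) ^ 2" by simp
  have "N (x / y) ^ 2 < 1" using z2 assms(4) by simp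
  then show "N (x / y) < 1" by (smt (verit) one_le_power)
  have "N (x / y) ^ 3 = N (x / y) ^ 2 * N (x / y)" by (simp add: power3_eq_cube power2_eq_square)
  also have "\<dots> = 1 / N y" unfolding z2 unfolding z using x0 by simp
  finally show "N (1 / y) = N (x / y) ^ 3" using N_divide[of 1 y] K_closed assms by simp
  have "N y ^ 2 > 1" unfolding sq using assms(4) by simp
  then show "N y > 1" using Ny by (smt (verit) power_le_one)
qed

text \<open>The coordinates \<open>z = x / y\<close>, \<open>w = 1 / y\<close> put infinity at the
  origin, where the curve reads \<open>w = A z^3 + B z^2 w + C z w^2 + w^3\<close>. Subtracting two
  instances gives \<open>(w2 - w1) (1 - T) = (z2 - z1) V\<close> with \<open>T\<close> small and
  \<open>V\<close> of size \<open>r^2\<close>. The quotient that is bounded is minus the slope, the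
  sign in which it equals \<open>l / n\<close> in \<open>line_bounds\<close>.\<close>

lemma chord_at_infinity:
  assumes K: "z1 \<in> K" "w1 \<in> K" "z2 \<in> K" "w2 \<in> K"
    and r: "N z1 \<le> r" "N w1 \<le> r" "N z2 \<le> r" "N w2 \<le> r" "r < 1"
    and c1: "w1 = A * z1 ^ 3 + B * z1\<^sup>2 * w1 + C * z1 * w1\<^sup>2 + w1 ^ 3"
    and c2: "w2 = A * z2 ^ 3 + B * z2\<^sup>2 * w2 + C * z2 * w2\<^sup>2 + w2 ^ 3"
  shows "z1 = z2 \<Longrightarrow> w1 = w2" and "N ((w1 - w2) / (z2 - z1)) \<le> r\<^sup>2"
proof -
  define T where "T = B * z2 * z2 + C * z2 * (w1 + w2) + (w1 * w1 + w1 * w2 + w2 * w2)"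
  define V where "V = A * (z1 * z1 + z1 * z2 + z2 * z2) + B * w1 * (z1 + z2) + C * w1 * w1"
  have UV: "(w2 - w1) * (1 - T) = (z2 - z1) * V"
    using c1 c2 unfolding T_def V_def by algebra
  have TV: "T \<in> K" "V \<in> K" unfolding T_def V_def by (intro K_closed K ABC_K)+
  have m: "N (B * x) \<le> r" "N (C * x) \<le> r" "B * x \<in> K" "C * x \<in> K" if "x \<in> K" "N x \<le> r" for x
    using N_mult_le[OF ABC_K(2) that(1) N_B that(2)] N_mult_le[OF ABC_K(3) that(1) N_C that(2)] that K_closed(4) ABC_K
    by simp_all
  have "N T \<le> r * r" unfolding T_def
    by (intro N_add_le N_mult_le m K r) (intro K_closed m K r)+
  moreover have "r * r < 1"
    using r(1,5) N_nonneg[OF K(1)] mult_strict_mono'[of r 1 r 1] by simp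
  ultimately have U: "N (1 - T) = 1" using N_add_eq[of 1 "- T"] TV K_closed(2,5) by simp
  then have U0: "1 - T \<noteq> 0" using N0 by auto
  show "w1 = w2" if "z1 = z2" using UV U0 that by simp
  have "N (A * (z1 * z1 + z1 * z2 + z2 * z2)) \<le> 1 * (r * r)"
    using N_A by (intro N_mult_le[OF ABC_K(1)] N_add_le N_mult_le K r) (auto intro!: K_closed K)
  moreover have "N (B * w1 * (z1 + z2)) \<le> r * r" "N (C * w1 * w1) \<le> r * r"
    by (intro N_mult_le N_add_le m K r; intro K_closed m K r)+
  ultimately have "N V \<le> r * r" unfolding V_def by (intro N_add_le) (auto intro!: K_closed K abc_K)
  then have V: "N (- V / (1 - T)) \<le> r\<^sup>2"
    using N_divide[of "- V" "1 - T"] U TV K_closed(2,5,7) by (simp add: power2_eq_square)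
  show "N ((w1 - w2) / (z2 - z1)) \<le> r\<^sup>2"
  proof (cases "z1 = z2")
    case False
    have "(w1 - w2) * (1 - T) = - V * (z2 - z1)" using UV by algebra
    then have "(w1 - w2) / (z2 - z1) = - V / (1 - T)"
      using U0 False by (subst frac_eq_eq) auto
    then show ?thesis using V by simp
  qed (simp add: N0)
qed

text \<open>In the coordinates \<open>z = x / y\<close>, \<open>w = 1 / y\<close> the line
  \<open>y = l x + n\<close> becomes \<open>w = 1 / n - (l / n) z\<close>, so the bounds concern its
  slope and its intercept.\<close>

lemma line_bounds:
  assumes P1: "x1 \<in> K" "y1 \<in> K" "y1\<^sup>2 = W x1" "N x1 > 1" and P2: "x2 \<in> K" "y2 \<in> K" "y2\<^sup>2 = W x2" "N x2 > 1"
    and ne: "\<not> (x1 = x2 \<and> y1 = - y2)"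
    and r: "N (x1 / y1) \<le> r" "N (x2 / y2) \<le> r" "r < 1"
  defines "l \<equiv> (if x1 = x2 then slope_at x1 / (2 * y1) else (y2 - y1) / (x2 - x1))"
  defines "n \<equiv> y1 - l * x1"
  shows "n \<noteq> 0" "N (l / n) \<le> r\<^sup>2" "N (1 / n) \<le> r ^ 3"
proof -
  note k1 = kernel_affine[OF P1] and k2 = kernel_affine[OF P2]
  have r0: "0 < r" using k1 r by linarith
  have r3r: "r ^ 3 \<le> r" using r0 r(3) by (simp add: power3_eq_cube mult_le_one)
  let ?z1 = "x1 / y1" and ?z2 = "x2 / y2" and ?w1 = "1 / y1" and ?w2 = "1 / y2"
  have zw: "?z1 \<in> K" "?z2 \<in> K" "?w1 \<in> K" "?w2 \<in> K" using P1 P2 K_closed by auto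
  have w3: "N ?w1 \<le> r ^ 3" "N ?w2 \<le> r ^ 3"
    unfolding k1(5) k2(5) using r k1(2) k2(2) by (auto intro!: power_mono)
  then have w: "N ?w1 \<le> r" "N ?w2 \<le> r" using r3r by linarith+
  have lK: "l \<in> K" unfolding l_def using P1 P2 slope_K by (auto intro!: K_closed)
  have nK: "n \<in> K" unfolding n_def by (intro K_closed lK P1)
  have *: "n \<noteq> 0 \<and> N (l / n) \<le> r\<^sup>2"
  proof (cases "x1 = x2")
    case True
    have y: "y1 \<noteq> 0" by (rule k1(1))
    have l: "2 * y1 * l = slope_at x1" using True y by (simp add: l_def)
    \<comment> \<open>The value of \<open>2 y1 n\<close> that the curve equation gives for the
      tangent; the term with \<open>x1 ^ 3\<close> outweighs the rest.\<close>
    define m where "m = - A * x1 ^ 3 + (C * x1 + 2)"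
    have "2 * y1 * n = 2 * y1\<^sup>2 - (2 * y1 * l) * x1" by (simp add: n_def algebra_simps power2_eq_square)
    also have "\<dots> = m" unfolding l P1(3) W_expand slope_at_def m_def by (simp add: algebra_simps power2_eq_square power3_eq_cube)
    finally have n: "2 * y1 * n = m" .
    have "N (- A * x1 ^ 3) = N x1 ^ 3" using N_A ABC_K P1 K_closed by (simp add: N_mult N_power)
    moreover have "N (C * x1 + 2) < N x1 ^ 3"
    proof -
      have "N (C * x1 + 2) \<le> N x1"
        using N_C N_mult_le[OF ABC_K(3) P1(1) N_C order_refl] P1 by (intro N_add_le K_closed abc_K) auto
      also have "\<dots> < N x1 ^ 3" using P1(4) power_strict_increasing[of 1 3 "N x1"] by simp
      finally show ?thesis .
    qed
    ultimately have Nm: "N m = N x1 ^ 3"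
      unfolding m_def using N_add_eq[of "- A * x1 ^ 3" "C * x1 + 2"] K_closed ABC_K P1 by auto
    then have m0: "m \<noteq> 0" using P1(4) N0 by auto
    then have n0: "n \<noteq> 0" using n by auto
    have "l / n = slope_at x1 / m" unfolding n[symmetric] l[symmetric] using y by simp
    moreover have "N (slope_at x1) \<le> N x1 ^ 2"
    proof -
      have 1: "1 \<le> N x1" "N x1 \<le> N x1 ^ 2" using P1(4) by (auto simp: power2_eq_square)
      have a1: "N (3 * A * x1\<^sup>2) \<le> N x1 ^ 2"
        using N_mult_le[of "3 * A" "x1\<^sup>2" 1 "N x1 ^ 2"] N_mult_le[of 3 A 1 1] N_numeral N_A ABC_K K_closed P1 N_power by auto
      have "N (2 * B * x1) \<le> 1 * 1 * N x1"
        by (intro N_mult_le K_closed abc_K P1 N_B) auto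
      then have a2: "N (2 * B * x1) \<le> N x1 ^ 2" using 1 by linarith
      have a3: "N C \<le> N x1 ^ 2" using 1 N_C by linarith
      show ?thesis unfolding slope_at_def by (intro N_add_le a1 a2 a3 K_closed abc_K P1)
    qed
    ultimately have "N (l / n) \<le> N x1 ^ 2 / N x1 ^ 3"
      using N_divide[of "slope_at x1" m] Nm slope_K[OF P1(1)] P1(4) K_closed ABC_K P1 n
      by (metis (no_types, lifting) divide_right_mono lK n_def nK N_nonneg zero_le_power)
    also have "\<dots> = 1 / N x1" using P1(4) by (simp add: field_simps power2_eq_square power3_eq_cube)
    also have "\<dots> = N ?z1 ^ 2" using k1(4) by simp
    also have "\<dots> \<le> r\<^sup>2" using r k1(2) by (intro power_mono) auto
    finally show ?thesis using n0 by simp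
  next
    case False
    have y: "y1 \<noteq> 0" "y2 \<noteq> 0" using k1(1) k2(1) .
    have curve: "1 / v = A * (u / v) ^ 3 + B * (u / v)\<^sup>2 * (1 / v) + C * (u / v) * (1 / v)\<^sup>2 + (1 / v) ^ 3"
      if "v\<^sup>2 = W u" "v \<noteq> 0" for u v :: complex
    proof -
      have "1 / v = v\<^sup>2 / v ^ 3" using that(2) by (simp add: power2_eq_square power3_eq_cube)
      also have "\<dots> = A * (u / v) ^ 3 + B * (u / v)\<^sup>2 * (1 / v) + C * (u / v) * (1 / v)\<^sup>2 + (1 / v) ^ 3"
        unfolding that(1) W_expand using that(2)
        by (simp add: add_divide_distrib power_divide power2_eq_square power3_eq_cube mult.assoc)
      finally show ?thesis .
    qed
    note zb = chord_at_infinity[OF zw(1,3,2,4) r(1) w(1) r(2) w(2) r(3) curve[OF P1(3) y(1)] curve[OF P2(3) y(2)]]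
    have z: "?z1 \<noteq> ?z2"
    proof
      assume e: "?z1 = ?z2"
      then have "y1 = y2" using zb(1) by simp
      then show False using e y False by simp
    qed
    have d: "n * (x2 - x1) = y1 * y2 * (?z2 - ?z1)" "l * (x2 - x1) = y1 * y2 * (?w1 - ?w2)"
    proof -
      show l: "l * (x2 - x1) = y1 * y2 * (?w1 - ?w2)"
        using False y by (simp add: l_def field_simps)
      have "n * (x2 - x1) = y1 * (x2 - x1) - (l * (x2 - x1)) * x1" by (simp add: n_def algebra_simps)
      also have "\<dots> = y1 * y2 * (?z2 - ?z1)" unfolding l using y by (simp add: field_simps)
      finally show "n * (x2 - x1) = y1 * y2 * (?z2 - ?z1)" .
    qed
    have n0: "n \<noteq> 0" using d(1) z y by auto
    have "l / n = (?w1 - ?w2) / (?z2 - ?z1)"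
    proof -
      have "l / n = (l * (x2 - x1)) / (n * (x2 - x1))" using False by simp
      also have "\<dots> = (?w1 - ?w2) / (?z2 - ?z1)" unfolding d using y by simp
      finally show ?thesis .
    qed
    then show ?thesis using n0 zb(2) by simp
  qed
  then show n0: "n \<noteq> 0" and ln: "N (l / n) \<le> r\<^sup>2" by auto
  have "1 / n = ?w1 + l / n * ?z1"
    using n0 k1(1) by (simp add: n_def field_simps)
  moreover have "N (?w1 + l / n * ?z1) \<le> r ^ 3"
  proof (rule N_add_le[OF zw(3) _ w3(1)])
    have lnK: "l / n \<in> K" by (rule K_closed(8)[OF lK nK])
    show "l / n * ?z1 \<in> K" by (rule K_closed(4)[OF lnK zw(1)])
    show "N (l / n * ?z1) \<le> r ^ 3"
      using N_mult_le[OF lnK zw(1) ln r(1)] by (simp only: power3_eq_cube power2_eq_square)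
  qed
  ultimately show "N (1 / n) \<le> r ^ 3" by simp
qed

text \<open>Substituting \<open>w = 1 / n - t z\<close> into the curve gives a cubic in
  \<open>z\<close> whose leading coefficient \<open>D\<close> is a unit and whose roots have sum
  \<open>S\<close> of size \<open>r^3\<close>. The roots belong to \<open>P\<close>,
  \<open>Q\<close> and the negative of their sum, and \<open>zc\<close> is odd.\<close>

lemma kernel_add:
  assumes P: "P \<in> ec_points K a b c" "in_kernel P" and Q: "Q \<in> ec_points K a b c" "in_kernel Q"
    and r: "N (zc P) \<le> r" "N (zc Q) \<le> r" "r < 1"
  shows "in_kernel (P \<oplus>\<^sub>E Q) \<and> N (zc (P \<oplus>\<^sub>E Q) - (zc P + zc Q)) \<le> r ^ 3"
proof (cases "P = None \<or> Q = None")
  case True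
  then show ?thesis using P Q r N0 by auto
next
  case False
  then obtain x1 y1 x2 y2 where PQ: "P = Some (x1, y1)" "Q = Some (x2, y2)" by (metis option.exhaust surj_pair)
  have p1: "x1 \<in> K" "y1 \<in> K" "y1\<^sup>2 = W x1" "N x1 > 1" and p2: "x2 \<in> K" "y2 \<in> K" "y2\<^sup>2 = W x2" "N x2 > 1"
    using P Q PQ by (auto simp: EK_Some)
  have r': "N (x1 / y1) \<le> r" "N (x2 / y2) \<le> r" using r PQ by auto
  have r0: "0 < r" using kernel_affine(2)[OF p1] r' by linarith
  show ?thesis
  proof (cases "x1 = x2 \<and> y1 = - y2")
    case True
    then show ?thesis unfolding PQ using r0 N0 by (simp add: ec_add_def)
  next
    case ne: False
    define l where "l = (if x1 = x2 then slope_at x1 / (2 * y1) else (y2 - y1) / (x2 - x1))"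
    define n where "n = y1 - l * x1"
    define x3 where "x3 = (l\<^sup>2 - B) / A - x1 - x2"
    define y3 where "y3 = l * x3 + n"
    note ch = chord[OF p1(3) p2(3) ne, folded l_def, folded n_def x3_def]
    note lb = line_bounds[OF p1 p2 ne r' r(3), folded l_def, folded n_def]
    have sum: "P \<oplus>\<^sub>E Q = Some (x3, - y3)" unfolding PQ ch(1) y3_def ..
    have K3: "x3 \<in> K" "y3 \<in> K" and on3: "y3\<^sup>2 = W x3"
      using EK_add[OF P(1) Q(1)] K_closed(5)[of "- y3"] unfolding sum by (auto simp: EK_Some)
    have nK: "n \<in> K" and lK: "l \<in> K"
      unfolding n_def l_def using p1 p2 slope_K by (auto intro!: K_closed)
    have y12: "y1 \<noteq> 0" "y2 \<noteq> 0" using kernel_affine(1) p1 p2 by blast+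
    define t where "t = l / n"
    have tK: "t \<in> K" "1 / n \<in> K" unfolding t_def by (intro K_closed lK nK)+
    have Nt: "N t \<le> r\<^sup>2" using lb(2) by (simp add: t_def)
    have r2: "r\<^sup>2 < 1" using r0 r(3) by (simp add: power_less_one_iff)
    have t1: "N t < 1" using Nt r2 by linarith
    define D where "D = A + (- B * t + C * t\<^sup>2 - t ^ 3)"
    have DK: "D \<in> K" unfolding D_def by (intro K_closed ABC_K tK)
    have "N (- B * t + C * t\<^sup>2 - t ^ 3) < 1"
    proof -
      have "N (- B * t) \<le> 1 * r\<^sup>2" "N (C * t\<^sup>2) \<le> 1 * r\<^sup>2" "N (t ^ 3) \<le> r\<^sup>2"
      proof -
        have t2: "N (t\<^sup>2) \<le> r\<^sup>2" "N (t ^ 3) \<le> r\<^sup>2"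
          using N_power[OF tK(1), of 2] N_power[OF tK(1), of 3] Nt t1 N_nonneg[OF tK(1)]
            power_decreasing[of 1 2 "N t"] power_decreasing[of 1 3 "N t"] by auto
        then show "N (t ^ 3) \<le> r\<^sup>2" by simp
        show "N (- B * t) \<le> 1 * r\<^sup>2" using N_B Nt N_neg[OF ABC_K(2)] by (intro N_mult_le K_closed tK abc_K) auto
        show "N (C * t\<^sup>2) \<le> 1 * r\<^sup>2" using N_C t2 by (intro N_mult_le K_closed tK abc_K) auto
      qed
      then have "N (- B * t + C * t\<^sup>2 - t ^ 3) \<le> r\<^sup>2"
        by (intro N_diff_le N_add_le K_closed tK abc_K) auto
      then show ?thesis using r2 by linarith
    qed
    then have ND: "N D = 1"
      unfolding D_def using N_add_eq[of A "- B * t + C * t\<^sup>2 - t ^ 3"] N_A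
        K_closed(7)[OF K_closed(3)[OF K_closed(4)[OF K_closed(5)[OF ABC_K(2)] tK(1)] K_closed(4)[OF ABC_K(3) K_closed(9)[OF tK(1)]]] K_closed(9)[OF tK(1)]]
        ABC_K(1) by metis
    then have D0: "D \<noteq> 0" using N0 by auto
    have l: "l = t * n" using lb(1) by (simp add: t_def)
    have e: "A * x3 = l\<^sup>2 - B - A * (x1 + x2)" "A * (x1 * x2) + (x1 + x2) * (A * x3) = C - 2 * l * n"
      "(A * x3) * (x1 * x2) = n\<^sup>2 - 1"
    proof -
      have f: "W x - (l * x + n)\<^sup>2 = A * (x - x1) * (x - x2) * (x - x3)" for x by (rule ch(4))
      define q where "q = [:1, C, B, A:] - [:n, l:]\<^sup>2 - [:A:] * [:- x1, 1:] * [:- x2, 1:] * [:- x3, 1:]"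
      have "poly q x = 0" for x
        unfolding q_def poly_diff poly_W using f[of x] by (simp add: power2_eq_square algebra_simps)
      then have "q = 0" using poly_all_0_iff_0 by blast
      then have "coeff q 0 = 0" "coeff q 1 = 0" "coeff q 2 = 0" by auto
      then show "A * x3 = l\<^sup>2 - B - A * (x1 + x2)" "A * (x1 * x2) + (x1 + x2) * (A * x3) = C - 2 * l * n"
        "(A * x3) * (x1 * x2) = n\<^sup>2 - 1"
        unfolding q_def by (simp_all add: power2_eq_square numeral_2_eq_2 algebra_simps)
    qed
    have prod: "A * (y1 * y2 * y3) = n ^ 3 * D"
      unfolding ch(2,3) y3_def D_def using e l by algebra
    have y3: "y3 \<noteq> 0" using prod D0 lb(1) y12 by auto
    define S where "S = (1 / n) * (- B + 2 * C * t - 3 * t\<^sup>2) / D"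
    have zsum: "x1 / y1 + x2 / y2 + x3 / y3 = S"
    proof -
      have "A * (x1 * y2 * y3 + x2 * y1 * y3 + x3 * y1 * y2) = n\<^sup>2 * (- B + 2 * C * t - 3 * t\<^sup>2)"
        unfolding ch(2,3) y3_def using e l by algebra
      then have "A * (x1 * y2 * y3 + x2 * y1 * y3 + x3 * y1 * y2) * n * D = n ^ 3 * D * (- B + 2 * C * t - 3 * t\<^sup>2)"
        by algebra
      also have "\<dots> = A * (y1 * y2 * y3) * (- B + 2 * C * t - 3 * t\<^sup>2)" unfolding prod ..
      finally have "A * ((x1 * y2 * y3 + x2 * y1 * y3 + x3 * y1 * y2) * (n * D)) = A * ((- B + 2 * C * t - 3 * t\<^sup>2) * (y1 * y2 * y3))"
        by (simp only: ac_simps)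
      then have m: "(x1 * y2 * y3 + x2 * y1 * y3 + x3 * y1 * y2) * (n * D) = (- B + 2 * C * t - 3 * t\<^sup>2) * (y1 * y2 * y3)"
        using A_nonzero mult_left_cancel by blast
      have "x1 / y1 + x2 / y2 + x3 / y3 = (x1 * y2 * y3 + x2 * y1 * y3 + x3 * y1 * y2) / (y1 * y2 * y3)"
        using y12 y3 by (simp add: field_simps)
      also have "\<dots> = (- B + 2 * C * t - 3 * t\<^sup>2) / (n * D)"
        using m y12 y3 lb(1) D0 by (subst frac_eq_eq) auto
      finally show ?thesis by (simp add: S_def)
    qed
    have SK: "S \<in> K" unfolding S_def by (intro K_closed tK ABC_K DK)
    have NS: "N S \<le> r ^ 3"
    proof -
      have "N (2 * C * t) \<le> 1 * 1 * 1" using t1 N_C by (intro N_mult_le K_closed tK abc_K) auto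
      moreover have "N (3 * t\<^sup>2) \<le> 1 * 1"
        using t1 N_numeral N_power[OF tK(1), of 2] N_nonneg[OF tK(1)] by (intro N_mult_le K_closed tK) (auto intro: power_le_one)
      ultimately have "N (- B + 2 * C * t - 3 * t\<^sup>2) \<le> 1"
        using N_B N_neg[OF ABC_K(2)] by (intro N_diff_le N_add_le K_closed tK abc_K) auto
      then have "N ((1 / n) * (- B + 2 * C * t - 3 * t\<^sup>2)) \<le> r ^ 3 * 1"
        using lb(3) by (intro N_mult_le K_closed tK abc_K) auto
      moreover have "(1 / n) * (- B + 2 * C * t - 3 * t\<^sup>2) \<in> K" by (intro K_closed tK ABC_K nK)
      ultimately show ?thesis unfolding S_def by (simp only: N_divide[OF _ DK] ND div_by_1 mult_1_right)
    qed
    have z3: "zc (P \<oplus>\<^sub>E Q) - (zc P + zc Q) = - S" "x3 / y3 = S - (x1 / y1 + x2 / y2)"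
      using sum[unfolded PQ] unfolding zsum[symmetric] PQ by simp_all
    have r3: "r ^ 3 \<le> r" using r0 r(3) by (simp add: power3_eq_cube mult_le_one)
    have Nz3: "N (x3 / y3) \<le> r"
      unfolding z3(2) using NS r3 r' by (intro N_diff_le N_add_le SK K_closed p1 p2) auto
    \<comment> \<open>If \<open>x3\<close> were integral, \<open>y3\<close> would be integral too,
      while \<open>1 / y3 = 1 / n - t (x3 / y3)\<close> is small.\<close>
    have "N x3 > 1"
    proof (rule ccontr)
      assume "\<not> N x3 > 1"
      then have "N (y3\<^sup>2) \<le> 1" using N_W_integral[OF K3(1)] on3 by simp
      then have y3le: "N y3 \<le> 1" using N_power[OF K3(2), of 2] by (simp add: power_le_one_iff N_nonneg[OF K3(2)])
      have "1 / y3 = 1 / n - t * (x3 / y3)"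
        using y3 lb(1) by (simp add: l y3_def field_simps)
      moreover have "N (1 / n - t * (x3 / y3)) \<le> r ^ 3"
        using N_mult_le[of t "x3 / y3" "r\<^sup>2" r] Nt Nz3 lb(3)
        by (intro N_diff_le K_closed tK K3) (auto simp: K_closed tK K3 power2_eq_square power3_eq_cube)
      ultimately have "N (1 / y3) \<le> r ^ 3" by simp
      then have "1 / N y3 < 1" using N_divide[of 1 y3] K_closed K3 r3 r(3) by simp
      then show False using y3le N_pos[OF K3(2) y3] by simp
    qed
    then show ?thesis using NS z3(1) N_neg[OF SK] unfolding sum by auto
  qed
qed

lemma kernel_pow:
  assumes P: "P \<in> ec_points K a b c" "in_kernel P" and r: "N (zc P) < 1"
  shows "in_kernel (P [^]\<^bsub>EK\<^esub> m) \<and> N (zc (P [^]\<^bsub>EK\<^esub> m) - of_nat m * zc P) \<le> N (zc P) ^ 3"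
proof (induction m)
  case 0
  show ?case using N_nonneg[OF zc_K[OF P(1)]] N0 by simp
next
  case (Suc m)
  let ?Q = "P [^]\<^bsub>EK\<^esub> m" and ?r = "N (zc P)"
  have Q: "?Q \<in> ec_points K a b c" using EK.nat_pow_closed[of P m] P by simp
  have zK: "zc P \<in> K" "zc ?Q \<in> K" "zc (?Q \<oplus>\<^sub>E P) \<in> K" using zc_K P Q EK_add by auto
  have r0: "?r \<ge> 0" using N_nonneg zK by blast
  have r3: "?r ^ 3 \<le> ?r" using r0 r power_decreasing[of 1 3 ?r] by simp
  have "N (zc ?Q) \<le> ?r"
  proof -
    have "N ((zc ?Q - of_nat m * zc P) + of_nat m * zc P) \<le> ?r"
      using Suc r3 N_mult_le[OF K_closed(11) zK(1) N_of_nat order_refl, of m]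
      by (intro N_add_le K_closed zK) auto
    then show ?thesis by simp
  qed
  then have add: "in_kernel (?Q \<oplus>\<^sub>E P)" "N (zc (?Q \<oplus>\<^sub>E P) - (zc ?Q + zc P)) \<le> ?r ^ 3"
    using kernel_add[OF Q _ P] Suc r by auto
  have "N ((zc (?Q \<oplus>\<^sub>E P) - (zc ?Q + zc P)) + (zc ?Q - of_nat m * zc P)) \<le> ?r ^ 3"
    using add(2) Suc by (intro N_add_le K_closed zK) auto
  moreover have "(zc (?Q \<oplus>\<^sub>E P) - (zc ?Q + zc P)) + (zc ?Q - of_nat m * zc P) = zc (?Q \<oplus>\<^sub>E P) - of_nat (Suc m) * zc P"
    by (simp add: algebra_simps)
  ultimately show ?case using add(1) by simp
qed

text \<open>Write \<open>z\<close> for \<open>zc P\<close>. If \<open>m P = 0\<close>, additivity of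
  \<open>zc\<close> up to cubic terms gives \<open>N m * N z \<le> N z ^ 3\<close>, absurd when
  \<open>q\<close> does not divide \<open>m\<close>. Otherwise induction yields
  \<open>q P = 0\<close>, hence \<open>N q \<le> N z ^ 2 < N z\<close>, whereas
  \<open>N z \<le> N q\<close> because \<open>q\<close> is a uniformiser.\<close>

lemma kernel_torsion_free:
  assumes "P \<in> ec_points K a b c" "in_kernel P" "P [^]\<^bsub>EK\<^esub> m = None" "m > (0::nat)"
  shows "P = None"
  using assms
proof (induction m arbitrary: P rule: less_induct)
  case (less m)
  show ?case
  proof (rule ccontr)
    assume "P \<noteq> None"
    then obtain x y where P: "P = Some (x, y)" by (metis option.exhaust surj_pair)
    let ?r = "N (zc P)"
    have r: "0 < ?r" "?r < 1"
      using kernel_affine(2,3)[of x y] less.prems P by (auto simp: EK_Some)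
    have zK: "zc P \<in> K" using zc_K less.prems by blast
    have r3: "?r ^ 3 < ?r" using r power_strict_decreasing[of 1 3 ?r] by simp
    have bound: "N (of_nat k) * ?r \<le> ?r ^ 3" if "P [^]\<^bsub>EK\<^esub> k = None" for k :: nat
      using kernel_pow[OF less.prems(1,2) r(2), of k] that N_mult[OF K_closed(11) zK, of k]
        N_neg[OF K_closed(4)[OF K_closed(11) zK], of k] by simp
    show False
    proof (cases "q dvd m")
      case False
      then show False using bound[OF less.prems(3)] N_unit r3 by simp
    next
      case True
      then obtain k where k: "m = q * k" by blast
      have k0: "0 < k" "k < m" using k less.prems(4) prime by auto
      let ?Q = "P [^]\<^bsub>EK\<^esub> q"
      have "?Q \<in> ec_points K a b c" using EK.nat_pow_closed[of P q] less.prems by simp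
      moreover have "in_kernel ?Q" using kernel_pow[OF less.prems(1,2) r(2)] by blast
      moreover have "?Q [^]\<^bsub>EK\<^esub> k = None"
        using EK.nat_pow_pow[of P q k] less.prems k by simp
      ultimately have "?Q = None" using less.IH[OF k0(2)] k0(1) by blast
      then have "N (of_nat q) * ?r \<le> ?r ^ 3" by (rule bound)
      then have "N (of_nat q) * ?r \<le> ?r\<^sup>2 * ?r" by (simp add: power2_eq_square power3_eq_cube)
      then have 1: "N (of_nat q) \<le> ?r\<^sup>2" using r by simp
      have "?r\<^sup>2 < ?r" using r power_strict_decreasing[of 1 2 ?r] by simp
      then show False using 1 N_discrete[OF zK r(2)] by linarith
    qed
  qed
qed

lemma torsion_integral:
  assumes "Some (x, y) \<in> ec_torsion K a b c"
  shows "x \<in> K" "y \<in> K" "y\<^sup>2 = W x" "N x \<le> 1" "N y \<le> 1"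
proof -
  obtain m :: nat where m: "m > 0" "Some (x, y) [^]\<^bsub>EK\<^esub> m = None" and P: "Some (x, y) \<in> ec_points K a b c"
    using assms by (auto simp: torsion_iff)
  show xy: "x \<in> K" "y \<in> K" "y\<^sup>2 = W x" using P by (auto simp: EK_Some)
  show x1: "N x \<le> 1" using kernel_torsion_free[OF P _ m(2,1)] by force
  have "N y ^ 2 \<le> 1" using N_W_integral[OF xy(1) x1] N_power[OF xy(2), of 2] xy(3) by simp
  then show "N y \<le> 1" using N_nonneg[OF xy(2)] by (simp add: power_le_one_iff)
qed

text \<open>For two distinct congruent points the chord through the first and the negative of the
  second is nearly vertical: its slope has absolute value above 1. The difference of the points then
  has a non-integral first coordinate and lies in the kernel of reduction, which has no
  torsion.\<close>

lemma torsion_reduction_inj: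
  assumes P: "Some (x1, y1) \<in> ec_torsion K a b c" and Q: "Some (x2, y2) \<in> ec_torsion K a b c"
    and cx: "N (x1 - x2) < 1" and cy: "N (y1 - y2) < 1"
  shows "x1 = x2 \<and> y1 = y2"
proof (rule ccontr)
  assume ne: "\<not> (x1 = x2 \<and> y1 = y2)"
  note p1 = torsion_integral[OF P] and p2 = torsion_integral[OF Q]
  define l where "l = (if x1 = x2 then slope_at x1 / (2 * y1) else (- y2 - y1) / (x2 - x1))"
  define n where "n = y1 - l * x1"
  define x3 where "x3 = (l\<^sup>2 - B) / A - x1 - x2"
  have ne': "\<not> (x1 = x2 \<and> y1 = - (- y2))" using ne by simp
  have on2: "(- y2)\<^sup>2 = W x2" using p2 by simp
  have sum: "Some (x1, y1) \<oplus>\<^sub>E neg (Some (x2, y2)) = Some (x3, - (l * x3 + n))"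
    using chord(1)[OF p1(3) on2 ne'] by (simp add: l_def n_def x3_def)
  have lK: "l \<in> K" unfolding l_def using p1 p2 slope_K by (auto intro!: K_closed)
  \<comment> \<open>\<open>G\<close> is the difference quotient of \<open>W\<close> between
    \<open>x1\<close> and \<open>x2\<close>. When \<open>y1\<close> is small it is congruent to
    \<open>slope_at x1\<close>, a unit.\<close>
  define G where "G = A * (x1\<^sup>2 + x1 * x2 + x2\<^sup>2) + B * (x1 + x2) + C"
  have GK: "G \<in> K" unfolding G_def by (intro K_closed abc_K p1 p2)
  have NG: "N G = 1" if "N y1 < 1"
  proof -
    have "N y1 ^ 2 < 1" using that N_nonneg[OF p1(2)] by (simp add: power_less_one_iff)
    then have s: "N (slope_at x1) = 1"
      using N_slope_unit[OF p1(1,4)] N_power[OF p1(2), of 2] p1(3) by simp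
    have cx': "N (x2 - x1) < 1" using cx N_neg[of "x1 - x2"] K_closed(7)[OF p1(1) p2(1)] by simp
    have "N (A * (x2 + 2 * x1) + B) \<le> 1"
      using N_A N_B N_mult_le[of 2 x1 1 1] N_mult_le[of A "x2 + 2 * x1" 1 1] N_add_le[of x2 "2 * x1" 1] p1 p2
      by (intro N_add_le[of "A * (x2 + 2 * x1)" B]) (auto simp: K_closed ABC_K)
    then have "N ((x2 - x1) * (A * (x2 + 2 * x1) + B)) < 1"
      using cx' N_mult[of "x2 - x1" "A * (x2 + 2 * x1) + B"] N_nonneg[of "x2 - x1"]
        mult_left_le[of "N (A * (x2 + 2 * x1) + B)" "N (x2 - x1)"]
      by (simp add: K_closed p1 p2 ABC_K)
    moreover have "G = slope_at x1 + (x2 - x1) * (A * (x2 + 2 * x1) + B)"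
      unfolding G_def slope_at_def by (simp add: algebra_simps power2_eq_square)
    ultimately show ?thesis
      using N_add_eq[of "slope_at x1" "(x2 - x1) * (A * (x2 + 2 * x1) + B)"] s slope_K p1 p2
      by (simp add: K_closed ABC_K)
  qed
  have Nl: "N l > 1"
  proof (cases "x1 = x2")
    case True
    then have y: "y2 = - y1" "y1 \<noteq> 0"
      using ne p1(3) p2(3) power2_eq_iff[of y1 y2] by auto
    have "N (2 * y1) < 1" using cy y by simp
    then have y1: "N y1 < 1" using N_mult[of 2 y1] p1 K_closed by simp
    have "slope_at x1 = G" using True by (simp add: G_def slope_at_def power2_eq_square algebra_simps)
    then have "N l = 1 / N y1"
      using True NG[OF y1] N_divide[OF GK, of "2 * y1"] N_mult[of 2 y1] p1 K_closed by (simp add: l_def)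
    then show ?thesis using y1 N_pos[OF p1(2) y(2)] by simp
  next
    case False
    have l: "l = - (y1 + y2) / (x2 - x1)" using False by (simp add: l_def)
    have dK: "y1 + y2 \<in> K" "y1 - y2 \<in> K" "x2 - x1 \<in> K" by (intro K_closed p1 p2)+
    \<comment> \<open>If \<open>y1 + y2\<close> is small as well, then so is \<open>y1\<close>,
      because 2 is a unit, and \<open>y1^2 - y2^2 = (x1 - x2) G\<close> rewrites the slope as
      \<open>G / (y1 - y2)\<close>. Otherwise only the denominator of the slope is small.\<close>
    show ?thesis
    proof (cases "N (y1 + y2) < 1")
      case True
      have "N ((y1 + y2) + (y1 - y2)) < 1" by (intro N_add_less dK True cy)
      then have "N (2 * y1) < 1" by simp
      then have y1: "N y1 < 1" using N_mult[of 2 y1] p1 K_closed by simp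
      have d: "(y1 + y2) * (y1 - y2) = - (x2 - x1) * G"
      proof -
        have "(y1 + y2) * (y1 - y2) = W x1 - W x2" using p1(3) p2(3) by (simp add: algebra_simps power2_eq_square)
        then show ?thesis unfolding W_expand G_def by (simp add: algebra_simps power2_eq_square power3_eq_cube)
      qed
      have "y1 \<noteq> y2"
      proof
        assume "y1 = y2"
        then have "G = 0" using d False by simp
        then show False using NG[OF y1] N0 by simp
      qed
      then have y0: "y1 - y2 \<noteq> 0" by simp
      have "l = G / (y1 - y2)"
        unfolding l using d y0 False by (subst frac_eq_eq) (auto simp: algebra_simps)
      then have "N l = 1 / N (y1 - y2)" using N_divide[OF GK dK(2)] NG[OF y1] by simp
      then show ?thesis using cy N_pos[OF dK(2) y0] by simp
    next
      case no: False
      have "N (x2 - x1) < 1" "x2 - x1 \<noteq> 0"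
        using cx N_neg[of "x1 - x2"] K_closed(7)[OF p1(1) p2(1)] False by auto
      moreover have "N l = N (y1 + y2) / N (x2 - x1)"
        unfolding l using N_divide[OF K_closed(5)[OF dK(1)] dK(3)] N_neg[OF dK(1)] by simp
      ultimately show ?thesis using no N_pos[OF dK(3)] by (simp add: less_divide_eq)
    qed
  qed
  have Nl2: "N (l\<^sup>2) > 1" using Nl N_power[OF lK, of 2] by (simp add: one_less_power)
  have "N (l\<^sup>2 + (- B - A * x1 - A * x2)) = N (l\<^sup>2)"
  proof (rule N_add_eq)
    have "N (- B - A * x1 - A * x2) \<le> 1"
      using N_B N_A p1 p2 N_neg[OF ABC_K(2)] by (intro N_diff_le K_closed abc_K) (auto simp: N_mult ABC_K K_closed)
    then show "N (- B - A * x1 - A * x2) < N (l\<^sup>2)" using Nl2 by linarith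
  qed (intro K_closed lK abc_K p1 p2)+
  moreover have "A * x3 = l\<^sup>2 + (- B - A * x1 - A * x2)"
    using nonzero_mult_div_cancel_left[OF A_nonzero, of "l\<^sup>2 - B"]
    unfolding x3_def right_diff_distrib[of A] times_divide_eq_right by simp
  moreover have x3K: "x3 \<in> K" unfolding x3_def by (intro K_closed lK abc_K p1 p2)
  ultimately have "N x3 > 1" using N_mult[OF ABC_K(1) x3K] N_A Nl2 by simp
  then have ker: "in_kernel (Some (x1, y1) \<oplus>\<^sub>E neg (Some (x2, y2)))" unfolding sum by simp
  from torsion_diff[OF P Q] obtain m :: nat where "m > 0"
    "(Some (x1, y1) \<oplus>\<^sub>E neg (Some (x2, y2))) [^]\<^bsub>EK\<^esub> m = None"
    "Some (x1, y1) \<oplus>\<^sub>E neg (Some (x2, y2)) \<in> ec_points K a b c"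
    unfolding torsion_iff by blast
  then show False using kernel_torsion_free[OF _ ker] sum by (metis option.distinct(1))
qed

end

section \<open>The 5-adic absolute value of a quadratic field in which 5 is inert\<close>

definition padic :: "nat \<Rightarrow> rat \<Rightarrow> real" where
  "padic p x = (if x = 0 then 0 else
     real p powi (int (multiplicity (int p) (snd (quotient_of x))) - int (multiplicity (int p) (fst (quotient_of x)))))"

lemma padic_0 [simp]: "padic p 0 = 0"
  by (simp add: padic_def)

context
  fixes p :: nat
  assumes p: "prime p"
begin

lemma p_int: "prime (int p)" and p_gt_1: "real p > 1"
  using p prime_gt_1_nat by auto

text \<open>Cross-multiplication shows that lowest terms do not matter, which frees later arguments
  from \<open>quotient_of\<close>.\<close>

lemma padic_divide_int:
  assumes "m \<noteq> 0" "n \<noteq> 0"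
  shows "padic p (of_int m / of_int n) = real p powi (int (multiplicity (int p) n) - int (multiplicity (int p) m))"
proof -
  let ?x = "of_int m / of_int n :: rat"
  obtain a b where ab: "quotient_of ?x = (a, b)" by force
  have x: "?x = of_int a / of_int b" "b > 0"
    using quotient_of_div[OF ab] quotient_of_denom_pos[OF ab] by auto
  have a0: "a \<noteq> 0" using x assms by auto
  have "of_int (m * b) = (of_int (a * n) :: rat)" using x assms by (simp add: field_simps)
  then have "m * b = a * n" by linarith
  then have "multiplicity (int p) (m * b) = multiplicity (int p) (a * n)" by simp
  then have "multiplicity (int p) m + multiplicity (int p) b = multiplicity (int p) a + multiplicity (int p) n"
    using assms a0 x(2) p_int by (simp add: prime_elem_multiplicity_mult_distrib)
  then have "int (multiplicity (int p) b) - int (multiplicity (int p) a) = int (multiplicity (int p) n) - int (multiplicity (int p) m)"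
    by linarith
  then show ?thesis using assms ab by (simp add: padic_def)
qed

lemma rat_cases:
  obtains m n where "(x::rat) = of_int m / of_int n" "n \<noteq> 0"
  by (metis quotient_of_div quotient_of_denom_pos surj_pair less_irrefl)

lemma padic_pos: "x \<noteq> 0 \<Longrightarrow> padic p x > 0"
  using p_gt_1 by (simp add: padic_def)

lemma padic_nonneg [simp]: "padic p x \<ge> 0"
  using padic_pos[of x] by (cases "x = 0") auto

lemma padic_eq_0 [simp]: "padic p x = 0 \<longleftrightarrow> x = 0"
  using padic_pos[of x] by (cases "x = 0") auto

lemma padic_mult: "padic p (x * y) = padic p x * padic p y"
proof (cases "x = 0 \<or> y = 0")
  case False
  obtain a b where x: "x = of_int a / of_int b" "b \<noteq> 0" by (rule rat_cases)
  obtain c d where y: "y = of_int c / of_int d" "d \<noteq> 0" by (rule rat_cases)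
  have nz: "a \<noteq> 0" "c \<noteq> 0" using False x y by auto
  have xy: "x * y = of_int (a * c) / of_int (b * d)" using x y by simp
  have "padic p (x * y) = real p powi (int (multiplicity (int p) b) - int (multiplicity (int p) a) +
      (int (multiplicity (int p) d) - int (multiplicity (int p) c)))"
    unfolding xy using padic_divide_int[of "a * c" "b * d"] x y nz p_int
    by (simp add: prime_elem_multiplicity_mult_distrib algebra_simps)
  also have "\<dots> = padic p x * padic p y"
    unfolding x y using padic_divide_int x y nz p_gt_1 by (simp add: power_int_add)
  finally show ?thesis .
qed auto

lemma padic_of_int: "padic p (of_int n) = (if n = 0 then 0 else (1 / real p) ^ multiplicity (int p) n)"
proof (cases "n = 0")
  case False
  then have "padic p (of_int n) = real p powi (- int (multiplicity (int p) n))"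
    using padic_divide_int[of n 1] by simp
  also have "\<dots> = (1 / real p) ^ multiplicity (int p) n"
    by (simp add: power_int_minus power_one_over inverse_eq_divide)
  finally show ?thesis using False by simp
qed simp

lemma padic_of_int_le: "padic p (of_int n) \<le> 1"
  using p_gt_1 by (simp add: padic_of_int power_le_one)

lemma padic_of_int_less_iff: "padic p (of_int n) < 1 \<longleftrightarrow> int p dvd n"
proof (cases "n = 0")
  case False
  show ?thesis
  proof (cases "int p dvd n")
    case True
    then have "multiplicity (int p) n \<noteq> 0"
      using False p_int prime_multiplicity_gt_zero_iff[of "int p" n] by simp
    then show ?thesis using True False p_gt_1 by (simp add: padic_of_int power_less_one_iff)
  next
    case nd: False
    then have "multiplicity (int p) n = 0" by (rule not_dvd_imp_multiplicity_0)
    then show ?thesis using nd False by (simp add: padic_of_int)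
  qed
qed simp

lemma padic_unit: "\<not> int p dvd n \<Longrightarrow> padic p (of_int n) = 1"
  using padic_of_int_less_iff[of n] padic_of_int_le[of n] by auto

lemma padic_1 [simp]: "padic p 1 = 1"
  using padic_of_int[of 1] by simp

lemma padic_minus [simp]: "padic p (- x) = padic p x"
proof -
  have "padic p (-1) ^ 2 = 1" using padic_mult[of "-1" "-1"] by (simp add: power2_eq_square)
  then have "padic p (-1) = 1 \<or> padic p (-1) = -1" by (simp add: power2_eq_1_iff)
  then have "padic p (-1) = 1" using padic_nonneg[of "-1"] by linarith
  then show ?thesis using padic_mult[of "-1" x] by simp
qed

lemma padic_divide: "padic p (x / y) = padic p x / padic p y"
proof (cases "y = 0")
  case False
  have "padic p (x / y) * padic p y = padic p x" using False by (simp flip: padic_mult)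
  then show ?thesis using False by (simp add: field_simps)
qed simp

lemma padic_le_1_cases:
  assumes "padic p x \<le> 1"
  obtains a b where "x = of_int a / of_int b" "b > 0" "\<not> int p dvd b"
proof -
  obtain a b where "quotient_of x = (a, b)" by force
  then have x: "x = of_int a / of_int b" "b > 0" "coprime a b"
    using quotient_of_div quotient_of_denom_pos quotient_of_coprime by auto
  have "\<not> int p dvd b"
  proof
    assume d: "int p dvd b"
    then have "\<not> int p dvd a" using x(3) p_int by (metis coprime_common_divisor not_prime_unit)
    then have "padic p (of_int a) = 1" by (rule padic_unit)
    moreover have "padic p (of_int b) < 1" using d padic_of_int_less_iff by blast
    moreover have "padic p (of_int b) > 0" using x(2) padic_pos by simp
    ultimately have "padic p x > 1" unfolding x(1) padic_divide by simp
    then show False using assms by simp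
  qed
  then show ?thesis using that x by blast
qed

lemma padic_add_1:
  assumes "padic p x \<le> 1"
  shows "padic p (x + 1) \<le> 1"
proof -
  obtain a b where x: "x = of_int a / of_int b" "b > 0" "\<not> int p dvd b"
    using assms by (rule padic_le_1_cases)
  then have "x + 1 = of_int (a + b) / of_int b" by (simp add: field_simps)
  then show ?thesis using padic_unit[OF x(3)] padic_of_int_le[of "a + b"] by (simp only: padic_divide)
qed

lemma padic_add: "padic p (x + y) \<le> max (padic p x) (padic p y)"
proof -
  have *: "padic p (u + v) \<le> padic p v" if "padic p u \<le> padic p v" for u v
  proof (cases "v = 0")
    case False
    then have "padic p (u / v) \<le> 1" using that padic_pos[of v] by (simp add: padic_divide)
    then have "padic p (u / v + 1) \<le> 1" by (rule padic_add_1)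
    moreover have "u + v = (u / v + 1) * v" using False by (simp add: field_simps)
    ultimately show ?thesis using padic_mult[of "u / v + 1" v] mult_right_mono[of "padic p (u / v + 1)" 1 "padic p v"] by simp
  qed (use that in simp)
  show ?thesis using *[of x y] *[of y x] by (auto simp: max_def add.commute)
qed

lemma padic_diff: "padic p (x - y) \<le> max (padic p x) (padic p y)"
  using padic_add[of x "- y"] by simp

lemma padic_add_eq: "padic p y < padic p x \<Longrightarrow> padic p (x + y) = padic p x"
  using padic_add[of x y] padic_diff[of "x + y" y] by (simp add: max_def split: if_splits)

lemma padic_power: "padic p (x ^ n) = padic p x ^ n"
  by (induction n) (auto simp: padic_mult)

lemma padic_discrete:
  assumes "padic p x < 1"
  shows "padic p x \<le> 1 / real p"
proof (cases "x = 0")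
  case False
  obtain a b where x: "x = of_int a / of_int b" "b \<noteq> 0" by (rule rat_cases)
  have a0: "a \<noteq> 0" using False x by auto
  define k where "k = int (multiplicity (int p) b) - int (multiplicity (int p) a)"
  have e: "padic p x = real p powi k" unfolding x k_def using padic_divide_int a0 x by blast
  have "k \<le> -1"
  proof (rule ccontr)
    assume "\<not> k \<le> -1"
    then have "k \<ge> 0" by simp
    then have "real p powi k \<ge> 1" using p_gt_1 by (simp add: power_int_def)
    then show False using assms e by simp
  qed
  then have "real p powi k \<le> real p powi (-1)" using p_gt_1 by (intro power_int_increasing) auto
  then show ?thesis using e by (simp add: power_int_minus divide_inverse)
qed simp

lemma padic_residue:
  assumes "padic p x \<le> 1"
  obtains i where "0 \<le> i" "i < int p" "padic p (x - of_int i) < 1"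
proof -
  obtain a b where x: "x = of_int a / of_int b" "b > 0" and nd: "\<not> int p dvd b"
    using assms by (rule padic_le_1_cases)
  have "coprime b (int p)" using nd p_int by (metis coprime_commute prime_imp_coprime)
  then obtain u v where "u * b + v * int p = 1"
    by (metis bezout_int coprime_iff_gcd_eq_1)
  \<comment> \<open>Here \<open>u\<close> inverts \<open>b\<close> modulo \<open>p\<close>.\<close>
  define i where "i = (a * u) mod int p"
  have "int p dvd a - i * b"
  proof -
    have "i = a * u - int p * ((a * u) div int p)" by (simp add: i_def minus_mult_div_eq_mod)
    then have "a - i * b = a - (a * u - int p * ((a * u) div int p)) * b" by presburger
    also have "\<dots> = a * (1 - u * b) + int p * ((a * u) div int p) * b" by (simp add: algebra_simps)
    also have "1 - u * b = v * int p" using \<open>u * b + v * int p = 1\<close> by simp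
    finally show ?thesis by simp
  qed
  then have "padic p (of_int (a - i * b)) < 1" using padic_of_int_less_iff by blast
  moreover have "x - of_int i = of_int (a - i * b) / of_int b" using x by (simp add: field_simps)
  ultimately have "padic p (x - of_int i) < 1" by (simp add: padic_divide padic_unit[OF nd])
  moreover have "0 \<le> i" "i < int p" using p_gt_1 by (auto simp: i_def)
  ultimately show ?thesis using that by blast
qed

end

lemma prime_5: "prime (5::nat)" and prime_3: "prime (3::nat)"
  by (simp_all add: prime_nat_numeral_eq)

text \<open>Since 2 is not a square modulo 5, the form \<open>u\<^sup>2 - d v\<^sup>2\<close> is anisotropic over the 5-adic numbers.\<close>

lemma padic_norm_form:
  assumes d: "d mod 5 = (2::int)"
  shows "padic 5 (u\<^sup>2 - of_int d * v\<^sup>2) = (max (padic 5 u) (padic 5 v))\<^sup>2"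
proof -
  note P = prime_5
  have dd: "\<not> int 5 dvd d" using d by presburger
  have d1: "padic 5 (of_int d) = 1" by (rule padic_unit[OF P dd])
  have dv: "padic 5 (of_int d * v\<^sup>2) = (padic 5 v)\<^sup>2"
    by (simp add: padic_mult[OF P] d1 padic_power[OF P])
  have u: "padic 5 (u\<^sup>2) = (padic 5 u)\<^sup>2" by (rule padic_power[OF P])
  consider "padic 5 v < padic 5 u" | "padic 5 u < padic 5 v" | "padic 5 u = padic 5 v" "v \<noteq> 0" | "u = 0" "v = 0"
    using padic_eq_0[OF P, of u] by fastforce
  then show ?thesis
  proof cases
    case 1
    then have "(padic 5 v)\<^sup>2 < (padic 5 u)\<^sup>2" using padic_nonneg[OF P] by (intro power_strict_mono) auto
    then show ?thesis using padic_add_eq[OF P, of "- (of_int d * v\<^sup>2)" "u\<^sup>2"] 1 dv u padic_minus[OF P, of "of_int d * v\<^sup>2"]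
      by (simp add: max_def)
  next
    case 2
    then have "(padic 5 u)\<^sup>2 < (padic 5 v)\<^sup>2" using padic_nonneg[OF P] by (intro power_strict_mono) auto
    then show ?thesis using padic_add_eq[OF P, of "u\<^sup>2" "- (of_int d * v\<^sup>2)"] 2 dv u padic_minus[OF P, of "of_int d * v\<^sup>2"]
      by (simp add: max_def)
  next
    case 3
    \<comment> \<open>Only for equal sizes could the two terms cancel. With \<open>t\<close>
      congruent to \<open>i\<close>, \<open>t^2 - d = (i^2 - d) + (t - i) (t + i)\<close>, and the
      integer \<open>i^2 - d\<close> is a unit.\<close>
    define t where "t = u / v"
    have t1: "padic 5 t = 1" using 3 padic_pos[OF P, of v] by (simp add: t_def padic_divide[OF P])
    obtain i where i: "0 \<le> i" "i < 5" "padic 5 (t - of_int i) < 1"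
      using padic_residue[OF P, of t] t1 by auto
    have nd: "\<not> int 5 dvd i\<^sup>2 - d"
    proof
      assume "int 5 dvd i\<^sup>2 - d"
      then have "i\<^sup>2 mod 5 = 2" using d by presburger
      moreover have "i = 0 \<or> i = 1 \<or> i = 2 \<or> i = 3 \<or> i = 4" using i by presburger
      ultimately show False by auto
    qed
    have ti: "padic 5 (t + of_int i) \<le> 1"
      using padic_add[OF P, of t "of_int i"] t1 padic_of_int_le[OF P, of i] by simp
    have "padic 5 ((t - of_int i) * (t + of_int i)) < 1"
      using mult_left_mono[OF ti padic_nonneg[OF P, of "t - of_int i"]] i(3) by (simp add: padic_mult[OF P])
    then have "padic 5 (of_int (i\<^sup>2 - d) + (t - of_int i) * (t + of_int i)) = 1"
      using padic_add_eq[OF P, of "(t - of_int i) * (t + of_int i)" "of_int (i\<^sup>2 - d)"] padic_unit[OF P nd] by simp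
    moreover have "u\<^sup>2 - of_int d * v\<^sup>2 = (of_int (i\<^sup>2 - d) + (t - of_int i) * (t + of_int i)) * v\<^sup>2"
      using 3(2) by (simp add: t_def field_simps power2_eq_square)
    ultimately show ?thesis using 3 by (simp add: padic_mult[OF P] padic_power[OF P])
  qed simp
qed

section \<open>The field generated by a square root of d, with 5 inert\<close>

definition quad_field :: "complex \<Rightarrow> complex set" where
  "quad_field s = {of_rat u + of_rat v * s | u v. True}"

locale inert_quadratic =
  fixes d :: int and s :: complex
  assumes d_mod: "d mod 5 = 2" and s_sq: "s\<^sup>2 = of_int d"
begin

abbreviation "K \<equiv> quad_field s"

abbreviation qelt :: "rat \<Rightarrow> rat \<Rightarrow> complex" where
  "qelt u v \<equiv> of_rat u + of_rat v * s"

lemma qelt_in: "qelt u v \<in> K"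
  by (auto simp: quad_field_def)

lemma K_cases:
  assumes "x \<in> K"
  obtains u v where "x = qelt u v"
  using assms by (auto simp: quad_field_def)

lemma qelt_mult: "qelt u v * qelt u' v' = qelt (u * u' + of_int d * (v * v')) (u * v' + v * u')"
proof -
  have "qelt u v * qelt u' v' = of_rat (u * u') + of_rat (v * v') * s\<^sup>2 + of_rat (u * v' + v * u') * s"
    by (simp add: of_rat_mult of_rat_add algebra_simps power2_eq_square)
  then show ?thesis unfolding s_sq by (simp add: of_rat_mult of_rat_add algebra_simps)
qed

lemma qelt_conj: "qelt u v * qelt u (- v) = of_rat (u\<^sup>2 - of_int d * v\<^sup>2)"
  unfolding qelt_mult by (simp add: power2_eq_square algebra_simps)

lemma norm_form_0: "u\<^sup>2 - of_int d * v\<^sup>2 = (0::rat) \<Longrightarrow> u = 0 \<and> v = 0"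
  using padic_norm_form[OF d_mod, of u v] padic_eq_0[OF prime_5] padic_nonneg[OF prime_5, of u] padic_nonneg[OF prime_5, of v]
  by (auto simp: max_def split: if_splits)

lemma qelt_0: "qelt u v = 0 \<longleftrightarrow> u = 0 \<and> v = 0"
proof
  assume "qelt u v = 0"
  then have "of_rat (u\<^sup>2 - of_int d * v\<^sup>2) = (0::complex)" using qelt_conj[of u v] by simp
  then show "u = 0 \<and> v = 0" using norm_form_0[of u v] by simp
qed simp

lemma qelt_eq: "qelt u v = qelt u' v' \<longleftrightarrow> u = u' \<and> v = v'"
proof -
  have "qelt u v = qelt u' v' \<longleftrightarrow> qelt (u - u') (v - v') = 0"
    by (auto simp: of_rat_diff algebra_simps)
  then show ?thesis unfolding qelt_0 by auto
qed

lemma subfield: "subfield_C K"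
  unfolding subfield_C_def
proof (intro conjI ballI impI)
  show "0 \<in> K" using qelt_in[of 0 0] by simp
  show "1 \<in> K" using qelt_in[of 1 0] by simp
next
  fix x y assume "x \<in> K" "y \<in> K"
  then obtain u v u' v' where xy: "x = qelt u v" "y = qelt u' v'" by (auto elim!: K_cases)
  have "x + y = qelt (u + u') (v + v')" unfolding xy by (simp add: of_rat_add algebra_simps)
  then show "x + y \<in> K" using qelt_in by simp
  show "x * y \<in> K" unfolding xy qelt_mult by (rule qelt_in)
next
  fix x assume "x \<in> K"
  then obtain u v where x: "x = qelt u v" by (rule K_cases)
  have "- x = qelt (- u) (- v)" unfolding x by (simp add: of_rat_minus)
  then show "- x \<in> K" using qelt_in by simp
next
  fix x assume "x \<in> K" and x0: "x \<noteq> 0"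
  then obtain u v where x: "x = qelt u v" using K_cases by blast
  define n where "n = u\<^sup>2 - of_int d * v\<^sup>2"
  have n0: "n \<noteq> 0" using norm_form_0[of u v] x0 x by (auto simp: n_def)
  have "x * qelt (u / n) (- v / n) = 1"
  proof -
    have "x * qelt (u / n) (- v / n) = (qelt u v * qelt u (- v)) / of_rat n"
      unfolding x by (simp add: of_rat_divide of_rat_minus diff_divide_distrib right_diff_distrib)
    also have "\<dots> = 1" unfolding qelt_conj n_def[symmetric] using n0 by simp
    finally show ?thesis .
  qed
  then have "inverse x = qelt (u / n) (- v / n)" by (rule inverse_unique)
  then show "inverse x \<in> K" using qelt_in by metis
qed

lemmas K_closed = subfield_CD[OF subfield]

lemma of_rat_K: "of_rat u \<in> K"
  using qelt_in[of u 0] by simp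

lemma s_K: "s \<in> K"
  using qelt_in[of 0 1] by simp

lemma quadratic_field: "quadratic_field K"
  unfolding quadratic_field_def
proof (intro conjI subfield bexI ballI)
  show "s \<in> K" "1 \<in> K" using s_K K_closed by auto
  fix x assume "x \<in> K"
  then obtain u v where x: "x = qelt u v" by (rule K_cases)
  show "\<exists>!pq. x = of_rat (fst pq) * 1 + of_rat (snd pq) * s"
  proof (rule ex1I[of _ "(u, v)"])
    show "x = of_rat (fst (u, v)) * 1 + of_rat (snd (u, v)) * s" using x by simp
    fix pq assume "x = of_rat (fst pq) * 1 + of_rat (snd pq) * s"
    then have "qelt (fst pq) (snd pq) = qelt u v" using x by simp
    then show "pq = (u, v)" unfolding qelt_eq by (simp add: prod_eq_iff)
  qed
qed

text \<open>By \<open>padic_norm_form\<close> the square of this maximum is the 5-adic absolute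
  value of the field norm, which makes it multiplicative: it extends \<open>padic 5\<close> to
  \<open>K\<close>. The description is unambiguous because the coordinates are unique
  (\<open>qelt_eq\<close>).\<close>

definition N :: "complex \<Rightarrow> real" where
  "N x = (THE r. \<exists>u v. x = qelt u v \<and> r = max (padic 5 u) (padic 5 v))"

lemma N_qelt: "N (qelt u v) = max (padic 5 u) (padic 5 v)"
  unfolding N_def by (rule the_equality) (auto simp: qelt_eq)

lemma N_of_rat: "N (of_rat u) = padic 5 u"
  using N_qelt[of u 0] padic_nonneg[OF prime_5, of u] by (simp add: max_def)

lemma N_of_int: "N (of_int i) = padic 5 (of_int i)"
  using N_of_rat[of "of_int i"] by simp

lemma N_nonneg': "x \<in> K \<Longrightarrow> N x \<ge> 0"
  by (erule K_cases) (simp add: N_qelt padic_nonneg[OF prime_5] le_max_iff_disj)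

lemma N_mult': "x \<in> K \<Longrightarrow> y \<in> K \<Longrightarrow> N (x * y) = N x * N y"
proof -
  assume xy: "x \<in> K" "y \<in> K"
  then obtain u v u' v' where e: "x = qelt u v" "y = qelt u' v'" by (auto elim!: K_cases)
  have "(N (x * y))\<^sup>2 = padic 5 ((u * u' + of_int d * (v * v'))\<^sup>2 - of_int d * (u * v' + v * u')\<^sup>2)"
    unfolding e qelt_mult N_qelt padic_norm_form[OF d_mod] ..
  also have "(u * u' + of_int d * (v * v'))\<^sup>2 - of_int d * (u * v' + v * u')\<^sup>2 =
      (u\<^sup>2 - of_int d * v\<^sup>2) * (u'\<^sup>2 - of_int d * v'\<^sup>2)"
    by (simp add: power2_eq_square algebra_simps)
  also have "padic 5 \<dots> = (N x * N y)\<^sup>2"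
    unfolding padic_mult[OF prime_5] padic_norm_form[OF d_mod] e N_qelt power_mult_distrib ..
  finally show ?thesis
    by (rule power2_eq_imp_eq[OF _ N_nonneg'[OF K_closed(4)[OF xy]] mult_nonneg_nonneg[OF N_nonneg'[OF xy(1)] N_nonneg'[OF xy(2)]]])
qed

sublocale unramified_abs K N 5
proof
  show "subfield_C K" by (rule subfield)
  show "prime (5::nat)" by (rule prime_5)
  show "N 0 = 0" using N_of_rat[of 0] by simp
  show "N x > 0" if "x \<in> K" "x \<noteq> 0" for x
    using that by (elim K_cases) (auto simp: N_qelt qelt_0 less_max_iff_disj padic_pos[OF prime_5])
  show "N (x * y) = N x * N y" if "x \<in> K" "y \<in> K" for x y
    using N_mult' that by blast
  show "N (x + y) \<le> max (N x) (N y)" if xy: "x \<in> K" "y \<in> K" for x y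
  proof -
    obtain u v u' v' where e: "x = qelt u v" "y = qelt u' v'" using xy by (auto elim!: K_cases)
    have "x + y = qelt (u + u') (v + v')" unfolding e by (simp add: of_rat_add algebra_simps)
    then have "N (x + y) = max (padic 5 (u + u')) (padic 5 (v + v'))" by (simp only: N_qelt)
    then show ?thesis unfolding e N_qelt
      using padic_add[OF prime_5, of u u'] padic_add[OF prime_5, of v v'] by linarith
  qed
  show "N (of_nat n) = 1" if "\<not> 5 dvd n" for n
  proof -
    have "\<not> int 5 dvd int n" using that by presburger
    from padic_unit[OF prime_5 this] show ?thesis using N_of_int[of "int n"] by simp
  qed
  show "N x \<le> N (of_nat 5)" if x: "x \<in> K" and "N x < 1" for x
  proof -
    have "padic 5 5 = 1 / 5"
      using padic_of_int[OF prime_5, of 5] by simp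
    then have "N (of_nat 5) = 1 / 5" using N_of_int[of 5] by simp
    moreover obtain u v where "x = qelt u v" using x by (rule K_cases)
    ultimately show ?thesis
      using that padic_discrete[OF prime_5, of u] padic_discrete[OF prime_5, of v] by (simp add: N_qelt)
  qed
qed simp

lemma residue:
  assumes x: "x \<in> K" "N x \<le> 1"
  obtains i j where "i \<in> {0..<5}" "j \<in> {0..<5}" "N (x - (of_int i + of_int j * s)) < 1"
proof -
  obtain u v where e: "x = qelt u v" using x(1) by (rule K_cases)
  have "padic 5 u \<le> 1" "padic 5 v \<le> 1" using x(2) unfolding e N_qelt by auto
  obtain i where i: "0 \<le> i" "i < int 5" "padic 5 (u - of_int i) < 1"
    by (rule padic_residue[OF prime_5 \<open>padic 5 u \<le> 1\<close>])
  obtain j where j: "0 \<le> j" "j < int 5" "padic 5 (v - of_int j) < 1"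
    by (rule padic_residue[OF prime_5 \<open>padic 5 v \<le> 1\<close>])
  have "x - (of_int i + of_int j * s) = qelt (u - of_int i) (v - of_int j)"
    unfolding e by (simp add: of_rat_diff algebra_simps)
  then have "N (x - (of_int i + of_int j * s)) < 1" using i j by (simp only: N_qelt)
  then show ?thesis using that i j by auto
qed

lemma N_int_pair: "N (of_int i + of_int j * s) < 1 \<longleftrightarrow> 5 dvd i \<and> 5 dvd j"
  using N_qelt[of "of_int i" "of_int j"] padic_of_int_less_iff[OF prime_5] by simp

end

section \<open>The torsion group of an explicit family\<close>

lemma (in group) int_pow_eq_one_iff:
  fixes p :: nat and k :: int
  assumes p: "prime p" and x: "x \<in> carrier G" "x [^] p = \<one>" "x \<noteq> \<one>"
  shows "x [^] k = \<one> \<longleftrightarrow> int p dvd k"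
proof
  have xp: "x [^] (int p * m) = \<one>" for m
    using int_pow_pow[OF x(1), of "int p" m] x(2) int_pow_int[of G x p] by simp
  show "x [^] k = \<one>" if "int p dvd k" using that xp by (elim dvdE) simp
  show "int p dvd k" if k: "x [^] k = \<one>"
  proof (rule ccontr)
    assume "\<not> int p dvd k"
    moreover have "prime (int p)" using p by simp
    ultimately have "coprime k (int p)" by (metis coprime_commute prime_imp_coprime)
    then obtain u v where uv: "u * k + v * int p = 1" by (metis bezout_int coprime_iff_gcd_eq_1)
    have "x = x [^] (k * u + int p * v)" using uv x(1) by (simp add: mult.commute)
    also have "\<dots> = x [^] (k * u) \<otimes> x [^] (int p * v)" by (rule int_pow_mult[OF x(1)])
    also have "x [^] (k * u) = \<one>" using int_pow_pow[OF x(1), of k u] k by simp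
    finally show False using xp x(3) by simp
  qed
qed

text \<open>\<open>T\<close> has order 2, \<open>V = U P\<close> has order 10, and the two are
  independent; their 20 products exhaust \<open>H\<close> by the bound on its size.\<close>

lemma (in comm_group) iso_Z2_Z10:
  assumes H: "subgroup H G" "finite H" "card H \<le> 20"
    and mem: "T \<in> H" "U \<in> H" "P \<in> H"
    and TU: "T [^] (2::nat) = \<one>" "U [^] (2::nat) = \<one>" "T \<noteq> \<one>" "U \<noteq> \<one>" "T \<noteq> U"
    and P: "P [^] (5::nat) = \<one>" "P \<noteq> \<one>"
  shows "G\<lparr>carrier := H\<rparr> \<cong> (integer_mod_group 2 \<times>\<times> integer_mod_group 10)"
proof -
  have cl: "T \<in> carrier G" "U \<in> carrier G" "P \<in> carrier G" using mem subgroup.subset[OF H(1)] by auto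
  define V where "V = U \<otimes> P"
  have Vcl: "V \<in> carrier G" using cl by (simp add: V_def)
  have Vpow: "V [^] k = U [^] k \<otimes> P [^] k" for k :: int
    unfolding V_def using cl int_pow_distrib by simp
  have pT: "T [^] k = \<one> \<longleftrightarrow> even k" "U [^] k = \<one> \<longleftrightarrow> even k" "P [^] k = \<one> \<longleftrightarrow> 5 dvd k" for k :: int
    using int_pow_eq_one_iff[OF two_is_prime_nat cl(1) TU(1,3)] int_pow_eq_one_iff[OF two_is_prime_nat cl(2) TU(2,4)]
      int_pow_eq_one_iff[OF prime_5 cl(3) P] by simp_all
  define f where "f = (\<lambda>(i::int, j::int). T [^] i \<otimes> V [^] j)"
  have f_cl: "f x \<in> carrier G" for x using cl Vcl by (cases x) (auto simp: f_def)
  have f_add: "f (i, j) \<otimes> f (i', j') = f (i + i', j + j')" for i j i' j'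
    unfolding f_def using cl Vcl by (simp add: int_pow_mult m_ac)
  \<comment> \<open>The fifth power removes \<open>P\<close> and leaves the 2-part, the square
    leaves the 5-part.\<close>
  have kernel: "even i \<and> 10 dvd j" if "f (i, j) = \<one>" for i j
  proof -
    have five: "(f (i, j)) [^] (5::int) = f (5 * i, 5 * j)" and two: "(f (i, j)) [^] (2::int) = f (2 * i, 2 * j)"
      unfolding f_def using cl Vcl by (simp_all add: int_pow_distrib int_pow_pow mult.commute)
    have "f (5 * i, 5 * j) = \<one>" "f (2 * i, 2 * j) = \<one>" unfolding five[symmetric] two[symmetric] that by simp_all
    moreover have "f (5 * i, 5 * j) = T [^] (5 * i) \<otimes> U [^] (5 * j)" "f (2 * i, 2 * j) = P [^] (2 * j)"
    proof -
      have "P [^] (5 * j) = \<one>" "U [^] (2 * j) = \<one>" "T [^] (2 * i) = \<one>" by (auto simp: pT)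
      then show "f (5 * i, 5 * j) = T [^] (5 * i) \<otimes> U [^] (5 * j)" "f (2 * i, 2 * j) = P [^] (2 * j)"
        unfolding f_def prod.case Vpow using cl by simp_all
    qed
    ultimately have 1: "T [^] (5 * i) \<otimes> U [^] (5 * j) = \<one>" and 2: "P [^] (2 * j) = \<one>" by simp_all
    have odd_pow: "X [^] k = X" if that: "X \<in> carrier G" "X [^] (2::nat) = \<one>" and odd: "odd k" for X and k :: int
    proof -
      obtain m where k: "k = 1 + 2 * m" using odd by (metis oddE add.commute)
      have "X [^] (2::int) = \<one>" using that(2) int_pow_int[of G X 2] by simp
      then have "X [^] (2 * m) = \<one>" using int_pow_pow[OF that(1), of 2 m] by simp
      moreover have "X [^] k = X [^] (1::int) \<otimes> X [^] (2 * m)" unfolding k by (rule int_pow_mult[OF that(1)])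
      ultimately show ?thesis using that(1) by simp
    qed
    have "even i \<and> even j"
    proof (rule ccontr)
      assume "\<not> (even i \<and> even j)"
      then consider "odd i" "even j" | "even i" "odd j" | "odd i" "odd j" by blast
      then show False
      proof cases
        case 1
        then have "U [^] (5 * j) = \<one>" "T [^] (5 * i) = T" using pT odd_pow cl TU by auto
        then show False using \<open>T [^] (5 * i) \<otimes> U [^] (5 * j) = \<one>\<close> TU cl by simp
      next
        case 2
        then have "U [^] (5 * j) = U" "T [^] (5 * i) = \<one>" using pT odd_pow cl TU by auto
        then show False using 1 TU cl by simp
      next
        case 3
        then have "T \<otimes> U = \<one>" using 1 odd_pow cl TU by auto
        moreover have "U \<otimes> U = \<one>" using TU(2) cl by (simp add: numeral_2_eq_2)
        ultimately show False using TU(5) cl by (metis right_cancel)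
      qed
    qed
    moreover have "5 dvd j" using 2 pT(3)[of "2 * j"] by presburger
    ultimately show ?thesis by presburger
  qed
  have f_mod: "f (i mod 2, j mod 10) = f (i, j)" for i j
  proof -
    have "f (2 * (i div 2), 10 * (j div 10)) = \<one>"
    proof -
      have "T [^] (2 * (i div 2)) = \<one>" "U [^] (10 * (j div 10)) = \<one>" "P [^] (10 * (j div 10)) = \<one>"
        unfolding pT by simp_all
      then show ?thesis unfolding f_def prod.case Vpow by simp
    qed
    then have "f (i mod 2, j mod 10) = f (i mod 2, j mod 10) \<otimes> f (2 * (i div 2), 10 * (j div 10))"
      using f_cl by simp
    then show ?thesis unfolding f_add by simp
  qed
  let ?Z = "integer_mod_group 2 \<times>\<times> integer_mod_group 10"
  have carr: "carrier ?Z = {0..<2} \<times> {0..<10}" by (simp add: carrier_integer_mod_group)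
  have sub: "subgroup H G" by (rule H(1))
  have f_H: "f x \<in> H" for x
  proof -
    have g: "group (G\<lparr>carrier := H\<rparr>)" by (rule subgroup_imp_group[OF sub])
    have VH: "V \<in> H" unfolding V_def using mem subgroup.m_closed[OF sub] by blast
    have pow: "X [^] k \<in> H" if "X \<in> H" for X and k :: int
      using group.int_pow_closed[OF g, of X k] int_pow_consistent[OF sub that] that by simp
    show ?thesis unfolding f_def using pow VH mem subgroup.m_closed[OF sub] by (cases x) auto
  qed
  have inj: "inj_on f ({0..<2} \<times> {0..<10})"
  proof (rule inj_onI, clarify)
    fix i j i' j' :: int
    assume b: "i \<in> {0..<2}" "j \<in> {0..<10}" "i' \<in> {0..<2}" "j' \<in> {0..<10}" and e: "f (i, j) = f (i', j')"
    have "f (i, j) \<otimes> f (- i', - j') = f (i', j') \<otimes> f (- i', - j')" unfolding e ..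
    then have "f (i - i', j - j') = f (0, 0)" unfolding f_add by simp
    also have "\<dots> = \<one>" by (simp add: f_def)
    finally have "even (i - i') \<and> 10 dvd (j - j')" by (rule kernel)
    then show "i = i' \<and> j = j'" using b by simp presburger
  qed
  have "card (f ` ({0..<2} \<times> {0..<10})) = 20"
    using card_image[OF inj] by (simp add: card_cartesian_product)
  then have image: "f ` ({0..<2} \<times> {0..<10}) = H"
    using f_H H by (intro card_seteq) auto
  have "f \<in> iso ?Z (G\<lparr>carrier := H\<rparr>)"
  proof (rule isoI)
    show "f \<in> hom ?Z (G\<lparr>carrier := H\<rparr>)"
      using f_H by (intro homI) (auto simp: f_mod f_add mult_DirProd)
    show "bij_betw f (carrier ?Z) (carrier (G\<lparr>carrier := H\<rparr>))"
      unfolding carr using inj image by (simp add: bij_betw_def)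
  qed
  then have "?Z \<cong> G\<lparr>carrier := H\<rparr>" by (auto simp: is_iso_def)
  moreover have "group ?Z" by (simp add: DirProd_group)
  ultimately show ?thesis using group.iso_sym by blast
qed

context triple_curve_over
begin

lemma torsion_subgroup: "subgroup (ec_torsion K a b c) EK"
proof (rule EK.subgroupI)
  show "ec_torsion K a b c \<subseteq> carrier EK" by (auto simp: ec_torsion_def)
  have N: "None \<in> ec_torsion K a b c"
    using EK.nat_pow_one[of 1] by (auto simp: torsion_iff EK_None intro!: exI[of _ 1])
  then show "ec_torsion K a b c \<noteq> {}" by auto
  have neg: "neg P \<in> ec_torsion K a b c" if "P \<in> ec_torsion K a b c" for P
    using torsion_diff[OF N that] by simp
  show "inv\<^bsub>EK\<^esub> P \<in> ec_torsion K a b c" if "P \<in> ec_torsion K a b c" for P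
    using neg[OF that] EK_inv[of P] that by (simp add: torsion_iff)
  show "P \<otimes>\<^bsub>EK\<^esub> Q \<in> ec_torsion K a b c" if "P \<in> ec_torsion K a b c" "Q \<in> ec_torsion K a b c" for P Q
    using torsion_diff[OF that(1) neg[OF that(2)]] by simp
qed

text \<open>For \<open>P = (0, 1)\<close> the first condition says that \<open>x(2P) = 1 / A\<close>, and then the second one says that
\<open>3P = - 2P\<close>.\<close>

lemma torsion_iso:
  assumes reg: "C\<^sup>2 = 4 * (B + 1)" "2 * A * (C + 2 * A) = 1"
    and card: "finite (ec_torsion K a b c)" "card (ec_torsion K a b c) \<le> 20"
  shows "ec_torsion_group K a b c \<cong> (integer_mod_group 2 \<times>\<times> integer_mod_group 10)"
proof -
  let ?T = "Some (- 1 / a, 0)" and ?U = "Some (- 1 / b, 0)" and ?P = "Some (0, 1)"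
  \<comment> \<open>The tangent at \<open>(0, 1)\<close> has slope \<open>C / 2\<close>, and
    \<open>Y\<close> is its height at \<open>1 / A\<close>.\<close>
  define Y where "Y = C / (2 * A) + 1"
  let ?Q = "Some (1 / A, - Y)"
  have A0: "A \<noteq> 0" by (rule A_nonzero)
  have two: "X [^]\<^bsub>EK\<^esub> (2::nat) = X \<oplus>\<^sub>E X" if "X \<in> ec_points K a b c" for X
    using that by (simp add: numeral_2_eq_2)
  have mem: "?T \<in> ec_points K a b c" "?U \<in> ec_points K a b c" "?P \<in> ec_points K a b c"
    using nonzero abc_K K_closed by (auto simp: EK_Some W_eq)
  have T2: "?T [^]\<^bsub>EK\<^esub> (2::nat) = None" "?U [^]\<^bsub>EK\<^esub> (2::nat) = None"
    using two[OF mem(1)] two[OF mem(2)] by (simp_all add: ec_add_def)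
  have P2: "?P \<oplus>\<^sub>E ?P = ?Q"
  proof -
    have "(C / 2)\<^sup>2 - B = 1" unfolding power_divide reg(1) by (simp add: field_simps)
    then have x: "((C / 2)\<^sup>2 - B) / A - 0 - 0 = 1 / A" by simp
    have l: "(3 * A * 0\<^sup>2 + 2 * B * 0 + C) / (2 * 1) = C / 2" by simp
    have y: "- (C / 2 * (1 / A) + (1 - C / 2 * 0)) = - Y" by (simp add: Y_def)
    have "(1::complex) \<noteq> - 1" by simp
    then show ?thesis
      unfolding ec_add_def option.case prod.case Let_def
      by (simp only: l x y if_True if_False simp_thms)
  qed
  have Y: "A * Y = C / 2 + A"
  proof -
    have "u * (v / (2 * u) + 1) = v / 2 + u" if "u \<noteq> 0" for u v :: complex
      using that by (simp add: field_simps)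
    from this[OF A0] show ?thesis unfolding Y_def .
  qed
  have P3: "?P \<oplus>\<^sub>E ?Q = Some (1 / A, Y)"
  proof -
    have l: "(- Y - 1) / (1 / A - 0) = - (C / 2 + 2 * A)"
    proof -
      have "(- Y - 1) / (1 / u - 0) = - (u * Y + u)" for u :: complex by (simp add: algebra_simps)
      from this[of A] show ?thesis unfolding Y by (simp add: algebra_simps)
    qed
    have "(- (C / 2 + 2 * A))\<^sup>2 = C\<^sup>2 / 4 + (2 * A * (C + 2 * A))" by (simp add: power2_eq_square algebra_simps)
    also have "\<dots> = B + 2" unfolding reg by simp
    finally have sq: "(- (C / 2 + 2 * A))\<^sup>2 = B + 2" .
    have x: "((- (C / 2 + 2 * A))\<^sup>2 - B) / A - 0 - 1 / A = 1 / A"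
    proof -
      have "(u + 2 - u) / v - 0 - 1 / v = 1 / v" for u v :: complex by simp
      from this[of B A] show ?thesis unfolding sq .
    qed
    have y: "- (- (C / 2 + 2 * A) * (1 / A) + (1 - - (C / 2 + 2 * A) * 0)) = Y"
    proof -
      have "- (- (v / 2 + 2 * u) * (1 / u) + (1 - - (v / 2 + 2 * u) * 0)) = v / (2 * u) + 1" if "u \<noteq> 0" for u v :: complex
        using that by (simp add: field_simps)
      from this[OF A0] show ?thesis unfolding Y_def .
    qed
    have "0 \<noteq> 1 / A" using A0 by simp
    then show ?thesis
      unfolding ec_add_def option.case prod.case Let_def
      by (simp only: l x y if_False simp_thms)
  qed
  have P5: "?P [^]\<^bsub>EK\<^esub> (5::nat) = None"
  proof -
    have m: "?P \<in> carrier EK" using mem by simp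
    have Q: "?P [^]\<^bsub>EK\<^esub> (2::nat) = ?Q" using two[OF mem(3)] P2 by simp
    have "?P [^]\<^bsub>EK\<^esub> (3::nat) = ?P \<otimes>\<^bsub>EK\<^esub> ?P [^]\<^bsub>EK\<^esub> (2::nat)"
      using EK.nat_pow_Suc2[OF m, of 2] by (simp add: numeral_3_eq_3 numeral_2_eq_2)
    then have R: "?P [^]\<^bsub>EK\<^esub> (3::nat) = Some (1 / A, Y)" unfolding Q using P3 by simp
    have "?P [^]\<^bsub>EK\<^esub> (5::nat) = ?P [^]\<^bsub>EK\<^esub> (3::nat) \<otimes>\<^bsub>EK\<^esub> ?P [^]\<^bsub>EK\<^esub> (2::nat)"
      using EK.nat_pow_mult[OF m, of 3 2] by simp
    then show ?thesis unfolding Q R by (simp add: ec_add_def)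
  qed
  have tors: "?T \<in> ec_torsion K a b c" "?U \<in> ec_torsion K a b c" "?P \<in> ec_torsion K a b c"
    unfolding torsion_iff using mem T2 P5 by (metis zero_less_numeral)+
  have "EK\<lparr>carrier := ec_torsion K a b c\<rparr> \<cong> (integer_mod_group 2 \<times>\<times> integer_mod_group 10)"
    using EK.iso_Z2_Z10[OF torsion_subgroup card tors] T2 P5 distinct nonzero by simp
  then show ?thesis by (simp add: ec_torsion_group_def EK_def)
qed

end

section \<open>Congruences modulo the prime and the count over the field with 25 elements\<close>

context unramified_abs
begin

text \<open>Congruence modulo the maximal ideal. Integrality of both sides is built in so that
  congruences can be multiplied.\<close>

definition close :: "complex \<Rightarrow> complex \<Rightarrow> bool" where
  "close x y \<longleftrightarrow> x \<in> K \<and> y \<in> K \<and> N x \<le> 1 \<and> N y \<le> 1 \<and> N (x - y) < 1"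

lemma close_refl: "x \<in> K \<Longrightarrow> N x \<le> 1 \<Longrightarrow> close x x"
  by (simp add: close_def N0)

lemma close_numeral: "close (numeral k) (numeral k)" and close_one: "close 1 1"
  by (simp_all add: close_refl K_closed N_numeral)

lemma close_I: "y \<in> K \<Longrightarrow> x \<in> K \<Longrightarrow> N y \<le> 1 \<Longrightarrow> N (x - y) < 1 \<Longrightarrow> close x y"
  using N_add_le[of "x - y" y 1] by (simp add: close_def K_closed)

lemma close_add: "close x y \<Longrightarrow> close u v \<Longrightarrow> close (x + u) (y + v)"
proof -
  assume xy: "close x y" and uv: "close u v"
  have "N ((x - y) + (u - v)) < 1" using xy uv by (intro N_add_less K_closed) (auto simp: close_def)
  moreover have "(x - y) + (u - v) = (x + u) - (y + v)" by simp
  ultimately have "N ((x + u) - (y + v)) < 1" by metis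
  then show ?thesis using xy uv by (auto simp: close_def K_closed N_add_le)
qed

lemma close_minus: "close x y \<Longrightarrow> close (- x) (- y)"
  using N_neg[of "x - y"] by (auto simp: close_def K_closed)

lemma close_diff: "close x y \<Longrightarrow> close u v \<Longrightarrow> close (x - u) (y - v)"
  using close_add[of x y "- u" "- v"] close_minus[of u v] by simp

lemma close_mult: "close x y \<Longrightarrow> close u v \<Longrightarrow> close (x * u) (y * v)"
proof -
  assume xy: "close x y" and uv: "close u v"
  have "N (x * u - y * v) = N ((x - y) * u + y * (u - v))" by (simp add: algebra_simps)
  also have "\<dots> < 1"
  proof (rule N_add_less)
    show "N ((x - y) * u) < 1"
      using xy uv mult_left_le[of "N u" "N (x - y)"] by (auto simp: close_def N_mult K_closed)
    show "N (y * (u - v)) < 1"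
      using xy uv mult_left_le[of "N y" "N (u - v)"] by (auto simp: close_def N_mult K_closed mult.commute)
  qed (use xy uv in \<open>auto simp: close_def K_closed\<close>)
  finally show ?thesis
    using xy uv N_mult_le[of x u 1 1] N_mult_le[of y v 1 1] by (auto simp: close_def K_closed)
qed

lemma close_power: "close x y \<Longrightarrow> close (x ^ m) (y ^ m)"
  by (induction m) (auto simp: close_one close_mult)

lemma close_unit: "close x y \<Longrightarrow> N y = 1 \<Longrightarrow> N x = 1"
  using N_add_eq[of y "x - y"] by (auto simp: close_def K_closed)

lemma close_0D: "close 0 y \<Longrightarrow> N y < 1"
  using N_neg[of y] by (auto simp: close_def)

lemmas close_intros = close_numeral close_one close_add close_diff close_mult close_power close_minus

end

text \<open>The affine points of \<open>y\<^sup>2 = (1 + 2 x) (1 + x + x\<^sup>2)\<close> over the field with 25 elements, where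
\<open>x = i + j s\<close>, \<open>y = k + l s\<close> and \<open>s\<^sup>2 = 2\<close>.\<close>

definition residue_solution :: "int \<times> int \<times> int \<times> int \<Rightarrow> bool" where
  "residue_solution = (\<lambda>(i, j, k, l).
     (k * k + 2 * (l * l) - (1 + 3 * i + 3 * (i * i + 2 * (j * j)) + 2 * (i * i * i + 6 * (i * (j * j))))) mod 5 = 0 \<and>
     (2 * (k * l) - (3 * j + 6 * (i * j) + 2 * (3 * (i * i * j) + 2 * (j * j * j)))) mod 5 = 0)"

text \<open>Together with the point at infinity this makes 20 points, the order of the group
  sought.\<close>

lemma residue_solution_count:
  "length (filter residue_solution (List.product [0..4] (List.product [0..4] (List.product [0..4] [0..4])))) = 19"
  by code_simp

lemma residue_solution_card:
  "finite {t \<in> {0..<5} \<times> {0..<5} \<times> {0..<5} \<times> {0..<5}. residue_solution t}"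
  "card {t \<in> {0..<5} \<times> {0..<5} \<times> {0..<5} \<times> {0..<5}. residue_solution t} \<le> 19"
proof -
  show "finite {t \<in> {0..<5} \<times> {0..<5} \<times> {0..<5} \<times> {0..<5}. residue_solution t}" by simp
  have "{0..<5} = {0..4::int}" by auto
  then have "{t \<in> {0..<5} \<times> {0..<5} \<times> {0..<5} \<times> {0..<5}. residue_solution t} =
    set (filter residue_solution (List.product [0..4] (List.product [0..4] (List.product [0..4] [0..4]))))"
    unfolding set_filter set_product set_upto by simp
  then show "card {t \<in> {0..<5} \<times> {0..<5} \<times> {0..<5} \<times> {0..<5}. residue_solution t} \<le> 19"
    using card_length residue_solution_count by metis
qed

text \<open>Here \<open>h\<close> is free, to be replaced by \<open>\<delta>\<^sup>2\<close>.
  Cleared of denominators, the identities encode the product \<open>tb * tc\<close>, the regularity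
  of the triple, the order 5 of \<open>(0, 1)\<close>, and the squares \<open>ta * tb + 1\<close>
  and \<open>ta * tc + 1\<close>.\<close>

lemma family_identities:
  fixes h :: complex
  defines "M \<equiv> h ^ 3 + h\<^sup>2 + h - 1" and "k \<equiv> h\<^sup>2 - 1"
  shows "M\<^sup>2 - 4 * h ^ 3 * (h\<^sup>2 + h - 1) = (h - 1)\<^sup>2 * k\<^sup>2"
    and "(2 * h + M)\<^sup>2 = 8 * h * M + (h - 1)\<^sup>2 * k\<^sup>2 + 4 * h * k\<^sup>2"
    and "(h - 1)\<^sup>2 * (2 * h + M + (h - 1)\<^sup>2) = k\<^sup>2 * h"
    and "M + k\<^sup>2 = h\<^sup>2 * (h\<^sup>2 + h - 1) + h"
  unfolding M_def k_def by (simp_all add: algebra_simps power2_eq_square power3_eq_cube)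

section \<open>The triples attached to a value of h, and their torsion groups\<close>

locale triple_family = inert_quadratic +
  fixes \<delta> r :: complex and \<eta> :: rat
  assumes \<delta>_K: "\<delta> \<in> K" and r_K: "r \<in> K"
    and \<delta>_sq: "\<delta>\<^sup>2 = of_rat \<eta>" and r_sq: "r\<^sup>2 = \<delta> ^ 4 + \<delta>\<^sup>2 - 1"
    and \<eta>_cong: "padic 5 (\<eta> - 3) < 1"
begin

definition "M = \<delta> ^ 6 + \<delta> ^ 4 + \<delta>\<^sup>2 - 1"
definition "k = \<delta> ^ 4 - 1"
definition "ta = 2 * \<delta> / k"
text \<open>A change of sign of \<open>r\<close> exchanges \<open>tb\<close> and \<open>tc\<close>:
  they are the roots of a quadratic polynomial with coefficients in terms of
  \<open>\<delta>\<close>, and \<open>r\<close> splits it over \<open>K\<close>. This splitting is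
  the full 2-torsion.\<close>

definition "tb = (M + 2 * \<delta> ^ 3 * r) / (2 * k * \<delta>)"
definition "tc = (M - 2 * \<delta> ^ 3 * r) / (2 * k * \<delta>)"

lemma K_mem: "k \<in> K" "M \<in> K" "ta \<in> K" "tb \<in> K" "tc \<in> K"
  unfolding k_def M_def ta_def tb_def tc_def by (intro K_closed \<delta>_K r_K)+

text \<open>Residues are therefore computed at \<open>h = 3\<close>, where \<open>k\<close> is 8 and
  \<open>M\<close> is 38.\<close>

lemma h_close: "close (\<delta>\<^sup>2) 3"
proof (rule close_I)
  have "\<delta>\<^sup>2 - 3 = of_rat (\<eta> - 3)" by (simp add: \<delta>_sq of_rat_diff)
  then show "N (\<delta>\<^sup>2 - 3) < 1" using N_of_rat \<eta>_cong by simp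
qed (simp_all add: K_closed \<delta>_K N_numeral)

lemma N_unit_int: "\<not> 5 dvd i \<Longrightarrow> N (of_int i) = 1"
  using N_of_int[of i] padic_unit[OF prime_5, of i] by simp

lemma pow4: "\<delta> ^ 4 = (\<delta>\<^sup>2)\<^sup>2" and pow6: "\<delta> ^ 6 = (\<delta>\<^sup>2) ^ 3"
  using power_mult[of \<delta> 2 2] power_mult[of \<delta> 2 3] by simp_all

lemma M_eq: "M = (\<delta>\<^sup>2) ^ 3 + (\<delta>\<^sup>2)\<^sup>2 + \<delta>\<^sup>2 - 1" and k_eq: "k = (\<delta>\<^sup>2)\<^sup>2 - 1"
  unfolding M_def k_def pow4 pow6 by (rule refl)+

lemma r_sq': "r\<^sup>2 = (\<delta>\<^sup>2)\<^sup>2 + \<delta>\<^sup>2 - 1"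
  unfolding r_sq pow4 ..

lemmas family = family_identities[of "\<delta>\<^sup>2", folded M_eq k_eq r_sq']

lemma k_close: "close k (3\<^sup>2 - 1)" and M_close: "close M (3 ^ 3 + 3\<^sup>2 + 3 - 1)"
  unfolding k_eq M_eq by (intro close_intros h_close)+

lemma N_h: "N (\<delta>\<^sup>2) = 1" and N_k: "N k = 1" and N_r: "N r = 1" and N_\<delta>: "N \<delta> = 1" and N_h1: "N (\<delta>\<^sup>2 - 1) = 1"
proof -
  show h: "N (\<delta>\<^sup>2) = 1" by (rule close_unit[OF h_close]) (use N_unit_int[of 3] in simp)
  show "N k = 1" by (rule close_unit[OF k_close]) (use N_unit_int[of 8] in simp)
  show "N (\<delta>\<^sup>2 - 1) = 1"
    by (rule close_unit[OF close_diff[OF h_close close_one]]) (use N_unit_int[of 2] in simp)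
  have sq: "N x = 1" if "x \<in> K" "N (x\<^sup>2) = 1" for x
  proof -
    have "N x = 1 \<or> N x = -1" using that N_power[of x 2] by (simp add: power2_eq_1_iff)
    then show ?thesis using N_nonneg[OF that(1)] by linarith
  qed
  show "N \<delta> = 1" by (rule sq[OF \<delta>_K h])
  have "close (r\<^sup>2) (3\<^sup>2 + 3 - 1)" unfolding r_sq pow4 by (intro close_intros h_close)
  then have "N (r\<^sup>2) = 1" by (rule close_unit) (use N_unit_int[of 11] in simp)
  then show "N r = 1" by (rule sq[OF r_K])
qed

lemma nz: "\<delta> \<noteq> 0" "k \<noteq> 0" "r \<noteq> 0"
  using N_\<delta> N_k N_r N0 by auto

lemma tbc: "tb * tc = (\<delta>\<^sup>2 - 1)\<^sup>2 / (4 * \<delta>\<^sup>2)"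
proof -
  have "(M + 2 * \<delta> ^ 3 * r) * (M - 2 * \<delta> ^ 3 * r) = M\<^sup>2 - 4 * \<delta> ^ 6 * r\<^sup>2"
    by (simp add: algebra_simps power2_eq_square flip: power_add)
  also have "\<dots> = (\<delta>\<^sup>2 - 1)\<^sup>2 * k\<^sup>2"
    unfolding pow6 by (rule family(1))
  finally have num: "(M + 2 * \<delta> ^ 3 * r) * (M - 2 * \<delta> ^ 3 * r) = (\<delta>\<^sup>2 - 1)\<^sup>2 * k\<^sup>2" .
  have "tb * tc = ((M + 2 * \<delta> ^ 3 * r) * (M - 2 * \<delta> ^ 3 * r)) / (4 * \<delta>\<^sup>2 * k\<^sup>2)"
    by (simp add: tb_def tc_def power2_eq_square)
  also have "\<dots> = (\<delta>\<^sup>2 - 1)\<^sup>2 / (4 * \<delta>\<^sup>2)" unfolding num using nz by simp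
  finally show ?thesis .
qed

lemma tb_plus_tc: "tb + tc = M / (k * \<delta>)"
  using nz by (simp add: tb_def tc_def flip: add_divide_distrib)

lemma tb_minus_tc: "tb - tc = 2 * \<delta>\<^sup>2 * r / k"
  using nz by (simp add: tb_def tc_def field_simps power2_eq_square power3_eq_cube)

lemma ta_tb: "ta * tb = (M + 2 * \<delta> ^ 3 * r) / k\<^sup>2" and ta_tc: "ta * tc = (M - 2 * \<delta> ^ 3 * r) / k\<^sup>2"
  using nz by (simp_all add: ta_def tb_def tc_def power2_eq_square)

lemma sum_abc: "ta + tb + tc = (2 * \<delta>\<^sup>2 + M) / (k * \<delta>)"
proof -
  have "ta = 2 * \<delta>\<^sup>2 / (k * \<delta>)" using nz by (simp add: ta_def power2_eq_square)
  then show ?thesis using tb_plus_tc by (simp add: add.assoc add_divide_distrib)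
qed

lemma prod_abc: "ta * tb * tc = (\<delta>\<^sup>2 - 1)\<^sup>2 / (2 * k * \<delta>)"
proof -
  have "ta * tb * tc = ta * (tb * tc)" by simp
  also have "\<dots> = (\<delta>\<^sup>2 - 1)\<^sup>2 / (2 * k * \<delta>)" unfolding tbc ta_def using nz by (simp add: power2_eq_square)
  finally show ?thesis .
qed

lemma sum_prods: "ta * tb + ta * tc + tb * tc = 2 * M / k\<^sup>2 + (\<delta>\<^sup>2 - 1)\<^sup>2 / (4 * \<delta>\<^sup>2)"
  unfolding ta_tb ta_tc tbc by (simp flip: add_divide_distrib)

lemma square_ab: "ta * tb + 1 = ((\<delta>\<^sup>2 * r + \<delta>) / k)\<^sup>2" and square_ac: "ta * tc + 1 = ((\<delta>\<^sup>2 * r - \<delta>) / k)\<^sup>2"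
  and square_bc: "tb * tc + 1 = ((\<delta>\<^sup>2 + 1) / (2 * \<delta>))\<^sup>2"
proof -
  have "M + 2 * \<delta> ^ 3 * r + k\<^sup>2 = (\<delta>\<^sup>2 * r + \<delta>)\<^sup>2" "M - 2 * \<delta> ^ 3 * r + k\<^sup>2 = (\<delta>\<^sup>2 * r - \<delta>)\<^sup>2"
    using family(4) by (simp_all add: algebra_simps power2_eq_square power3_eq_cube)
  moreover have "u / k\<^sup>2 + 1 = (u + k\<^sup>2) / k\<^sup>2" for u using nz by (simp add: add_divide_distrib)
  ultimately show "ta * tb + 1 = ((\<delta>\<^sup>2 * r + \<delta>) / k)\<^sup>2" "ta * tc + 1 = ((\<delta>\<^sup>2 * r - \<delta>) / k)\<^sup>2"
    unfolding ta_tb ta_tc power_divide by simp_all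
  show "tb * tc + 1 = ((\<delta>\<^sup>2 + 1) / (2 * \<delta>))\<^sup>2"
    unfolding tbc using nz by (simp add: field_simps power2_eq_square)
qed

text \<open>Equivalent to \<open>(ta + tb - tc)^2 = 4 (ta tb + 1)\<close>, the classical condition
  for a regular Diophantine triple. It gives the double of \<open>(0, 1)\<close> the first
  coordinate \<open>1 / (ta tb tc)\<close>.\<close>

lemma regular_triple: "(ta + tb + tc)\<^sup>2 = 4 * (ta * tb + ta * tc + tb * tc + 1)"
proof -
  have "(2 * \<delta>\<^sup>2 + M)\<^sup>2 = 8 * \<delta>\<^sup>2 * M + (\<delta>\<^sup>2 - 1)\<^sup>2 * k\<^sup>2 + 4 * \<delta>\<^sup>2 * k\<^sup>2"
    by (rule family(2))
  then have "(2 * \<delta>\<^sup>2 + M)\<^sup>2 / (k\<^sup>2 * \<delta>\<^sup>2) = 4 * (2 * M / k\<^sup>2 + (\<delta>\<^sup>2 - 1)\<^sup>2 / (4 * \<delta>\<^sup>2) + 1)"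
    using nz by (simp add: field_simps)
  then show ?thesis unfolding sum_abc sum_prods by (simp add: power_divide power_mult_distrib)
qed

lemma order_5: "2 * (ta * tb * tc) * (ta + tb + tc + 2 * (ta * tb * tc)) = 1"
proof -
  have "(\<delta>\<^sup>2 - 1)\<^sup>2 * (2 * \<delta>\<^sup>2 + M + (\<delta>\<^sup>2 - 1)\<^sup>2) = k\<^sup>2 * \<delta>\<^sup>2"
    by (rule family(3))
  moreover have "2 * (ta * tb * tc) * (ta + tb + tc + 2 * (ta * tb * tc)) =
      (\<delta>\<^sup>2 - 1)\<^sup>2 * (2 * \<delta>\<^sup>2 + M + (\<delta>\<^sup>2 - 1)\<^sup>2) / (k\<^sup>2 * \<delta>\<^sup>2)"
    unfolding sum_abc prod_abc using nz by (simp add: field_simps power2_eq_square)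
  ultimately show ?thesis using nz by simp
qed

lemma N_ta: "N ta = 1"
  unfolding ta_def using N_divide[of "2 * \<delta>" k] N_mult[of 2 \<delta>] N_\<delta> N_k K_mem \<delta>_K K_closed by simp

text \<open>If one element were larger than 1, the other would be smaller than 1 and the sum as
  large as the first. The assumptions determine \<open>r\<close> modulo 5 only up to sign, so
  \<open>tb\<close> and \<open>tc\<close> are approached through symmetric expressions such as
  these.\<close>

lemma N_units:
  assumes xy: "x \<in> K" "y \<in> K" "N (x * y) = 1" "N (x + y) \<le> 1"
  shows "N x = 1 \<and> N y = 1"
proof -
  have less: "v < 1" if "u > 1" "u * v = 1" for u v :: real
  proof (rule ccontr)
    assume "\<not> v < 1"
    then have "u * 1 \<le> u * v" using that(1) by (intro mult_left_mono) auto
    then show False using that by simp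
  qed
  have le: "N x \<le> 1" if xy: "x \<in> K" "y \<in> K" "N (x * y) = 1" "N (x + y) \<le> 1" for x y
  proof (rule ccontr)
    assume "\<not> N x \<le> 1"
    then have x1: "N x > 1" by simp
    moreover have "N x * N y = 1" using xy N_mult by simp
    ultimately have "N y < 1" by (rule less)
    then show False using N_add_eq[of x y] x1 xy by simp
  qed
  have "N x * N y = 1" using xy N_mult by simp
  moreover have "N x \<le> 1" "N y \<le> 1" using le[OF xy] le[of y x] xy by (simp_all add: mult.commute add.commute)
  ultimately show ?thesis
    using mult_mono[of "N x" 1 "N y" 1] mult_left_mono[of "N y" 1 "N x"] mult_right_mono[of "N x" 1 "N y"]
      N_nonneg[OF xy(1)] N_nonneg[OF xy(2)] by simp
qed

lemma N_bc: "N (tb * tc) = 1"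
proof -
  have "N ((\<delta>\<^sup>2 - 1)\<^sup>2) = 1" using N_power[of "\<delta>\<^sup>2 - 1" 2] N_h1 K_closed \<delta>_K by simp
  moreover have "N (4 * \<delta>\<^sup>2) = 1" using N_mult[of 4 "\<delta>\<^sup>2"] N_h N_unit_int[of 4] K_closed \<delta>_K by simp
  ultimately show ?thesis unfolding tbc using N_divide[of "(\<delta>\<^sup>2 - 1)\<^sup>2" "4 * \<delta>\<^sup>2"] K_closed \<delta>_K by simp
qed

lemma N_b_plus_c: "N (tb + tc) \<le> 1"
proof -
  have "N (k * \<delta>) = 1" using N_mult[of k \<delta>] N_k N_\<delta> K_mem \<delta>_K by simp
  moreover have "N M \<le> 1" using M_close by (simp add: close_def)
  ultimately show ?thesis unfolding tb_plus_tc using N_divide[of M "k * \<delta>"] K_mem \<delta>_K K_closed by simp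
qed

lemma N_tb: "N tb = 1" and N_tc: "N tc = 1"
  using N_units[OF K_mem(4,5) N_bc N_b_plus_c] by auto

lemma N_diff_bc: "N (tb - tc) = 1"
proof -
  have "N (2 * \<delta>\<^sup>2 * r) = 1" using N_mult[of 2 "\<delta>\<^sup>2"] N_mult[of "2 * \<delta>\<^sup>2" r] N_h N_r K_closed \<delta>_K r_K by simp
  then show ?thesis unfolding tb_minus_tc using N_divide[of "2 * \<delta>\<^sup>2 * r" k] N_k K_mem \<delta>_K r_K K_closed by simp
qed

lemma N_diff_a: "N (ta - tb) = 1" "N (ta - tc) = 1"
proof -
  \<comment> \<open>The numerator of \<open>(ta - tb) (ta - tc)\<close>, which is symmetric in
    \<open>tb\<close> and \<open>tc\<close>; at \<open>h = 3\<close> it takes the value -512, prime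
    to 5.\<close>
  define q where "q = 16 * (\<delta>\<^sup>2)\<^sup>2 - 8 * \<delta>\<^sup>2 * M + (\<delta>\<^sup>2 - 1)\<^sup>2 * k\<^sup>2"
  have qK: "q \<in> K" unfolding q_def by (intro K_closed \<delta>_K K_mem)
  have "close q (16 * 3\<^sup>2 - 8 * 3 * (3 ^ 3 + 3\<^sup>2 + 3 - 1) + (3 - 1)\<^sup>2 * (3\<^sup>2 - 1)\<^sup>2)"
    unfolding q_def by (intro close_intros h_close M_close k_close)
  then have Nq: "N q = 1" by (rule close_unit) (use N_unit_int[of "-512"] in simp)
  have "ta * ta = 4 * \<delta>\<^sup>2 / k\<^sup>2" by (simp add: ta_def power2_eq_square)
  moreover have "(ta - tb) * (ta - tc) = ta * ta - (ta * tb + ta * tc) + tb * tc" by (simp add: algebra_simps)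
  moreover have "ta * tb + ta * tc = 2 * M / k\<^sup>2" unfolding ta_tb ta_tc by (simp flip: add_divide_distrib)
  ultimately have "(ta - tb) * (ta - tc) = 4 * \<delta>\<^sup>2 / k\<^sup>2 - 2 * M / k\<^sup>2 + (\<delta>\<^sup>2 - 1)\<^sup>2 / (4 * \<delta>\<^sup>2)"
    unfolding tbc by simp
  also have "\<dots> = q / (4 * \<delta>\<^sup>2 * k\<^sup>2)"
    unfolding q_def using nz by (simp add: field_simps power2_eq_square)
  finally have "(ta - tb) * (ta - tc) = q / (4 * \<delta>\<^sup>2 * k\<^sup>2)" .
  moreover have "N (4 * \<delta>\<^sup>2 * k\<^sup>2) = 1"
    using N_mult[of 4 "\<delta>\<^sup>2"] N_mult[of "4 * \<delta>\<^sup>2" "k\<^sup>2"] N_power[of k 2] N_h N_k N_unit_int[of 4] K_closed \<delta>_K K_mem by simp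
  ultimately have "N ((ta - tb) * (ta - tc)) = 1"
    using N_divide[OF qK, of "4 * \<delta>\<^sup>2 * k\<^sup>2"] Nq K_closed \<delta>_K K_mem by simp
  moreover have "N ((ta - tb) + (ta - tc)) \<le> 1"
    using N_ta N_tb N_tc by (intro N_add_le N_diff_le K_closed K_mem) auto
  ultimately show "N (ta - tb) = 1" "N (ta - tc) = 1"
    using N_units[of "ta - tb" "ta - tc"] K_closed K_mem by auto
qed

sublocale curve: good_reduction ta tb tc K N 5
proof unfold_locales
  show "ta \<noteq> 0" "tb \<noteq> 0" "tc \<noteq> 0" "ta \<noteq> tb" "ta \<noteq> tc" "tb \<noteq> tc"
    using N_ta N_tb N_tc N_diff_a N_diff_bc N0 by auto
qed (use subfield K_mem N_ta N_tb N_tc N_diff_a N_diff_bc in auto)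

lemma triple: "diophantine_triple K ta tb tc"
proof -
  have "is_square_in K (x\<^sup>2)" if "x \<in> K" for x using that by (auto simp: is_square_in_def)
  moreover have "(\<delta>\<^sup>2 * r + \<delta>) / k \<in> K" "(\<delta>\<^sup>2 * r - \<delta>) / k \<in> K" "(\<delta>\<^sup>2 + 1) / (2 * \<delta>) \<in> K"
    by (intro K_closed \<delta>_K r_K K_mem)+
  ultimately show ?thesis
    unfolding diophantine_triple_def square_ab square_ac square_bc
    using K_mem curve.nonzero curve.distinct by simp
qed

text \<open>The substitution \<open>x = \<delta> z\<close> removes \<open>\<delta>\<close> from the
  cubic: its coefficients become rational functions of \<open>h\<close>, and at \<open>h = 3\<close>
  it is \<open>(1 + 2 z) (1 + z + z^2)\<close> modulo 5.\<close>

lemma torsion_residue: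
  assumes "Some (x, y) \<in> ec_torsion K ta tb tc"
  shows "\<exists>i j u v. (i, j, u, v) \<in> {t \<in> {0..<5} \<times> {0..<5} \<times> {0..<5} \<times> {0..<5}. residue_solution t} \<and>
    N (x / \<delta> - (of_int i + of_int j * s)) < 1 \<and> N (y - (of_int u + of_int v * s)) < 1"
proof -
  note t = curve.torsion_integral[OF assms]
  define z where "z = x / \<delta>"
  have zK: "z \<in> K" unfolding z_def by (intro K_closed t \<delta>_K)
  have Nz: "N z \<le> 1" unfolding z_def using N_divide[OF t(1) \<delta>_K] N_\<delta> t(4) by simp
  have x: "x = \<delta> * z" using nz by (simp add: z_def)
  obtain i j where ij: "i \<in> {0..<5}" "j \<in> {0..<5}" "N (z - (of_int i + of_int j * s)) < 1"
    by (rule residue[OF zK Nz])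
  obtain u v where uv: "u \<in> {0..<5}" "v \<in> {0..<5}" "N (y - (of_int u + of_int v * s)) < 1"
    by (rule residue[OF t(2,5)])
  have int_K: "of_int p + of_int q * s \<in> K \<and> N (of_int p + of_int q * s) \<le> 1" for p q :: int
    using qelt_in[of "of_int p" "of_int q"] N_qelt[of "of_int p" "of_int q"] padic_of_int_le[OF prime_5] by simp
  let ?z = "of_int i + of_int j * s" and ?y = "of_int u + of_int v * s"
  have cz: "close z ?z" and cy: "close y ?y"
    using int_K ij uv zK t by (auto intro!: close_I)
  have eq: "4 * k\<^sup>2 * y\<^sup>2 = (k + 2 * \<delta>\<^sup>2 * z) * (4 * k + 4 * M * z + k * (\<delta>\<^sup>2 - 1)\<^sup>2 * z\<^sup>2)"
  proof -
    have "y\<^sup>2 = (ta * x + 1) * (1 + (tb + tc) * x + tb * tc * x\<^sup>2)"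
      unfolding t(3) ec_rhs_def by (simp add: algebra_simps power2_eq_square)
    also have "\<dots> = (2 * \<delta>\<^sup>2 * z / k + 1) * (1 + M * z / k + (\<delta>\<^sup>2 - 1)\<^sup>2 * z\<^sup>2 / 4)"
    proof -
      have "ta * x = 2 * \<delta>\<^sup>2 * z / k" "(tb + tc) * x = M * z / k" "tb * tc * x\<^sup>2 = (\<delta>\<^sup>2 - 1)\<^sup>2 * z\<^sup>2 / 4"
        unfolding tb_plus_tc tbc ta_def x using nz by (simp_all add: power2_eq_square)
      then show ?thesis by simp
    qed
    finally show ?thesis using nz by (simp add: field_simps power2_eq_square)
  qed
  \<comment> \<open>The curve equation cleared of denominators, with \<open>h\<close>,
    \<open>z\<close> and \<open>y\<close> replaced by their representatives 3, \<open>?z\<close> and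
    \<open>?y\<close>.\<close>
  let ?E = "4 * (3\<^sup>2 - 1)\<^sup>2 * ?y\<^sup>2 - ((3\<^sup>2 - 1) + 2 * 3 * ?z) * (4 * (3\<^sup>2 - 1) + 4 * (3 ^ 3 + 3\<^sup>2 + 3 - 1) * ?z + (3\<^sup>2 - 1) * (3 - 1)\<^sup>2 * ?z\<^sup>2)"
  have "close (4 * k\<^sup>2 * y\<^sup>2 - (k + 2 * \<delta>\<^sup>2 * z) * (4 * k + 4 * M * z + k * (\<delta>\<^sup>2 - 1)\<^sup>2 * z\<^sup>2))
    (4 * (3\<^sup>2 - 1)\<^sup>2 * ?y\<^sup>2 - ((3\<^sup>2 - 1) + 2 * 3 * ?z) * (4 * (3\<^sup>2 - 1) + 4 * (3 ^ 3 + 3\<^sup>2 + 3 - 1) * ?z + (3\<^sup>2 - 1) * (3 - 1)\<^sup>2 * ?z\<^sup>2))"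
    by (intro close_intros h_close M_close k_close cz cy)
  then have "close 0 ?E" unfolding eq diff_self .
  then have "N ?E < 1" by (rule close_0D)
  also have "?E =
    of_int (256 * (u * u + d * (v * v)) - (256 + 1408 * i + 1168 * (i * i + d * (j * j)) + 192 * (i * i * i + 3 * (d * (i * (j * j)))))) +
    of_int (512 * (u * v) - (1408 * j + 2336 * (i * j) + 192 * (3 * (i * i * j) + d * (j * j * j)))) * s"
  proof -
    have "4 * (3\<^sup>2 - 1)\<^sup>2 * (U + V * s)\<^sup>2 - ((3\<^sup>2 - 1) + 2 * 3 * (I + J * s)) * (4 * (3\<^sup>2 - 1) + 4 * (3 ^ 3 + 3\<^sup>2 + 3 - 1) * (I + J * s) + (3\<^sup>2 - 1) * (3 - 1)\<^sup>2 * (I + J * s)\<^sup>2) =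
      (256 * (U * U + s\<^sup>2 * (V * V)) - (256 + 1408 * I + 1168 * (I * I + s\<^sup>2 * (J * J)) + 192 * (I * I * I + 3 * (s\<^sup>2 * (I * (J * J)))))) +
      (512 * (U * V) - (1408 * J + 2336 * (I * J) + 192 * (3 * (I * I * J) + s\<^sup>2 * (J * J * J)))) * s" for I J U V :: complex
      by (simp add: algebra_simps power2_eq_square)
    from this[of "of_int u" "of_int v" "of_int i" "of_int j"] show ?thesis unfolding s_sq by simp
  qed
  finally have dvd: "5 dvd 256 * (u * u + d * (v * v)) - (256 + 1408 * i + 1168 * (i * i + d * (j * j)) + 192 * (i * i * i + 3 * (d * (i * (j * j)))))"
    "5 dvd 512 * (u * v) - (1408 * j + 2336 * (i * j) + 192 * (3 * (i * i * j) + d * (j * j * j)))"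
    unfolding N_int_pair by auto
  \<comment> \<open>What remains is to reduce \<open>d\<close> and the integer coefficients obtained
    at \<open>h = 3\<close> modulo 5; the explicit multiples of 5 below are the differences.\<close>
  obtain t where d: "d = 2 + 5 * t" using d_mod by (metis mult_div_mod_eq add.commute)
  have "residue_solution (i, j, u, v)"
    unfolding residue_solution_def prod.case
  proof (intro conjI)
    have "u * u + 2 * (v * v) - (1 + 3 * i + 3 * (i * i + 2 * (j * j)) + 2 * (i * i * i + 6 * (i * (j * j)))) =
      (256 * (u * u + d * (v * v)) - (256 + 1408 * i + 1168 * (i * i + d * (j * j)) + 192 * (i * i * i + 3 * (d * (i * (j * j))))))
      - 5 * (51 * (u * u) + (102 + 256 * t) * (v * v) - 51 - 281 * i - 233 * (i * i) - (466 + 1168 * t) * (j * j) - 38 * (i * i * i) - (228 + 576 * t) * (i * (j * j)))"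
      unfolding d by (simp add: algebra_simps)
    then show "(u * u + 2 * (v * v) - (1 + 3 * i + 3 * (i * i + 2 * (j * j)) + 2 * (i * i * i + 6 * (i * (j * j))))) mod 5 = 0"
      using dvd(1) by (metis dvd_diff dvd_triv_left mod_eq_0_iff_dvd)
    have "2 * (u * v) - (3 * j + 6 * (i * j) + 2 * (3 * (i * i * j) + 2 * (j * j * j))) =
      (512 * (u * v) - (1408 * j + 2336 * (i * j) + 192 * (3 * (i * i * j) + d * (j * j * j))))
      - 5 * (102 * (u * v) - 281 * j - 466 * (i * j) - 114 * (i * i * j) - (76 + 192 * t) * (j * j * j))"
      unfolding d by (simp add: algebra_simps)
    then show "(2 * (u * v) - (3 * j + 6 * (i * j) + 2 * (3 * (i * i * j) + 2 * (j * j * j)))) mod 5 = 0"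
      using dvd(2) by (metis dvd_diff dvd_triv_left mod_eq_0_iff_dvd)
  qed
  then show ?thesis using ij uv unfolding z_def by blast
qed

lemma torsion_card: "finite (ec_torsion K ta tb tc)" "card (ec_torsion K ta tb tc) \<le> 20"
proof -
  let ?S = "{t \<in> {0..<5} \<times> {0..<5} \<times> {0..<5} \<times> {0..<5}. residue_solution t}"
  let ?T = "{(x, y). Some (x, y) \<in> ec_torsion K ta tb tc}"
  \<comment> \<open>A torsion point is sent to the residues of \<open>x / \<delta>\<close> and
    \<open>y\<close>. Dividing by the unit \<open>\<delta>\<close> preserves congruences, so
    \<open>torsion_reduction_inj\<close> makes this injective.\<close>
  define R where "R = (\<lambda>(x, y) (i, j, u, v). N (x / \<delta> - (of_int i + of_int j * s)) < 1 \<and> N (y - (of_int u + of_int v * s)) < 1)"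
  have "\<exists>t. t \<in> ?S \<and> R w t" if "w \<in> ?T" for w
  proof -
    obtain x y where w: "w = (x, y)" by force
    then have "Some (x, y) \<in> ec_torsion K ta tb tc" using that by simp
    from torsion_residue[OF this] show ?thesis unfolding R_def w by (simp only: prod.case) blast
  qed
  then have "\<forall>w\<in>?T. \<exists>t. t \<in> ?S \<and> R w t" by (rule ballI)
  from bchoice[OF this] obtain f where "\<forall>w\<in>?T. f w \<in> ?S \<and> R w (f w)" by (rule exE)
  then have f: "f w \<in> ?S \<and> R w (f w)" if "w \<in> ?T" for w using that by (rule bspec)
  have inj: "inj_on f ?T"
  proof (rule inj_onI, clarify)
    fix x y x' y'
    assume t: "Some (x, y) \<in> ec_torsion K ta tb tc" "Some (x', y') \<in> ec_torsion K ta tb tc" and e: "f (x, y) = f (x', y')"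
    obtain i j u v where w: "f (x, y) = (i, j, u, v)" by (metis surj_pair)
    let ?z = "of_int i + of_int j * s" and ?y = "of_int u + of_int v * s"
    have zyK: "?z \<in> K" "?y \<in> K" using qelt_in[of "of_int i" "of_int j"] qelt_in[of "of_int u" "of_int v"] by simp_all
    note m = curve.torsion_integral[OF t(1)] and m' = curve.torsion_integral[OF t(2)]
    have 1: "N (x / \<delta> - ?z) < 1" "N (y - ?y) < 1" using f[of "(x, y)"] t w by (simp_all add: R_def)
    have 2: "N (x' / \<delta> - ?z) < 1" "N (y' - ?y) < 1" using f[of "(x', y')"] t w e by (simp_all add: R_def)
    have "N ((x / \<delta> - ?z) - (x' / \<delta> - ?z)) < 1"
      by (rule N_diff_less[OF K_closed(7)[OF K_closed(8)[OF m(1) \<delta>_K] zyK(1)] K_closed(7)[OF K_closed(8)[OF m'(1) \<delta>_K] zyK(1)] 1(1) 2(1)])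
    moreover have "(x / \<delta> - ?z) - (x' / \<delta> - ?z) = (x - x') / \<delta>" by (simp add: diff_divide_distrib)
    ultimately have cx: "N (x - x') < 1"
      using N_divide[of "x - x'" \<delta>] N_\<delta> K_closed m m' \<delta>_K by simp
    have "N ((y - ?y) - (y' - ?y)) < 1"
      by (rule N_diff_less[OF K_closed(7)[OF m(2) zyK(2)] K_closed(7)[OF m'(2) zyK(2)] 1(2) 2(2)])
    then have cy: "N (y - y') < 1" by simp
    show "x = x' \<and> y = y'" by (rule curve.torsion_reduction_inj[OF t cx cy])
  qed
  have fS: "f ` ?T \<subseteq> ?S" using f by blast
  have fin: "finite ?T" using inj_on_finite[OF inj fS residue_solution_card(1)] .
  have "card ?T \<le> 19"
    using card_inj_on_le[OF inj fS residue_solution_card(1)] residue_solution_card(2) by linarith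
  \<comment> \<open>The point at infinity raises the affine bound 19 to 20.\<close>
  have sub: "ec_torsion K ta tb tc \<subseteq> insert None (Some ` ?T)"
  proof
    fix Q assume "Q \<in> ec_torsion K ta tb tc"
    then show "Q \<in> insert None (Some ` ?T)" by (cases Q) auto
  qed
  show "finite (ec_torsion K ta tb tc)" using finite_subset[OF sub] fin by simp
  have "card (ec_torsion K ta tb tc) \<le> card (insert None (Some ` ?T))"
    using card_mono[OF _ sub] fin by simp
  also have "\<dots> \<le> Suc (card (Some ` ?T))" by (rule card_insert_le_m1) (use fin in auto)
  also have "\<dots> \<le> 20" using card_image_le[OF fin, of Some] \<open>card ?T \<le> 19\<close> by simp
  finally show "card (ec_torsion K ta tb tc) \<le> 20" .
qed

lemma torsion_Z2_Z10: "ec_torsion_group K ta tb tc \<cong> (integer_mod_group 2 \<times>\<times> integer_mod_group 10)"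
  by (rule curve.torsion_iso[OF regular_triple order_5 torsion_card])

end

section \<open>Infinitely many triples over infinitely many fields\<close>

abbreviation (input) good_triple :: "complex set \<Rightarrow> complex \<Rightarrow> complex \<Rightarrow> complex \<Rightarrow> bool" where
  "good_triple K a b c \<equiv> diophantine_triple K a b c \<and>
    ec_torsion_group K a b c \<cong> (integer_mod_group 2 \<times>\<times> integer_mod_group 10)"

section \<open>Multiplication by 3 on the parameter curve and its effect at 3 and at 5\<close>

definition trip_num :: "rat \<Rightarrow> rat" where "trip_num m = m ^ 4 - 30 * m\<^sup>2 + 40 * m - 75"
text \<open>The 3-division polynomial of \<open>y^2 = m (m^2 - 2 m + 5)\<close>. As
  \<open>(0, 0)\<close> has order 2, tripling multiplies the first coordinate by a square, that of
  \<open>trip_num / trip_den\<close>; \<open>trip_fac\<close> enters the second coordinate.\<close>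

definition trip_den :: "rat \<Rightarrow> rat" where "trip_den m = 3 * m ^ 4 - 8 * m ^ 3 + 30 * m\<^sup>2 - 25"
definition trip_fac :: "rat \<Rightarrow> rat" where
  "trip_fac m = m ^ 8 - 8 * m ^ 7 + 140 * m ^ 6 - 280 * m ^ 5 + 470 * m ^ 4 - 1400 * m ^ 3 + 3500 * m\<^sup>2 - 1000 * m + 625"

text \<open>The first coordinate of multiplication by 3 on the elliptic curve
\<open>d y\<^sup>2 = m (m\<^sup>2 - 2 m + 5)\<close>.\<close>

definition tripling :: "rat \<Rightarrow> rat" where "tripling m = m * (trip_num m / trip_den m)\<^sup>2"

lemma tripling_identity:
  "m\<^sup>2 * trip_num m ^ 4 - 2 * m * (trip_num m)\<^sup>2 * (trip_den m)\<^sup>2 + 5 * trip_den m ^ 4 =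
   (m\<^sup>2 - 2 * m + 5) * (trip_fac m)\<^sup>2"
  unfolding trip_num_def trip_den_def trip_fac_def by algebra

lemma tripling_curve:
  assumes "trip_den m \<noteq> 0" "m * (m\<^sup>2 - 2 * m + 5) = of_int d * w\<^sup>2"
  shows "\<exists>w'. tripling m * ((tripling m)\<^sup>2 - 2 * tripling m + 5) = of_int d * w'\<^sup>2"
proof
  let ?n = "trip_num m" and ?e = "trip_den m" and ?g = "trip_fac m"
  have "tripling m * ((tripling m)\<^sup>2 - 2 * tripling m + 5) =
      m * ?n\<^sup>2 * (m\<^sup>2 * ?n ^ 4 - 2 * m * ?n\<^sup>2 * ?e\<^sup>2 + 5 * ?e ^ 4) / ?e ^ 6"
    using assms(1) unfolding tripling_def
    by (simp add: divide_simps power_divide power_mult_distrib) (simp add: algebra_simps eval_nat_numeral)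
  also have "\<dots> = (m * (m\<^sup>2 - 2 * m + 5)) * (?n * ?g / ?e ^ 3)\<^sup>2"
    unfolding tripling_identity by (simp add: power_divide power_mult_distrib flip: power_mult)
  also have "\<dots> = of_int d * (w * (?n * ?g / ?e ^ 3))\<^sup>2"
    unfolding assms(2) by (simp only: power_mult_distrib mult.assoc)
  finally show "tripling m * ((tripling m)\<^sup>2 - 2 * tripling m + 5) = of_int d * (w * (?n * ?g / ?e ^ 3))\<^sup>2" .
qed

context
  fixes p :: nat
  assumes p: "prime p"
begin

lemma padic_int_add: "padic p x \<le> 1 \<Longrightarrow> padic p y \<le> 1 \<Longrightarrow> padic p (x + y) \<le> 1"
  using padic_add[OF p, of x y] by simp

lemma padic_int_diff: "padic p x \<le> 1 \<Longrightarrow> padic p y \<le> 1 \<Longrightarrow> padic p (x - y) \<le> 1"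
  using padic_diff[OF p, of x y] by simp

lemma padic_int_mult: "padic p x \<le> 1 \<Longrightarrow> padic p y \<le> 1 \<Longrightarrow> padic p (x * y) \<le> 1"
  using padic_nonneg[OF p] by (simp add: padic_mult[OF p] mult_le_one)

lemma padic_int_power: "padic p x \<le> 1 \<Longrightarrow> padic p (x ^ n) \<le> 1"
  using padic_nonneg[OF p] by (simp add: padic_power[OF p] power_le_one)

lemma padic_numeral: "padic p (numeral k) \<le> 1"
  using padic_of_int_le[OF p, of "numeral k"] by simp

lemmas padic_integral = padic_int_add padic_int_diff padic_int_mult padic_int_power padic_numeral

lemma padic_mult_less: "padic p x < r \<Longrightarrow> padic p y \<le> 1 \<Longrightarrow> padic p (x * y) < r"
  using padic_nonneg[OF p] mult_left_le[of "padic p y" "padic p x"] by (simp add: padic_mult[OF p] order_le_less_trans)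

text \<open>Squares have even valuation.\<close>

lemma padic_square_neq: "padic p (v\<^sup>2) \<noteq> 1 / real p"
proof
  assume e: "padic p (v\<^sup>2) = 1 / real p"
  have p1: "real p > 1" using p prime_gt_1_nat by simp
  have "v \<noteq> 0" using e p1 by auto
  obtain a b where v: "v = of_int a / of_int b" "b \<noteq> 0" by (rule rat_cases[OF p])
  have "a \<noteq> 0" using v \<open>v \<noteq> 0\<close> by auto
  define k where "k = int (multiplicity (int p) b) - int (multiplicity (int p) a)"
  have "padic p v = real p powi k" unfolding v k_def using padic_divide_int[OF p \<open>a \<noteq> 0\<close> v(2)] .
  then have "padic p (v\<^sup>2) = real p powi (2 * k)"
    using p1 power_int_add[of "real p" k k] by (simp add: padic_power[OF p] power2_eq_square[of "real p powi k"])
  moreover have "1 / real p = real p powi (-1)" by (simp add: power_int_minus divide_inverse)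
  ultimately have "real p powi (2 * k) = real p powi (-1)" using e by simp
  moreover have "2 * k < -1 \<or> 2 * k > -1" by presburger
  ultimately show False
    using power_int_strict_increasing[of "2 * k" "-1" "real p"] power_int_strict_increasing[of "-1" "2 * k" "real p"] p1
    by auto
qed

end

text \<open>For so small an \<open>m\<close> the constant terms decide: -75 is divisible by 3
  exactly once, -25 not at all.\<close>

lemma padic_3_tripling:
  assumes "padic 3 m \<le> 1 / 9"
  shows "padic 3 (tripling m) = padic 3 m / 9"
proof -
  note P = prime_3
  have m1: "padic 3 m \<le> 1" "padic 3 m < 1" "padic 3 m < 1 / 3" using assms by simp_all
  have "padic 3 (m * (m ^ 3 - 30 * m + 40)) < 1 / 3"
    by (intro padic_mult_less[OF P] padic_integral[OF P] m1)
  moreover have 75: "padic 3 (- 75) = 1 / 3"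
  proof -
    have "padic 3 3 = 1 / 3" using padic_of_int[OF P, of 3] by simp
    moreover have "padic 3 25 = 1" using padic_unit[OF P, of 25] by simp
    ultimately show ?thesis using padic_mult[OF P, of 3 25] padic_minus[OF P, of 75] by simp
  qed
  moreover have "trip_num m = - 75 + m * (m ^ 3 - 30 * m + 40)"
    by (simp add: trip_num_def algebra_simps power2_eq_square eval_nat_numeral)
  ultimately have n: "padic 3 (trip_num m) = 1 / 3"
    using padic_add_eq[OF P, of "m * (m ^ 3 - 30 * m + 40)" "- 75"] by (simp only:)
  have "padic 3 (m * (3 * m ^ 3 - 8 * m\<^sup>2 + 30 * m)) < 1"
    by (intro padic_mult_less[OF P] padic_integral[OF P] m1)
  moreover have "padic 3 (- 25) = 1" using padic_unit[OF P, of "- 25"] by simp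
  moreover have "trip_den m = - 25 + m * (3 * m ^ 3 - 8 * m\<^sup>2 + 30 * m)"
    by (simp add: trip_den_def algebra_simps power2_eq_square eval_nat_numeral)
  ultimately have e: "padic 3 (trip_den m) = 1"
    using padic_add_eq[OF P, of "m * (3 * m ^ 3 - 8 * m\<^sup>2 + 30 * m)" "- 25"] by (simp only:)
  show ?thesis
    by (simp add: tripling_def padic_mult[OF P] padic_power[OF P] padic_divide[OF P] n e power2_eq_square)
qed

context inert_quadratic
begin

text \<open>At \<open>m = -1\<close> the quotient of \<open>trip_num\<close> by
  \<open>trip_den\<close> is -144 / 16 = -9, so tripling gives -81, again -1 modulo 5.\<close>

lemma tripling_mod_5:
  assumes "padic 5 (m + 1) < 1"
  shows "trip_den m \<noteq> 0" "padic 5 (tripling m + 1) < 1"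
proof -
  note P = prime_5
  let ?m = "of_rat m :: complex"
  have cm: "close ?m (- 1)"
  proof (rule close_I)
    have "?m - (- 1) = of_rat (m + 1)" by (simp add: of_rat_add)
    then show "N (?m - (- 1)) < 1" using assms N_of_rat by simp
  qed (simp_all add: K_closed of_rat_K)
  have n: "of_rat (trip_num m) = ?m ^ 4 - 30 * ?m\<^sup>2 + 40 * ?m - 75"
    and e: "of_rat (trip_den m) = 3 * ?m ^ 4 - 8 * ?m ^ 3 + 30 * ?m\<^sup>2 - 25"
    by (simp_all add: trip_num_def trip_den_def of_rat_add of_rat_diff of_rat_mult of_rat_power)
  have cn: "close (of_rat (trip_num m)) ((- 1) ^ 4 - 30 * (- 1)\<^sup>2 + 40 * (- 1) - 75)"
    unfolding n by (intro close_intros cm)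
  have ce: "close (of_rat (trip_den m)) (3 * (- 1) ^ 4 - 8 * (- 1) ^ 3 + 30 * (- 1)\<^sup>2 - 25)"
    unfolding e by (intro close_intros cm)
  have "N (of_int 16) = 1" using N_of_int[of 16] padic_unit[OF P, of 16] by simp
  then have Ne: "N (of_rat (trip_den m)) = 1" using close_unit[OF ce] by simp
  then show e0: "trip_den m \<noteq> 0" using N0 by auto
  have "close (?m * (of_rat (trip_num m))\<^sup>2 + (of_rat (trip_den m))\<^sup>2)
     ((- 1) * ((- 1) ^ 4 - 30 * (- 1)\<^sup>2 + 40 * (- 1) - 75)\<^sup>2 + (3 * (- 1) ^ 4 - 8 * (- 1) ^ 3 + 30 * (- 1)\<^sup>2 - 25)\<^sup>2)"
    by (intro close_add close_mult close_power cm cn ce)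
  then have c: "close (of_rat (m * (trip_num m)\<^sup>2 + (trip_den m)\<^sup>2)) (of_int (- 20480))"
    by (simp add: of_rat_add of_rat_mult of_rat_power)
  have lt: "N (of_int (- 20480)) < 1" using N_of_int[of "- 20480"] padic_of_int_less_iff[OF P, of "- 20480"] by simp
  have "N ((of_rat (m * (trip_num m)\<^sup>2 + (trip_den m)\<^sup>2) - of_int (- 20480)) + of_int (- 20480)) < 1"
    using c lt by (intro N_add_less) (auto simp: close_def K_closed)
  then have "padic 5 (m * (trip_num m)\<^sup>2 + (trip_den m)\<^sup>2) < 1" unfolding diff_add_cancel N_of_rat .
  moreover have "tripling m + 1 = (m * (trip_num m)\<^sup>2 + (trip_den m)\<^sup>2) / (trip_den m)\<^sup>2"
    using e0 by (simp add: tripling_def power_divide add_divide_distrib)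
  moreover have "padic 5 (trip_den m) = 1" using Ne unfolding N_of_rat .
  ultimately show "padic 5 (tripling m + 1) < 1"
    by (simp add: padic_divide[OF P] padic_power[OF P])
qed

text \<open>The clause about \<open>x\<close> serves to tell triples apart: the square of the
  product of the triple is a rational number that remembers the 3-adic size of
  \<open>m\<close>.\<close>

lemma parameter_triple:
  assumes m: "padic 5 (m + 1) < 1" and w: "m * (m\<^sup>2 - 2 * m + 5) = of_int d * w\<^sup>2"
    and m3: "padic 3 m < 1"
  shows "\<exists>a b c x. good_triple K a b c \<and> (a * b * c)\<^sup>2 = of_rat x \<and> padic 3 x = padic 3 m"
proof -
  note P = prime_5
  have Nm: "padic 5 m = 1"
    using padic_add_eq[OF P, of "m + 1" "- 1"] padic_minus[OF P, of 1] m by (simp add: padic_1[OF P])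
  then have m0: "m \<noteq> 0" by auto
  define h where "h = (m\<^sup>2 - 2 * m + 5) / (4 * m)"
  \<comment> \<open>The equation for \<open>w\<close> says \<open>h = d (w / (2 m))^2\<close>, so
    this element squares to \<open>h\<close>.\<close>
  define \<delta> where "\<delta> = of_rat (w / (2 * m)) * s"
  define r where "r = (of_rat ((m\<^sup>2 - 5) / (4 * m)) :: complex)"
  have h: "of_int d * (w / (2 * m))\<^sup>2 = h"
  proof -
    have "of_int d * (w / (2 * m))\<^sup>2 = (of_int d * w\<^sup>2) / (4 * m\<^sup>2)" by (simp add: power_divide power_mult_distrib)
    also have "\<dots> = h" unfolding w[symmetric] h_def using m0 by (simp add: power2_eq_square)
    finally show ?thesis .
  qed
  have \<delta>2: "\<delta>\<^sup>2 = of_rat h"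
    unfolding \<delta>_def power_mult_distrib s_sq h[symmetric] of_rat_mult of_rat_power of_rat_of_int_eq
    by (rule mult.commute)
  have \<delta>4: "\<delta> ^ 4 = of_rat (h\<^sup>2)"
    using power_mult[of \<delta> 2 2] \<delta>2 by (simp add: of_rat_power)
  have r2: "((m\<^sup>2 - 5) / (4 * m))\<^sup>2 = h\<^sup>2 + h - 1"
    unfolding h_def using m0 by (simp add: field_simps power2_eq_square)
  have h3: "padic 5 (h - 3) < 1"
  proof -
    \<comment> \<open>\<open>4 m (h - 3) = m^2 - 14 m + 5 = (m + 1) (m - 15) + 20\<close>.\<close>
    have "padic 5 ((m + 1) * (m - 15)) < 1"
      using Nm by (intro padic_mult_less[OF P] padic_integral[OF P] m) simp
    moreover have "padic 5 20 < 1" using padic_of_int_less_iff[OF P, of 20] by simp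
    ultimately have "padic 5 ((m + 1) * (m - 15) + 20) < 1" using padic_add[OF P, of "(m + 1) * (m - 15)" 20] by simp
    moreover have "h - 3 = ((m + 1) * (m - 15) + 20) / (4 * m)"
      unfolding h_def using m0 by (simp add: field_simps power2_eq_square)
    moreover have "padic 5 (4 * m) = 1" using padic_mult[OF P, of 4 m] Nm padic_unit[OF P, of 4] by simp
    ultimately show ?thesis by (simp add: padic_divide[OF P])
  qed
  interpret F: triple_family d s \<delta> r h
  proof unfold_locales
    show "\<delta> \<in> K" unfolding \<delta>_def by (intro K_closed of_rat_K s_K)
    show "r \<in> K" unfolding r_def by (rule of_rat_K)
    show "r\<^sup>2 = \<delta> ^ 4 + \<delta>\<^sup>2 - 1"
      unfolding r_def \<delta>2 \<delta>4 of_rat_power[symmetric] r2 by (simp add: of_rat_add of_rat_diff)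
  qed (use \<delta>2 h3 in auto)
  define x where "x = (h - 1) ^ 4 / (4 * (h\<^sup>2 - 1)\<^sup>2 * h)"
  have "(F.ta * F.tb * F.tc)\<^sup>2 = (\<delta>\<^sup>2 - 1) ^ 4 / (4 * F.k\<^sup>2 * \<delta>\<^sup>2)"
    unfolding F.prod_abc by (simp add: power_divide power_mult_distrib flip: power_mult)
  also have "\<dots> = of_rat x"
    unfolding F.k_def \<delta>4 \<delta>2 x_def by (simp add: of_rat_divide of_rat_mult of_rat_diff of_rat_power)
  finally have prod: "(F.ta * F.tb * F.tc)\<^sup>2 = of_rat x" .
  note Q = prime_3
  have "padic 3 (m * (m - 2)) < 1"
    using m3 by (intro padic_mult_less[OF Q] padic_integral[OF Q]) simp_all
  then have "padic 3 (5 + m * (m - 2)) = 1" using padic_add_eq[OF Q, of "m * (m - 2)" 5] padic_unit[OF Q, of 5] by simp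
  moreover have "padic 3 (4 * m) = padic 3 m" using padic_mult[OF Q, of 4 m] padic_unit[OF Q, of 4] by simp
  moreover have "h = (5 + m * (m - 2)) / (4 * m)" by (simp add: h_def algebra_simps power2_eq_square)
  ultimately have H: "padic 3 h = 1 / padic 3 m" by (simp add: padic_divide[OF Q])
  have H1: "padic 3 h > 1" unfolding H using m3 padic_pos[OF Q m0] by simp
  \<comment> \<open>Since \<open>h\<close> is 3-adically large, shifts by 1 do not change its size;
    \<open>x\<close> then has the size of \<open>1 / h\<close>, which is that of
    \<open>m\<close>.\<close>
  have "padic 3 (h - 1) = padic 3 h" "padic 3 (h + 1) = padic 3 h"
    using padic_add_eq[OF Q, of "- 1" h] padic_add_eq[OF Q, of 1 h] H1 padic_minus[OF Q, of 1]
    by (simp_all add: padic_1[OF Q])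
  moreover have "padic 3 4 = 1" using padic_unit[OF Q, of 4] by simp
  moreover have "h\<^sup>2 - 1 = (h - 1) * (h + 1)" by (simp add: algebra_simps power2_eq_square)
  ultimately have "padic 3 x = padic 3 h ^ 4 / ((padic 3 h * padic 3 h)\<^sup>2 * padic 3 h)"
    by (simp add: x_def padic_divide[OF Q] padic_mult[OF Q] padic_power[OF Q])
  also have "\<dots> = 1 / padic 3 h" using H1 by (simp add: power2_eq_square power4_eq_xxxx)
  also have "\<dots> = padic 3 m" unfolding H by simp
  finally show ?thesis using F.triple F.torsion_Z2_Z10 prod by blast
qed

lemma infinitely_many_triples:
  assumes m: "padic 5 (m + 1) < 1" "padic 3 m \<le> 1 / 9" and w: "m * (m\<^sup>2 - 2 * m + 5) = of_int d * w\<^sup>2"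
  shows "infinite {{a, b, c} | a b c. good_triple K a b c}"
proof -
  define \<mu> where "\<mu> n = (tripling ^^ n) m" for n
  have inv: "padic 5 (\<mu> n + 1) < 1 \<and> padic 3 (\<mu> n) = padic 3 m / 9 ^ n \<and>
      (\<exists>w. \<mu> n * ((\<mu> n)\<^sup>2 - 2 * \<mu> n + 5) = of_int d * w\<^sup>2)" for n
  proof (induction n)
    case 0
    then show ?case using m w by (auto simp: \<mu>_def)
  next
    case (Suc n)
    have s: "\<mu> (Suc n) = tripling (\<mu> n)" by (simp add: \<mu>_def)
    have "padic 3 m / 9 ^ n \<le> padic 3 m / 1"
      using padic_nonneg[OF prime_3, of m] by (intro divide_left_mono) simp_all
    then have "padic 3 m / 9 ^ n \<le> 1 / 9" using m(2) by linarith
    then have "padic 3 (\<mu> n) \<le> 1 / 9" using Suc by simp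
    from padic_3_tripling[OF this] have "padic 3 (\<mu> (Suc n)) = padic 3 m / 9 ^ Suc n" using Suc s by simp
    moreover have "trip_den (\<mu> n) \<noteq> 0" "padic 5 (\<mu> (Suc n) + 1) < 1"
      using tripling_mod_5[of "\<mu> n"] Suc s by auto
    moreover have "\<exists>w. \<mu> (Suc n) * ((\<mu> (Suc n))\<^sup>2 - 2 * \<mu> (Suc n) + 5) = of_int d * w\<^sup>2"
      using tripling_curve[OF calculation(2)] Suc s by auto
    ultimately show ?case by blast
  qed
  have m0: "padic 3 m > 0"
  proof -
    have "m \<noteq> 0" using m(1) padic_1[OF prime_5] by auto
    then show ?thesis by (rule padic_pos[OF prime_3])
  qed
  let ?F = "{{a, b, c} | a b c. good_triple K a b c}"
  \<comment> \<open>The triples are counted as sets, so they are separated by an invariant of the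
    set: the 3-adic size of its squared product, which drops by the factor 9 at each
    tripling.\<close>
  have "\<exists>S. S \<in> ?F \<and> (\<exists>x. (\<Prod>S)\<^sup>2 = of_rat x \<and> padic 3 x = padic 3 m / 9 ^ n)" for n
  proof -
    obtain w where w: "\<mu> n * ((\<mu> n)\<^sup>2 - 2 * \<mu> n + 5) = of_int d * w\<^sup>2" using inv by blast
    have "padic 3 m / 9 ^ n \<le> padic 3 m" using m0 by (simp add: divide_le_eq)
    moreover have "padic 3 (\<mu> n) = padic 3 m / 9 ^ n" using inv by blast
    ultimately have "padic 3 (\<mu> n) < 1" using m(2) by linarith
    from parameter_triple[OF _ w this] inv[of n]
    obtain a b c x where abc: "good_triple K a b c" "(a * b * c)\<^sup>2 = of_rat x" "padic 3 x = padic 3 (\<mu> n)" by blast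
    have "\<Prod>{a, b, c} = a * b * c" using abc(1) by (simp add: diophantine_triple_def mult.assoc)
    then have "(\<Prod>{a, b, c})\<^sup>2 = of_rat x \<and> padic 3 x = padic 3 m / 9 ^ n" using abc inv[of n] by simp
    moreover have "{a, b, c} \<in> ?F" using abc by blast
    ultimately show ?thesis by blast
  qed
  then have "\<forall>n. \<exists>S. S \<in> ?F \<and> (\<exists>x. (\<Prod>S)\<^sup>2 = of_rat x \<and> padic 3 x = padic 3 m / 9 ^ n)" by (rule allI)
  from choice[OF this] obtain S where S: "\<forall>n. S n \<in> ?F \<and> (\<exists>x. (\<Prod>(S n))\<^sup>2 = of_rat x \<and> padic 3 x = padic 3 m / 9 ^ n)"
    by (rule exE)
  have "inj S"
  proof (rule injI)
    fix i j assume e: "S i = S j"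
    obtain x where x: "(\<Prod>(S i))\<^sup>2 = of_rat x" "padic 3 x = padic 3 m / 9 ^ i" using S by blast
    obtain y where y: "(\<Prod>(S j))\<^sup>2 = of_rat y" "padic 3 y = padic 3 m / 9 ^ j" using S by blast
    have "of_rat x = (of_rat y :: complex)" unfolding x(1)[symmetric] y(1)[symmetric] e ..
    then have "x = y" by simp
    then have "padic 3 m / 9 ^ i = padic 3 m / 9 ^ j" using x(2) y(2) by (simp only:)
    then have "(9::real) ^ i = 9 ^ j" using m0 by auto
    then show "i = j" by simp
  qed
  then have "infinite (range S)" by (rule range_inj_infinite)
  moreover have "range S \<subseteq> ?F" using S by blast
  ultimately show ?thesis using infinite_super by blast
qed

end

text \<open>Given a prime \<open>p > 5\<close>, the start value \<open>m = 9 p e\<close> with \<open>p e\<close> congruent to 1 modulo 5 makes \<open>p\<close>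
ramify in the field.\<close>

definition start :: "nat \<Rightarrow> int" where
  "start p = 9 * int p * (SOME e. 0 < e \<and> e < 5 \<and> (int p * e) mod 5 = 1)"

definition disc :: "nat \<Rightarrow> int" where
  "disc p = start p * ((start p)\<^sup>2 - 2 * start p + 5)"

definition field_of :: "nat \<Rightarrow> complex set" where
  "field_of p = quad_field (csqrt (of_int (disc p)))"

lemma start_props:
  assumes "prime p" "p > 5"
  shows "\<exists>e. start p = 9 * int p * e \<and> 0 < e \<and> e < 5 \<and> (int p * e) mod 5 = 1"
proof -
  have "\<not> 5 dvd p" using assms by (metis prime_nat_iff less_irrefl numeral_eq_one_iff semiring_norm(86))
  then have "int p mod 5 = 1 \<or> int p mod 5 = 2 \<or> int p mod 5 = 3 \<or> int p mod 5 = 4" by presburger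
  then have "\<exists>e. 0 < e \<and> e < 5 \<and> (int p * e) mod 5 = 1"
    by (elim disjE) (rule exI[of _ 1] exI[of _ 3] exI[of _ 2] exI[of _ 4]; simp; presburger)+
  from someI_ex[OF this] show ?thesis unfolding start_def by blast
qed

text \<open>\<open>start p\<close> is 9 modulo 45, hence divisible by 9 and congruent to -1 modulo
  5; \<open>disc p\<close> is then congruent to 9 * 68, that is to 2, modulo 5. The prime
  \<open>p > 5\<close> divides \<open>disc p\<close> exactly once, since it divides none of 9,
  \<open>e\<close> and 5.\<close>

lemma field_of_inert:
  assumes "prime p" "p > 5"
  shows "inert_quadratic (disc p) (csqrt (of_int (disc p)))"
    and "padic 5 (of_int (start p) + 1) < 1" and "padic 3 (of_int (start p)) \<le> 1 / 9"
    and "padic p (of_int (disc p)) = 1 / real p"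
proof -
  obtain e where e: "start p = 9 * int p * e" "0 < e" "e < 5" "(int p * e) mod 5 = 1" using start_props[OF assms] by blast
  obtain t where "int p * e = 1 + 5 * t" using e(4) by (metis mult_div_mod_eq add.commute)
  then have st: "start p = 9 + 45 * t" using e(1) by (simp add: mult.assoc)
  show "inert_quadratic (disc p) (csqrt (of_int (disc p)))"
  proof
    have "disc p = 2 + 5 * (122 + 1908 * t + 10125 * (t * t) + 18225 * (t * t * t))"
      unfolding disc_def st by (simp add: algebra_simps power2_eq_square)
    then obtain z where "disc p = 2 + 5 * z" by blast
    then show "disc p mod 5 = 2" by presburger
  qed simp
  have "5 dvd start p + 1" unfolding st by presburger
  then show "padic 5 (of_int (start p) + 1) < 1"
    using padic_of_int_less_iff[OF prime_5, of "start p + 1"] by simp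
  have "padic 3 (of_int (start p)) = padic 3 3 * padic 3 3 * padic 3 (of_int (int p * e))"
    unfolding e(1) by (simp add: mult.assoc flip: padic_mult[OF prime_3])
  moreover have "padic 3 3 = 1 / 3" using padic_of_int[OF prime_3, of 3] by simp
  ultimately show "padic 3 (of_int (start p)) \<le> 1 / 9"
    using padic_of_int_le[OF prime_3, of "int p * e"] by simp
  have pi: "prime (int p)" using assms by simp
  have small: "\<not> int p dvd n" if "0 < n" "n \<le> 5" for n
    using zdvd_imp_le[of "int p" n] that assms(2) by auto
  have pp: "padic p (of_nat p) = 1 / real p"
    using padic_of_int[OF assms(1), of "int p"] assms pi prime_gt_1_int[OF pi] by (simp add: multiplicity_self)
  have 9: "padic p 9 = 1"
  proof -
    have "\<not> int p dvd 3" by (rule small) simp_all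
    then have "padic p 3 = 1" using padic_unit[OF assms(1), of 3] by simp
    then show ?thesis using padic_mult[OF assms(1), of 3 3] by simp
  qed
  have ee: "padic p (of_int e) = 1" using padic_unit[OF assms(1)] small[of e] e by simp
  have "\<not> int p dvd (start p)\<^sup>2 - 2 * start p + 5"
  proof
    assume "int p dvd (start p)\<^sup>2 - 2 * start p + 5"
    moreover have "int p dvd (start p)\<^sup>2 - 2 * start p" unfolding e(1) power2_eq_square by simp
    ultimately have "int p dvd 5" by (metis dvd_add_right_iff)
    then show False using small[of 5] by simp
  qed
  from padic_unit[OF assms(1) this]
  show "padic p (of_int (disc p)) = 1 / real p"
    unfolding disc_def e(1) using 9 ee pp by (simp add: padic_mult[OF assms(1)])
qed

text \<open>Comparing coordinates in the square of the root of \<open>disc q\<close> gives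
  \<open>disc q = disc p * v^2\<close> with \<open>v\<close> rational, because \<open>disc q\<close>
  is not a rational square. If \<open>q\<close> did not divide \<open>disc p\<close>, then
  \<open>v^2\<close> would have odd valuation at \<open>q\<close>.\<close>

lemma field_of_eq_imp_dvd:
  assumes p: "prime p" "p > 5" and q: "prime q" "q > 5" and eq: "field_of p = field_of q"
  shows "int q dvd disc p"
proof -
  interpret P: inert_quadratic "disc p" "csqrt (of_int (disc p))" using field_of_inert[OF p] by blast
  interpret Q: inert_quadratic "disc q" "csqrt (of_int (disc q))" using field_of_inert[OF q] by blast
  let ?s = "csqrt (of_int (disc p))" and ?t = "csqrt (of_int (disc q))"
  have "?t \<in> quad_field ?s" using Q.s_K eq by (simp add: field_of_def)
  then obtain u v where uv: "?t = P.qelt u v" by (rule P.K_cases)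
  have "P.qelt (of_int (disc q)) 0 = ?t * ?t" using Q.s_sq by (simp add: power2_eq_square)
  also have "\<dots> = P.qelt (u * u + of_int (disc p) * (v * v)) (u * v + v * u)" unfolding uv by (rule P.qelt_mult)
  finally have e: "of_int (disc q) = u * u + of_int (disc p) * (v * v)" "0 = u * v + v * u"
    unfolding P.qelt_eq by auto
  have "v \<noteq> 0"
  proof
    assume "v = 0"
    then have "u\<^sup>2 - of_int (disc q) * 1\<^sup>2 = 0" using e by (simp add: power2_eq_square)
    from Q.norm_form_0[OF this] show False by simp
  qed
  then have "u = 0" using e(2) by simp
  then have d: "of_int (disc q) = of_int (disc p) * v\<^sup>2" using e(1) by (simp add: power2_eq_square)
  show ?thesis
  proof (rule ccontr)
    assume "\<not> int q dvd disc p"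
    then have "padic q (of_int (disc p)) = 1" by (rule padic_unit[OF q(1)])
    then have "padic q (v\<^sup>2) = 1 / real q"
      using field_of_inert(4)[OF q] unfolding d by (simp add: padic_mult[OF q(1)])
    then show False using padic_square_neq[OF q(1)] by blast
  qed
qed

theorem theorem1:
  shows "infinite {K. quadratic_field K \<and>
           infinite {{a, b, c} | a b c. diophantine_triple K a b c \<and>
              ec_torsion_group K a b c \<cong> (integer_mod_group 2 \<times>\<times> integer_mod_group 10)}}"
proof -
  let ?P = "{p::nat. prime p \<and> p > 5}"
  have good: "field_of p \<in> {K. quadratic_field K \<and>
           infinite {{a, b, c} | a b c. good_triple K a b c}}" if "p \<in> ?P" for p
  proof -
    have p: "prime p" "p > 5" using that by auto
    note f = field_of_inert[OF p]
    interpret inert_quadratic "disc p" "csqrt (of_int (disc p))" by (rule f(1))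
    have "of_int (start p) * ((of_int (start p))\<^sup>2 - 2 * of_int (start p) + 5) = of_int (disc p) * (1::rat)\<^sup>2"
      by (simp add: disc_def)
    from infinitely_many_triples[OF f(2,3) this] quadratic_field
    show ?thesis unfolding field_of_def by blast
  qed
  have "infinite ?P"
  proof
    assume "finite ?P"
    then have "finite (?P \<union> {..5})" by simp
    then have "finite {p::nat. prime p}" by (rule rev_finite_subset) auto
    then show False using primes_infinite by blast
  qed
  have "infinite (field_of ` ?P)"
  proof
    assume "finite (field_of ` ?P)"
    \<comment> \<open>All primes that share the field of \<open>p\<close> divide the nonzero integer
      \<open>disc p\<close>, so no field can arise from infinitely many primes.\<close>
    then obtain p where p: "p \<in> ?P" "infinite {q \<in> ?P. field_of q = field_of p}"
      using pigeonhole_infinite[OF \<open>infinite ?P\<close>] by blast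
    have "disc p \<noteq> 0"
      using field_of_inert(4)[of p] p(1) by auto
    then have "finite {q. int q dvd disc p}"
      using finite_vimageI[OF finite_divisors_int[of "disc p"] inj_of_nat] by (simp add: vimage_def)
    moreover have "{q \<in> ?P. field_of q = field_of p} \<subseteq> {q. int q dvd disc p}"
      using field_of_eq_imp_dvd p(1) by auto
    ultimately show False using p(2) finite_subset by blast
  qed
  moreover have "field_of ` ?P \<subseteq> {K. quadratic_field K \<and>
           infinite {{a, b, c} | a b c. good_triple K a b c}}"
    using good by (rule image_subsetI)
  ultimately show ?thesis by (rule infinite_super[rotated])
qed

end
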